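(* For $m\in\mathbb{N}$, let $\mathbf{G}\le\mathrm{GL}_{2m+2}$ be the algebraic automorphism group of the $\mathbb{Z}$-Lie lattice (scheme) $L=L_{t^m}$. Let $\mathbf{G}_0\trianglelefteq\mathbf{G}$ be the affine subgroup consisting of all automorphisms that fix pointwise the centre of $L$. Then $\mathbf{G}$ splits as $$\mathbf{G}\cong\mathbf{B}_2\ltimes\mathbf{G}_0,$$ where, for every field extension $k$ of $\mathbb{Q}$, the group $\mathbf{B}_2(k)$ is the group of invertible lower-triangular $2\times2$ matrices over $k$, and $$\mathbf{G}_0(k)\cong\mathrm{SL}_2(R)\ltimes\mathsf{V}_{\mathrm{st}}(R)^{\oplus2},\qquad\text{for } R=k[t]/(t^m)\text{ and }\mathsf{V}_{\mathrm{st}}(R)=R^2,$$ with respect to the standard left action. In particular, the algebraic group $\mathbf{G}$ is connected.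
   Context: $L_{t^m}$ is the $\mathbb{Z}$-Lie lattice (free $\mathbb{Z}$-module with Lie bracket) of rank $2m+2$ with basis $\mathcal{S}=(x_1,\dots,x_m,y_1,\dots,y_m,z_1,z_2)$ and bracket $[x_i,y_j]=\delta_{i,j}z_1+\delta_{i+1,j}z_2$, $[x_i,x_j]=[y_i,y_j]=0$ for $1\le i,j\le m$, with $z_1,z_2$ central ($\delta$ is the Kronecker delta); its centre is $\mathbb{Z}z_1+\mathbb{Z}z_2$. The algebraic automorphism group $\mathbf{G}=\mathbf{Aut}(L)$ is the affine $\mathbb{Z}$-group scheme, realised in $\mathrm{GL}_{2m+2}$ via the basis $\mathcal{S}$, with $\mathbf{G}(k)\cong\mathrm{Aut}(k\otimes_{\mathbb{Z}}L)$ for every extension field $k$ of $\mathbb{Q}$; coordinates are row vectors and matrices act from the right. The group $\mathbf{G}_0(k)$ consists of those elements of $\mathbf{G}(k)$ that fix $k\otimes_{\mathbb{Z}}\mathrm{Z}(L)$ pointwise. *)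

theory Defs
  imports
    "HOL-Analysis.Abstract_Topology"
    "HOL-Algebra.Algebra"
    "HOL-Algebra.Algebraic_Closure_Type"
    "Jordan_Normal_Form.Determinant"
    "Jordan_Normal_Form.VS_Connect"
begin

section \<open>The Lie lattice and its automorphism group\<close>

text \<open>
  An element is its row vector of \<open>2m+2\<close> coordinates with respect to the basis
  \<open>x_1,\<dots>,x_m, y_1,\<dots>,y_m, z_1, z_2\<close>.  With coordinates counted from 0, the unit vectors
  with indices \<open>i-1\<close>, \<open>m+j-1\<close>, \<open>2m\<close>, \<open>2m+1\<close> are \<open>x_i\<close>, \<open>y_j\<close>, \<open>z_1\<close>, \<open>z_2\<close>.  At type
  \<^typ>\<open>int\<close> the definitions describe the lattice \<open>L\<close>; over a commutative ring \<open>k\<close> they describe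
  its base change, as the structure constants are integers.
\<close>

abbreviation lie_rank :: "nat \<Rightarrow> nat" where
  "lie_rank m \<equiv> 2 * m + 2"

definition xy_bracket :: "nat \<Rightarrow> nat \<Rightarrow> nat \<Rightarrow> 'a::comm_ring_1 vec" where
  "xy_bracket m i j =
     of_bool (i = j) \<cdot>\<^sub>v unit_vec (lie_rank m) (2 * m)
     + of_bool (i + 1 = j) \<cdot>\<^sub>v unit_vec (lie_rank m) (2 * m + 1)"

definition basis_bracket :: "nat \<Rightarrow> nat \<Rightarrow> nat \<Rightarrow> 'a::comm_ring_1 vec" where
  "basis_bracket m a b =
     (if a < m \<and> m \<le> b \<and> b < 2 * m then xy_bracket m a (b - m)
      else if m \<le> a \<and> a < 2 * m \<and> b < m then - xy_bracket m b (a - m)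
      else 0\<^sub>v (lie_rank m))"

definition lie_bracket :: "nat \<Rightarrow> 'a::comm_ring_1 vec \<Rightarrow> 'a vec \<Rightarrow> 'a vec" where
  "lie_bracket m u v =
     vec (lie_rank m)
       (\<lambda>c. \<Sum>a<lie_rank m. \<Sum>b<lie_rank m. u $ a * v $ b * basis_bracket m a b $ c)"

definition lie_centre :: "nat \<Rightarrow> 'a::comm_ring_1 vec set" where
  "lie_centre m =
     {z \<in> carrier_vec (lie_rank m).
        \<forall>v \<in> carrier_vec (lie_rank m). lie_bracket m z v = 0\<^sub>v (lie_rank m)}"

text \<open>\<open>k \<otimes> Z(L)\<close>, as the \<open>k\<close>-span in \<open>k \<otimes> L\<close> of the centre of the integral lattice \<open>L\<close>.\<close>

definition ext_centre :: "nat \<Rightarrow> 'k::field vec set" where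
  "ext_centre m =
     LinearCombinations.module.span class_ring (module_vec TYPE('k) (lie_rank m))
       (map_vec of_int ` (lie_centre m :: int vec set))"

text \<open>Matrices act on row vectors from the right: \<open>v \<mapsto> v M\<close>.\<close>

definition row_act :: "'a::comm_ring_1 vec \<Rightarrow> 'a mat \<Rightarrow> 'a vec" where
  "row_act v M = transpose_mat M *\<^sub>v v"

definition GL :: "nat \<Rightarrow> 'a::comm_ring_1 mat monoid" where
  "GL n = units_of (ring_mat TYPE('a) n ())"

definition lie_Aut :: "nat \<Rightarrow> 'a::comm_ring_1 mat monoid" where
  "lie_Aut m = GL (lie_rank m)
     \<lparr>carrier := {M \<in> carrier (GL (lie_rank m)).
        \<forall>u \<in> carrier_vec (lie_rank m). \<forall>v \<in> carrier_vec (lie_rank m).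
          lie_bracket m (row_act u M) (row_act v M) = row_act (lie_bracket m u v) M}\<rparr>"

definition lie_Aut0 :: "nat \<Rightarrow> 'k::field mat monoid" where
  "lie_Aut0 m = lie_Aut m
     \<lparr>carrier := {M \<in> carrier (lie_Aut m). \<forall>z \<in> ext_centre m. row_act z M = z}\<rparr>"

definition B2 :: "'a::comm_ring_1 mat monoid" where
  "B2 = GL 2 \<lparr>carrier := {M \<in> carrier (GL 2). \<forall>i<2. \<forall>j<2. i < j \<longrightarrow> M $$ (i, j) = 0}\<rparr>"

section \<open>Semidirect products\<close>

definition semidirect ::
  "('h, 'b) monoid_scheme \<Rightarrow> ('n, 'c) monoid_scheme \<Rightarrow> ('h \<Rightarrow> 'n \<Rightarrow> 'n) \<Rightarrow> ('h \<times> 'n) monoid" where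
  "semidirect H N \<theta> =
     \<lparr>carrier = carrier H \<times> carrier N,
      monoid.mult = (\<lambda>(h, n) (h', n'). (h \<otimes>\<^bsub>H\<^esub> h', n \<otimes>\<^bsub>N\<^esub> \<theta> h n')),
      one = (\<one>\<^bsub>H\<^esub>, \<one>\<^bsub>N\<^esub>)\<rparr>"

text \<open>The truncated polynomial ring \<open>k[t]/(t^m)\<close>.\<close>

definition trunc_ring :: "nat \<Rightarrow> 'k::field poly set ring" where
  "trunc_ring m =
     (ring_of_type_algebra :: 'k poly ring) Quot
       (PIdl\<^bsub>(ring_of_type_algebra :: 'k poly ring)\<^esub> (monom 1 m))"

text \<open>The matrix with rows \<open>(a, b)\<close> and \<open>(c, d)\<close> is encoded as \<open>((a, b), (c, d))\<close>.\<close>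

definition SL2 :: "('r, 'b) ring_scheme \<Rightarrow> (('r \<times> 'r) \<times> ('r \<times> 'r)) monoid" where
  "SL2 R =
     \<lparr>carrier = {((a, b), (c, d)) | a b c d.
        a \<in> carrier R \<and> b \<in> carrier R \<and> c \<in> carrier R \<and> d \<in> carrier R
        \<and> a \<otimes>\<^bsub>R\<^esub> d \<ominus>\<^bsub>R\<^esub> b \<otimes>\<^bsub>R\<^esub> c = \<one>\<^bsub>R\<^esub>},
      monoid.mult = (\<lambda>((a, b), (c, d)) ((a', b'), (c', d')).
        ((a \<otimes>\<^bsub>R\<^esub> a' \<oplus>\<^bsub>R\<^esub> b \<otimes>\<^bsub>R\<^esub> c', a \<otimes>\<^bsub>R\<^esub> b' \<oplus>\<^bsub>R\<^esub> b \<otimes>\<^bsub>R\<^esub> d'),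
         (c \<otimes>\<^bsub>R\<^esub> a' \<oplus>\<^bsub>R\<^esub> d \<otimes>\<^bsub>R\<^esub> c', c \<otimes>\<^bsub>R\<^esub> b' \<oplus>\<^bsub>R\<^esub> d \<otimes>\<^bsub>R\<^esub> d'))),
      one = ((\<one>\<^bsub>R\<^esub>, \<zero>\<^bsub>R\<^esub>), (\<zero>\<^bsub>R\<^esub>, \<one>\<^bsub>R\<^esub>))\<rparr>"

definition V_st :: "('r, 'b) ring_scheme \<Rightarrow> ('r \<times> 'r) monoid" where
  "V_st R = add_monoid R \<times>\<times> add_monoid R"

definition V_st_act :: "('r, 'b) ring_scheme \<Rightarrow> ('r \<times> 'r) \<times> ('r \<times> 'r) \<Rightarrow> 'r \<times> 'r \<Rightarrow> 'r \<times> 'r" where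
  "V_st_act R = (\<lambda>((a, b), (c, d)) (v, w).
     (a \<otimes>\<^bsub>R\<^esub> v \<oplus>\<^bsub>R\<^esub> b \<otimes>\<^bsub>R\<^esub> w, c \<otimes>\<^bsub>R\<^esub> v \<oplus>\<^bsub>R\<^esub> d \<otimes>\<^bsub>R\<^esub> w))"

definition SL2_V_st_V_st ::
  "('r, 'b) ring_scheme \<Rightarrow> ((('r \<times> 'r) \<times> ('r \<times> 'r)) \<times> (('r \<times> 'r) \<times> ('r \<times> 'r))) monoid" where
  "SL2_V_st_V_st R =
     semidirect (SL2 R) (V_st R \<times>\<times> V_st R) (\<lambda>g. map_prod (V_st_act R g) (V_st_act R g))"

section \<open>Morphisms of algebraic groups and the Zariski topology\<close>

inductive_set poly_funs :: "'a::comm_ring_1 set \<Rightarrow> ('x \<Rightarrow> 'a) set \<Rightarrow> ('x \<Rightarrow> 'a) set"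
  for A :: "'a set" and V :: "('x \<Rightarrow> 'a) set" where
  const: "c \<in> A \<Longrightarrow> (\<lambda>_. c) \<in> poly_funs A V"
| coord: "f \<in> V \<Longrightarrow> f \<in> poly_funs A V"
| add: "f \<in> poly_funs A V \<Longrightarrow> g \<in> poly_funs A V \<Longrightarrow> (\<lambda>x. f x + g x) \<in> poly_funs A V"
| mult: "f \<in> poly_funs A V \<Longrightarrow> g \<in> poly_funs A V \<Longrightarrow> (\<lambda>x. f x * g x) \<in> poly_funs A V"

definition mat_coords :: "nat \<Rightarrow> ('a mat \<Rightarrow> 'a) set" where
  "mat_coords n = {\<lambda>M. M $$ (i, j) | i j. i < n \<and> j < n}"

definition GL_coords :: "nat \<Rightarrow> ('a::field mat \<Rightarrow> 'a) set" where
  "GL_coords n = insert (\<lambda>M. inverse (det M)) (mat_coords n)"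

definition prod_coords :: "('x \<Rightarrow> 'a) set \<Rightarrow> ('y \<Rightarrow> 'a) set \<Rightarrow> ('x \<times> 'y \<Rightarrow> 'a) set" where
  "prod_coords V W = (\<lambda>f. f \<circ> fst) ` V \<union> (\<lambda>f. f \<circ> snd) ` W"

text \<open>
  The map \<open>\<Phi>\<close> on the point set \<open>S\<close> is given by a morphism of varieties defined over \<open>\<rat>\<close>: the
  coordinate functions \<open>W\<close> of the target pull back to polynomials with rational coefficients in
  the coordinate functions \<open>V\<close> of the source.
\<close>

definition rat_morphism ::
  "'x set \<Rightarrow> ('x \<Rightarrow> 'k::field_char_0) set \<Rightarrow> ('y \<Rightarrow> 'k) set \<Rightarrow> ('x \<Rightarrow> 'y) \<Rightarrow> bool" where
  "rat_morphism S V W \<Phi> \<longleftrightarrow> (\<forall>f \<in> W. \<exists>p \<in> poly_funs \<rat> V. \<forall>x \<in> S. f (\<Phi> x) = p x)"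

definition rat_iso ::
  "('x, 'b) monoid_scheme \<Rightarrow> ('x \<Rightarrow> 'k::field_char_0) set \<Rightarrow>
   ('y, 'c) monoid_scheme \<Rightarrow> ('y \<Rightarrow> 'k) set \<Rightarrow> ('x \<Rightarrow> 'y) \<Rightarrow> bool" where
  "rat_iso A V B W \<Phi> \<longleftrightarrow>
     \<Phi> \<in> iso A B \<and> rat_morphism (carrier A) V W \<Phi>
     \<and> rat_morphism (carrier B) W V (inv_into (carrier A) \<Phi>)"

text \<open>
  The Zariski topology on all \<open>n \<times> n\<close> matrices, generated by the principal open sets (which are
  closed under intersection); on subsets of \<open>GL\<close> it induces the same topology as that of \<open>GL\<close>.
\<close>

definition zariski :: "nat \<Rightarrow> 'a::field mat topology" where
  "zariski n = topology_generated_by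
     {{M \<in> carrier_mat n n. p M \<noteq> 0} | p. p \<in> poly_funs UNIV (mat_coords n)}"

end

theory Submission
  imports Defs
begin

text \<open>
  Let \<open>V\<close> be the span of the \<open>x\<^sub>i\<close> and \<open>y\<^sub>j\<close>.  The \<open>z\<^sub>1\<close>- and \<open>z\<^sub>2\<close>-coordinates of the bracket are two
  alternating forms \<open>B\<^sub>1\<close>, \<open>B\<^sub>2\<close> on \<open>V\<close>, with Gram matrices \<open>skew 1\<close> and \<open>skew N\<close> for the nilpotent \<open>m \<times> m\<close>
  shift \<open>N\<close>.  So \<open>B\<^sub>1\<close> is nondegenerate, and \<open>B\<^sub>2(u, v) = B\<^sub>1(t u, v)\<close> for the nilpotent operator \<open>t\<close> that
  shifts the \<open>x\<^sub>i\<close> up and the \<open>y\<^sub>j\<close> down.  This makes \<open>V\<close> a free module of rank 2 over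
  \<open>R = k[t]/(t\<^sup>m)\<close>, with basis \<open>x\<^sub>1\<close>, \<open>y\<^sub>m\<close>, and \<open>B\<^sub>1(u, v)\<close> is the coefficient of \<open>t\<^bsup>m-1\<^esup>\<close> in
  \<open>det (u, v)\<close>.

  An automorphism preserves the centre, so it is a block matrix with diagonal blocks \<open>A\<close> on \<open>V\<close> and \<open>D\<close> on
  the centre, and \<open>A\<close> transforms \<open>(B\<^sub>1, B\<^sub>2)\<close> through \<open>D\<close> (\<open>lie_Aut_iff\<close>).  A combination
  \<open>\<lambda> B\<^sub>1 + \<mu> B\<^sub>2\<close> is degenerate iff \<open>\<lambda> = 0\<close>; hence \<open>D\<close> is lower triangular, and \<open>\<^bold>G\<^sub>0\<close> is the
  kernel of the homomorphism to \<open>\<^bold>B\<^sub>2\<close> sending a matrix to \<open>D\<close>.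

  On \<open>\<^bold>G\<^sub>0\<close> the block \<open>A\<close> is an isometry of both forms, so it commutes with \<open>t\<close>: it is an \<open>R\<close>-linear map
  preserving the top coefficient of the determinant form, and therefore lies in \<open>SL\<^sub>2(R)\<close>
  (\<open>aut_blocks_one_iff\<close>).  The upper right block is arbitrary; its two columns are the two vectors of the
  standard module (\<open>lie_Aut0_iso\<close>).  In matrices, \<open>R\<close> is the ring of lower triangular Toeplitz matrices,
  and the order of the \<open>x\<^sub>i\<close> has to be reversed.

  To split \<open>\<^bold>G \<rightarrow> \<^bold>B\<^sub>2\<close>, let \<open>b\<close> have the entries \<open>c\<close>, \<open>a\<close>, \<open>d\<close> at the positions \<open>(0, 0)\<close>,
  \<open>(1, 0)\<close>, \<open>(1, 1)\<close>.  A lift of \<open>b\<close> must act on \<open>V\<close> semilinearly over the substitution \<open>t \<mapsto> c t / (d - a t)\<close>.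
  Requiring that it fixes \<open>x\<^sub>1\<close> and keeps the spans of the \<open>x\<^sub>i\<close> and of the \<open>y\<^sub>j\<close> determines it: on the
  \<open>x\<^sub>i\<close> it is the substitution itself, and on the \<open>y\<^sub>j\<close> it is forced by duality.  By uniqueness the lifts
  multiply like the elements of \<open>\<^bold>B\<^sub>2\<close> (\<open>subst_mat_mult\<close>, \<open>dual_mat_mult\<close>), and their entries are
  given by a recursion in \<open>c\<close>, \<open>a\<close>, \<open>d\<close> and \<open>1/d\<close>, so that everything is a morphism over \<open>\<rat>\<close>.

  For connectedness, every automorphism is a product of factors each of which lies on a rational curve through the
  identity: lifts of \<open>1 + s (b - 1)\<close>, elementary matrices over \<open>R\<close> with entry \<open>s u\<close>, and
  matrices with \<open>A = 1\<close>, \<open>D = 1\<close> and upper right block \<open>s C\<close> (\<open>connected_lie_Aut\<close>).  Such a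
  curve is connected in the Zariski topology because two nonempty open subsets of the affine line over an infinite field
  meet.
\<close>

(* The rule would rewrite the rank 2 * m + 2 to Suc (Suc (2 * m)). *)
declare add_2_eq_Suc' [simp del]

section \<open>The Gram matrices of the bracket\<close>

definition shift_mat :: "nat \<Rightarrow> 'a::comm_ring_1 mat" where
  "shift_mat m = mat m m (\<lambda>(i, j). of_bool (i + 1 = j))"

text \<open>
  The Gram matrix of an alternating form for which the \<open>x\<^sub>i\<close> and the \<open>y\<^sub>j\<close> span isotropic subspaces.
\<close>

definition skew :: "nat \<Rightarrow> 'a::comm_ring_1 mat \<Rightarrow> 'a mat" where
  "skew m F = four_block_mat (0\<^sub>m m m) F (- transpose_mat F) (0\<^sub>m m m)"

text \<open>The same form, extended by zero to the centre.\<close>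

definition gram :: "nat \<Rightarrow> 'a::comm_ring_1 mat \<Rightarrow> 'a mat" where
  "gram m F = four_block_mat (skew m F) (0\<^sub>m (2 * m) 2) (0\<^sub>m 2 (2 * m)) (0\<^sub>m 2 2)"

lemma shift_mat_carrier [simp]: "shift_mat m \<in> carrier_mat m m"
  by (simp add: shift_mat_def)

lemma shift_mat_dim [simp]: "dim_row (shift_mat m) = m" "dim_col (shift_mat m) = m"
  by (simp_all add: shift_mat_def)

lemma skew_carrier' [simp]: "skew m F \<in> carrier_mat (m + m) (m + m)"
  by (simp add: skew_def)

lemma skew_carrier [simp]: "skew m F \<in> carrier_mat (2 * m) (2 * m)"
  by (simp add: skew_def mult_2)

lemma skew_dim [simp]: "dim_row (skew m F) = 2 * m" "dim_col (skew m F) = 2 * m"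
  by (simp_all add: skew_def)

lemma gram_carrier [simp]: "gram m F \<in> carrier_mat (lie_rank m) (lie_rank m)"
  unfolding gram_def by (rule four_block_carrier_mat) simp_all

lemma gram_dim [simp]: "dim_row (gram m F) = lie_rank m" "dim_col (gram m F) = lie_rank m"
  by (simp_all add: gram_def)

lemma skew_add:
  assumes "F \<in> carrier_mat m m" "Y \<in> carrier_mat m m"
  shows "skew m (F + Y) = skew m F + skew m Y"
  unfolding skew_def using assms by (intro eq_matI) auto

lemma skew_smult:
  assumes "F \<in> carrier_mat m m"
  shows "skew m (c \<cdot>\<^sub>m F) = c \<cdot>\<^sub>m skew m F"
  unfolding skew_def using assms by (intro eq_matI) auto

lemma gram_add:
  assumes "F \<in> carrier_mat m m" "Y \<in> carrier_mat m m"
  shows "gram m (F + Y) = gram m F + gram m Y"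
  unfolding gram_def skew_add[OF assms] by (intro eq_matI) auto

lemma gram_smult:
  assumes "F \<in> carrier_mat m m"
  shows "gram m (c \<cdot>\<^sub>m F) = c \<cdot>\<^sub>m gram m F"
  unfolding gram_def skew_smult[OF assms] by (intro eq_matI) auto

lemma skew_inject:
  assumes "F \<in> carrier_mat m m" "Y \<in> carrier_mat m m"
  shows "skew m F = skew m Y \<longleftrightarrow> F = Y"
proof
  assume eq: "skew m F = skew m Y"
  show "F = Y"
  proof (rule eq_matI)
    fix i j assume "i < dim_row Y" "j < dim_col Y"
    then have "skew m F $$ (i, m + j) = F $$ (i, j)" "skew m Y $$ (i, m + j) = Y $$ (i, j)"
      using assms by (auto simp: skew_def)
    with eq show "F $$ (i, j) = Y $$ (i, j)" by simp
  qed (use assms in auto)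
qed simp

lemma basis_bracket_gram:
  assumes "a < lie_rank m" "b < lie_rank m" "c < lie_rank m"
  shows "basis_bracket m a b $ c =
    (if c = 2 * m then gram m (1\<^sub>m m) $$ (a, b)
     else if c = 2 * m + 1 then gram m (shift_mat m) $$ (a, b) else (0::'a::comm_ring_1))"
  using assms
  by (auto simp: basis_bracket_def xy_bracket_def gram_def skew_def shift_mat_def of_bool_def)

lemma bilinear_sum:
  assumes "u \<in> carrier_vec n" "v \<in> carrier_vec n" "G \<in> carrier_mat n n"
  shows "(\<Sum>a<n. \<Sum>b<n. u $ a * v $ b * G $$ (a, b)) = u \<bullet> (G *\<^sub>v (v :: 'a::comm_ring_1 vec))"
  using assms
  by (auto simp: scalar_prod_def atLeast0LessThan sum_distrib_left mult.assoc intro!: sum.cong)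

lemma lie_bracket_gram:
  assumes u: "u \<in> carrier_vec (lie_rank m)" and v: "v \<in> carrier_vec (lie_rank m)"
  shows "lie_bracket m u v =
    (u \<bullet> (gram m (1\<^sub>m m) *\<^sub>v v)) \<cdot>\<^sub>v unit_vec (lie_rank m) (2 * m)
    + (u \<bullet> (gram m (shift_mat m) *\<^sub>v v)) \<cdot>\<^sub>v unit_vec (lie_rank m) (2 * m + 1)"
    (is "_ = ?R")
proof (rule eq_vecI)
  fix c assume "c < dim_vec ?R"
  then have c: "c < lie_rank m" by simp
  have "lie_bracket m u v $ c =
    (\<Sum>a<lie_rank m. \<Sum>b<lie_rank m. u $ a * v $ b * basis_bracket m a b $ c)"
    using c by (simp add: lie_bracket_def)
  also have "\<dots> = (\<Sum>a<lie_rank m. \<Sum>b<lie_rank m. u $ a * v $ b *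
    (if c = 2 * m then gram m (1\<^sub>m m) $$ (a, b)
     else if c = 2 * m + 1 then gram m (shift_mat m) $$ (a, b) else 0))"
    using c by (intro sum.cong refl) (simp add: basis_bracket_gram)
  also have "\<dots> = (if c = 2 * m then u \<bullet> (gram m (1\<^sub>m m) *\<^sub>v v)
     else if c = 2 * m + 1 then u \<bullet> (gram m (shift_mat m) *\<^sub>v v) else 0)"
    by (cases "c = 2 * m"; cases "c = 2 * m + 1") (simp_all only: bilinear_sum[OF u v gram_carrier] if_True if_False
          simp_thms mult_zero_right sum.neutral_const)
  also have "\<dots> = ?R $ c" using c by auto
  finally show "lie_bracket m u v $ c = ?R $ c" .
qed (simp add: lie_bracket_def)

lemma smult_mat_mult_vec:
  assumes "A \<in> carrier_mat n k" "v \<in> carrier_vec k"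
  shows "(c \<cdot>\<^sub>m A) *\<^sub>v v = c \<cdot>\<^sub>v (A *\<^sub>v (v :: 'a::comm_ring_1 vec))"
  using assms by (intro eq_vecI) auto

lemma zero_mult_mat_vec:
  "v \<in> carrier_vec n \<Longrightarrow> 0\<^sub>m k n *\<^sub>v v = (0\<^sub>v k :: 'a::comm_ring_1 vec)"
  by (intro eq_vecI) auto

lemma bilinear_form_eqI:
  assumes F: "F \<in> carrier_mat n n" and Y: "Y \<in> carrier_mat n n"
    and eq: "\<And>u v. u \<in> carrier_vec n \<Longrightarrow> v \<in> carrier_vec n \<Longrightarrow> u \<bullet> (F *\<^sub>v v) = u \<bullet> (Y *\<^sub>v v)"
  shows "F = (Y :: 'a::comm_ring_1 mat)"
proof (rule eq_matI)
  fix i j assume ij: "i < dim_row Y" "j < dim_col Y"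
  have "unit_vec n i \<bullet> (F *\<^sub>v unit_vec n j) = unit_vec n i \<bullet> (Y *\<^sub>v unit_vec n j)"
    by (intro eq) auto
  then show "F $$ (i, j) = Y $$ (i, j)" using ij F Y
    by (simp add: scalar_prod_left_unit[of _ n])
qed (use F Y in auto)

lemma row_act_carrier [simp]:
  assumes "M \<in> carrier_mat n k" shows "row_act u M \<in> carrier_vec k"
  using assms by (intro carrier_vecI) (simp add: row_act_def)

lemma bilinear_row_act:
  assumes M: "M \<in> carrier_mat n n" and G: "G \<in> carrier_mat n n"
    and u: "u \<in> carrier_vec n" and v: "v \<in> carrier_vec n"
  shows "row_act u M \<bullet> (G *\<^sub>v row_act v M) = u \<bullet> ((M * G * transpose_mat M) *\<^sub>v (v :: 'a::comm_ring_1 vec))"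
proof -
  have "row_act u M \<bullet> (G *\<^sub>v row_act v M) = u \<bullet> (M *\<^sub>v (G *\<^sub>v (transpose_mat M *\<^sub>v v)))"
    unfolding row_act_def
    by (rule transpose_vec_mult_scalar[OF M]) (use M G u v in auto)
  also have "M *\<^sub>v (G *\<^sub>v (transpose_mat M *\<^sub>v v)) = (M * G * transpose_mat M) *\<^sub>v v"
    using M G v by (simp add: assoc_mult_mat_vec[of _ n n _ n])
  finally show ?thesis .
qed

lemma row_act_unit:
  assumes "M \<in> carrier_mat n k" "i < n" "c < k"
  shows "row_act (unit_vec n i) M $ c = (M $$ (i, c) :: 'a::comm_ring_1)"
  using assms by (simp add: row_act_def)

text \<open>
  Comparing coordinates in the equation \<open>[u M, v M] = [u, v] M\<close>: since \<open>[u, v]\<close> is a combination of \<open>z\<^sub>1\<close>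
  and \<open>z\<^sub>2\<close>, the right hand side only involves the last two rows of \<open>M\<close>, and the coordinate \<open>c\<close> contributes
  the form whose coefficients are the entries of these rows in column \<open>c\<close>.
\<close>

lemma bracket_preserving_iff:
  assumes M: "M \<in> carrier_mat (lie_rank m) (lie_rank m)"
  defines "T \<equiv> (\<lambda>c. gram m (M $$ (2 * m, c) \<cdot>\<^sub>m 1\<^sub>m m + M $$ (2 * m + 1, c) \<cdot>\<^sub>m shift_mat m))"
  shows "(\<forall>u \<in> carrier_vec (lie_rank m). \<forall>v \<in> carrier_vec (lie_rank m).
      lie_bracket m (row_act u M) (row_act v M) = row_act (lie_bracket m u v) M) \<longleftrightarrow>
    M * gram m (1\<^sub>m m) * transpose_mat M = T (2 * m)
    \<and> M * gram m (shift_mat m) * transpose_mat M = T (2 * m + 1)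
    \<and> (\<forall>c<2 * m. T c = (0\<^sub>m (lie_rank m) (lie_rank m) :: 'a::comm_ring_1 mat))"
proof -
  let ?n = "lie_rank m" and ?G1 = "gram m (1\<^sub>m m)" and ?G2 = "gram m (shift_mat m)"
  have T: "T c = M $$ (2 * m, c) \<cdot>\<^sub>m ?G1 + M $$ (2 * m + 1, c) \<cdot>\<^sub>m ?G2" for c
    unfolding T_def by (simp add: gram_add gram_smult)
  define S where "S c = (if c = 2 * m then M * ?G1 * transpose_mat M
    else if c = 2 * m + 1 then M * ?G2 * transpose_mat M else 0\<^sub>m ?n ?n)" for c
  have Sc: "S c \<in> carrier_mat ?n ?n" for c
    unfolding S_def using M by (auto intro!: mult_carrier_mat[of _ _ ?n])
  have Tc: "T c \<in> carrier_mat ?n ?n" for c unfolding T_def by simp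
  have lhs: "lie_bracket m (row_act u M) (row_act v M) $ c = u \<bullet> (S c *\<^sub>v v)"
    if u: "u \<in> carrier_vec ?n" and v: "v \<in> carrier_vec ?n" and c: "c < ?n" for u v c
    using M c u v bilinear_row_act[OF M gram_carrier u v] zero_mult_mat_vec[OF v]
    by (auto simp: lie_bracket_gram[OF row_act_carrier[OF M] row_act_carrier[OF M]] S_def)
  have rhs: "row_act (lie_bracket m u v) M $ c = u \<bullet> (T c *\<^sub>v v)"
    if u: "u \<in> carrier_vec ?n" and v: "v \<in> carrier_vec ?n" and c: "c < ?n" for u v c
  proof -
    have "row_act (lie_bracket m u v) M $ c =
      (u \<bullet> (?G1 *\<^sub>v v)) * M $$ (2 * m, c) + (u \<bullet> (?G2 *\<^sub>v v)) * M $$ (2 * m + 1, c)"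
      using M c unfolding lie_bracket_gram[OF u v] row_act_def
      by (simp add: scalar_prod_add_distrib[of _ ?n])
    also have "\<dots> = u \<bullet> (T c *\<^sub>v v)"
      unfolding T using u v mult_mat_vec_carrier[OF gram_carrier v]
      by (simp add: add_mult_distrib_mat_vec[of _ ?n ?n] scalar_prod_add_distrib[of _ ?n]
        smult_mat_mult_vec[of _ ?n ?n]
        mult.commute[of "u \<bullet> _"])
    finally show ?thesis .
  qed
  have "(\<forall>u \<in> carrier_vec ?n. \<forall>v \<in> carrier_vec ?n.
      lie_bracket m (row_act u M) (row_act v M) = row_act (lie_bracket m u v) M) \<longleftrightarrow>
    (\<forall>u \<in> carrier_vec ?n. \<forall>v \<in> carrier_vec ?n. \<forall>c<?n. u \<bullet> (S c *\<^sub>v v) = u \<bullet> (T c *\<^sub>v v))"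
    (is "?A \<longleftrightarrow> ?B")
  proof
    assume ?A then show ?B by (metis lhs rhs)
  next
    assume B: ?B
    show ?A
    proof (intro ballI eq_vecI)
      fix u v :: "'a vec" and c
      assume uv: "u \<in> carrier_vec ?n" "v \<in> carrier_vec ?n"
        and c: "c < dim_vec (row_act (lie_bracket m u v) M)"
      have "c < ?n" using c M by (simp add: row_act_def)
      with uv B lhs rhs show "lie_bracket m (row_act u M) (row_act v M) $ c = row_act (lie_bracket m u v) M $ c"
        by metis
    qed (use M in \<open>simp_all add: row_act_def lie_bracket_def\<close>)
  qed
  also have "\<dots> \<longleftrightarrow> (\<forall>c<?n. S c = T c)"
    using bilinear_form_eqI[OF Sc Tc] by metis
  also have "\<dots> \<longleftrightarrow> S (2 * m) = T (2 * m) \<and> S (2 * m + 1) = T (2 * m + 1) \<and> (\<forall>c<2 * m. S c = T c)"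
    by (auto simp: less_Suc_eq numeral_2_eq_2)
  also have "\<dots> \<longleftrightarrow> M * ?G1 * transpose_mat M = T (2 * m)
    \<and> M * ?G2 * transpose_mat M = T (2 * m + 1) \<and> (\<forall>c<2 * m. T c = 0\<^sub>m ?n ?n)"
    by (auto simp: S_def)
  finally show ?thesis .
qed

section \<open>Block form of automorphisms\<close>

lemma four_block_mat_inject:
  assumes eq: "four_block_mat A B C D = four_block_mat A' B' C' D'"
    and "A \<in> carrier_mat n k" "B \<in> carrier_mat n l" "C \<in> carrier_mat r k" "D \<in> carrier_mat r l"
    and "A' \<in> carrier_mat n k" "B' \<in> carrier_mat n l" "C' \<in> carrier_mat r k" "D' \<in> carrier_mat r l"
  shows "A = A'" "B = B'" "C = C'" "D = D'"
proof -
  have ent: "four_block_mat A B C D $$ (i, j) = four_block_mat A' B' C' D' $$ (i, j)" for i j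
    by (simp only: eq)
  show "A = A'"
  proof (rule eq_matI)
    fix i j assume "i < dim_row A'" "j < dim_col A'"
    with ent[of i j] assms(2-) show "A $$ (i, j) = A' $$ (i, j)" by auto
  qed (use assms in auto)
  show "B = B'"
  proof (rule eq_matI)
    fix i j assume "i < dim_row B'" "j < dim_col B'"
    with ent[of i "k + j"] assms(2-) show "B $$ (i, j) = B' $$ (i, j)" by auto
  qed (use assms in auto)
  show "C = C'"
  proof (rule eq_matI)
    fix i j assume "i < dim_row C'" "j < dim_col C'"
    with ent[of "n + i" j] assms(2-) show "C $$ (i, j) = C' $$ (i, j)" by auto
  qed (use assms in auto)
  show "D = D'"
  proof (rule eq_matI)
    fix i j assume "i < dim_row D'" "j < dim_col D'"
    with ent[of "n + i" "k + j"] assms(2-) show "D $$ (i, j) = D' $$ (i, j)" by auto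
  qed (use assms in auto)
qed

lemma GL_carrier_iff:
  "M \<in> carrier (GL n) \<longleftrightarrow> M \<in> carrier_mat n n \<and> det M \<noteq> (0 :: 'a::field)"
proof -
  have "carrier (ring_mat TYPE('a) n ()) = carrier_mat n n"
    by (simp add: ring_mat_def)
  then show ?thesis
    unfolding GL_def units_of_def
    using det_non_zero_imp_unit[of M n "()"] unit_imp_det_non_zero[of M n "()"]
    by (auto simp: Units_def)
qed

lemma GL_mult [simp]: "M \<otimes>\<^bsub>GL n\<^esub> M' = M * M'"
  and GL_one [simp]: "\<one>\<^bsub>GL n\<^esub> = 1\<^sub>m n"
  by (simp_all add: GL_def units_of_def ring_mat_def)

lemma group_GL: "group (GL n :: 'a::field mat monoid)"
  unfolding GL_def
  by (rule monoid.units_group) (rule ring.is_monoid[OF ring_mat])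

lemma lie_Aut_mult [simp]: "M \<otimes>\<^bsub>lie_Aut m\<^esub> M' = M * M'"
  and lie_Aut_one [simp]: "\<one>\<^bsub>lie_Aut m\<^esub> = 1\<^sub>m (lie_rank m)"
  by (simp_all add: lie_Aut_def)

lemma lie_Aut0_mult [simp]: "M \<otimes>\<^bsub>lie_Aut0 m\<^esub> M' = M * M'"
  and lie_Aut0_one [simp]: "\<one>\<^bsub>lie_Aut0 m\<^esub> = 1\<^sub>m (lie_rank m)"
  by (simp_all add: lie_Aut0_def)

lemma B2_mult [simp]: "M \<otimes>\<^bsub>B2\<^esub> M' = M * M'"
  and B2_one [simp]: "\<one>\<^bsub>B2\<^esub> = 1\<^sub>m 2"
  by (simp_all add: B2_def)

text \<open>
  The pencil of the two forms; as \<open>shift_mat m\<close> acts as \<open>t\<close>, this is the matrix of multiplication by \<open>a + b t\<close>.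
\<close>

definition pencil :: "nat \<Rightarrow> 'a::comm_ring_1 \<Rightarrow> 'a \<Rightarrow> 'a mat" where
  "pencil m a b = a \<cdot>\<^sub>m 1\<^sub>m m + b \<cdot>\<^sub>m shift_mat m"

lemma pencil_carrier [simp]: "pencil m a b \<in> carrier_mat m m"
  by (simp add: pencil_def)

lemma pencil_dim [simp]: "dim_row (pencil m a b) = m" "dim_col (pencil m a b) = m"
  by (simp_all add: pencil_def)

lemma pencil_1_0: "pencil m 1 0 = 1\<^sub>m m"
  by (intro eq_matI) (auto simp: pencil_def)

lemma pencil_0_1: "pencil m 0 1 = shift_mat m"
  by (intro eq_matI) (auto simp: pencil_def)

lemma det_pencil: "det (pencil m a b) = (a :: 'a::field) ^ m"
proof -
  have "upper_triangular (pencil m a b)"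
    by (auto simp: pencil_def shift_mat_def)
  then have "det (pencil m a b) = prod_list (diag_mat (pencil m a b))"
    by (rule det_upper_triangular[OF _ pencil_carrier])
  also have "diag_mat (pencil m a b) = replicate m a"
    by (intro nth_equalityI) (auto simp: diag_mat_def pencil_def shift_mat_def)
  finally show ?thesis by simp
qed

lemmas mult_square_blocks =
  mult_four_block_mat[where ?nr1.0 = m and ?n1.0 = m and ?n2.0 = m and ?nr2.0 = m and ?nc1.0 = m and ?nc2.0 = m] for m

lemma skew_eq_block_diag_mult:
  assumes F: "F \<in> carrier_mat m m"
  shows "skew m F = four_block_mat F (0\<^sub>m m m) (0\<^sub>m m m) (transpose_mat F) * skew m (1\<^sub>m m)"
  unfolding skew_def using F
  by (subst mult_square_blocks[where m = m])
     auto

lemma skew_one_square: "skew m (1\<^sub>m m) * skew m (1\<^sub>m m) = - (1\<^sub>m (2 * m) :: 'a::comm_ring_1 mat)"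
proof -
  have "skew m (1\<^sub>m m) * skew m (1\<^sub>m m) =
    four_block_mat (- 1\<^sub>m m) (0\<^sub>m m m) (- 0\<^sub>m m m) (- 1\<^sub>m m :: 'a mat)"
    unfolding skew_def
    by (subst mult_square_blocks[where m = m]) auto
  also have "\<dots> = - 1\<^sub>m (2 * m)"
    by (intro eq_matI) auto
  finally show ?thesis .
qed

text \<open>
  A form in the pencil is degenerate only if the nondegenerate generator is absent, because the shift is nilpotent:
  up to the invertible \<open>skew m 1\<close> the Gram matrix is block diagonal with triangular blocks of diagonal \<open>a\<close>.
\<close>

lemma det_skew_pencil_eq_0_iff:
  assumes "m \<ge> 1"
  shows "det (skew m (pencil m a b)) = 0 \<longleftrightarrow> a = (0 :: 'a::field)"
proof -
  have "det (skew m (1\<^sub>m m) * skew m (1\<^sub>m m)) \<noteq> (0 :: 'a)"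
  proof -
    have "- (1\<^sub>m (2 * m) :: 'a mat) = (- 1) \<cdot>\<^sub>m 1\<^sub>m (2 * m)" by (intro eq_matI) auto
    then show ?thesis unfolding skew_one_square by simp
  qed
  then have one: "det (skew m (1\<^sub>m m)) \<noteq> (0 :: 'a)"
    by (simp add: det_mult[OF skew_carrier skew_carrier])
  have c: "four_block_mat (pencil m a b) (0\<^sub>m m m) (0\<^sub>m m m) (transpose_mat (pencil m a b))
      \<in> carrier_mat (2 * m) (2 * m)"
    unfolding mult_2 by (rule four_block_carrier_mat) simp_all
  have "det (skew m (pencil m a b)) = a ^ m * a ^ m * det (skew m (1\<^sub>m m))"
    unfolding skew_eq_block_diag_mult[OF pencil_carrier]
    by (subst det_mult[OF c skew_carrier], subst det_four_block_mat_lower_left_zero[of _ m _ m])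
       (simp_all add: det_pencil det_transpose[OF pencil_carrier])
  with one assms show ?thesis by simp
qed

lemma gram_congruence:
  assumes "A \<in> carrier_mat (2 * m) (2 * m)" "C \<in> carrier_mat (2 * m) 2"
    "E \<in> carrier_mat 2 (2 * m)" "D \<in> carrier_mat 2 2"
  shows "four_block_mat A C E D * gram m F = four_block_mat (A * skew m F) (0\<^sub>m (2 * m) 2)
      (E * skew m F) (0\<^sub>m 2 2 :: 'a::comm_ring_1 mat)" (is ?thesis1)
    and "four_block_mat A C E D * gram m F * transpose_mat (four_block_mat A C E D) =
      four_block_mat (A * skew m F * transpose_mat A) (A * skew m F * transpose_mat E)
        (E * skew m F * transpose_mat A) (E * skew m F * transpose_mat E)" (is ?thesis2)
proof -
  have [simp]: "A * skew m F \<in> carrier_mat (2 * m) (2 * m)" "E * skew m F \<in> carrier_mat 2 (2 * m)"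
    using assms by (auto intro: mult_carrier_mat)
  show 1: ?thesis1
    unfolding gram_def using assms
    by (subst mult_four_block_mat[of _ "2 * m" "2 * m" _ 2 _ 2 _ _ "2 * m" _ 2]) simp_all
  have [simp]: "A * skew m F * transpose_mat A \<in> carrier_mat (2 * m) (2 * m)"
    "A * skew m F * transpose_mat E \<in> carrier_mat (2 * m) 2"
    "E * skew m F * transpose_mat A \<in> carrier_mat 2 (2 * m)"
    "E * skew m F * transpose_mat E \<in> carrier_mat 2 2"
    using assms by (auto intro!: mult_carrier_mat[of _ _ "2 * m"] simp del: assoc_mult_mat)
  show ?thesis2
    unfolding 1 transpose_four_block_mat[OF assms] using assms
    by (subst mult_four_block_mat[of _ "2 * m" "2 * m" _ 2 _ 2 _ _ "2 * m" _ 2])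
       (simp_all del: assoc_mult_mat)
qed

text \<open>
  The conditions on the blocks \<open>A\<close> (on the span of the \<open>x\<^sub>i\<close>, \<open>y\<^sub>j\<close>), \<open>D\<close> (on the centre) and \<open>C\<close> of an
  automorphism.  The entry \<open>D $$ (0, 1)\<close> is zero in \<^const>\<open>B2\<close>, so the second form is transformed into a multiple of
  itself.
\<close>

definition aut_blocks :: "nat \<Rightarrow> 'a::field mat \<Rightarrow> 'a mat \<Rightarrow> 'a mat \<Rightarrow> bool" where
  "aut_blocks m A C D \<longleftrightarrow>
     A \<in> carrier_mat (2 * m) (2 * m) \<and> C \<in> carrier_mat (2 * m) 2 \<and> D \<in> carrier B2 \<and> det A \<noteq> 0
     \<and> A * skew m (1\<^sub>m m) * transpose_mat A = skew m (pencil m (D $$ (0, 0)) (D $$ (1, 0)))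
     \<and> A * skew m (shift_mat m) * transpose_mat A = skew m (pencil m 0 (D $$ (1, 1)))"

lemma det_lower_2x2:
  assumes "D \<in> carrier_mat 2 2" "D $$ (0, 1) = 0"
  shows "det D = D $$ (0, 0) * (D $$ (1, 1) :: 'a::comm_ring_1)"
proof -
  have "det D = prod_list (diag_mat D)"
    using assms by (intro det_lower_triangular[where n = 2]) (auto simp: less_2_cases_iff)
  also have "diag_mat D = [D $$ (0, 0), D $$ (1, 1)]"
    using assms by (intro nth_equalityI) (auto simp: diag_mat_def less_2_cases_iff)
  finally show ?thesis by simp
qed

lemma B2_iff:
  "D \<in> carrier B2 \<longleftrightarrow> D \<in> carrier_mat 2 2 \<and> D $$ (0, 0) \<noteq> 0 \<and> D $$ (1, 1) \<noteq> 0 \<and> D $$ (0, 1) = (0 :: 'a::field)"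
  unfolding B2_def using det_lower_2x2[of D] by (auto simp: GL_carrier_iff less_2_cases_iff)

text \<open>
  The lower left block vanishes since the transformed forms have the centre in their radical, and \<open>D\<close> is lower
  triangular since \<open>B\<^sub>2\<close> is degenerate, whereas every form in the pencil that involves \<open>B\<^sub>1\<close> is not.
\<close>

lemma lie_Aut_iff:
  assumes m: "m \<ge> 1"
  shows "M \<in> carrier (lie_Aut m) \<longleftrightarrow>
    (\<exists>A C D. aut_blocks m A C D \<and> M = (four_block_mat A C (0\<^sub>m 2 (2 * m)) D :: 'a::field mat))"
proof
  assume "M \<in> carrier (lie_Aut m)"
  then have M: "M \<in> carrier_mat (lie_rank m) (lie_rank m)" and dM: "det M \<noteq> 0"
    and pres: "\<forall>u \<in> carrier_vec (lie_rank m). \<forall>v \<in> carrier_vec (lie_rank m).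
      lie_bracket m (row_act u M) (row_act v M) = row_act (lie_bracket m u v) M"
    by (simp_all add: lie_Aut_def GL_carrier_iff)
  let ?p = "\<lambda>c. pencil m (M $$ (2 * m, c)) (M $$ (2 * m + 1, c))"
  note g = pres[unfolded bracket_preserving_iff[OF M], folded pencil_def]
  obtain A C E D where "split_block M (2 * m) (2 * m) = (A, C, E, D)"
    by (metis prod_cases4)
  from split_block[OF this, of 2 2] M
  have c: "A \<in> carrier_mat (2 * m) (2 * m)" "C \<in> carrier_mat (2 * m) 2"
    "E \<in> carrier_mat 2 (2 * m)" "D \<in> carrier_mat 2 2" and Meq: "M = four_block_mat A C E D"
    by auto
  have D: "M $$ (2 * m + i, 2 * m + j) = D $$ (i, j)" if "i < 2" "j < 2" for i j
    using that c by (auto simp: Meq)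
  have tr: "A * skew m F * transpose_mat A = skew m Y"
    "E * skew m F * transpose_mat A = 0\<^sub>m 2 (2 * m)"
    "E * skew m F * transpose_mat E = 0\<^sub>m 2 2"
    if "M * gram m F * transpose_mat M = gram m Y" for F Y :: "'a mat"
  proof -
    have eq: "four_block_mat (A * skew m F * transpose_mat A) (A * skew m F * transpose_mat E)
        (E * skew m F * transpose_mat A) (E * skew m F * transpose_mat E)
      = four_block_mat (skew m Y) (0\<^sub>m (2 * m) 2) (0\<^sub>m 2 (2 * m)) (0\<^sub>m 2 2)"
      using that[unfolded Meq gram_congruence(2)[OF c]] unfolding gram_def .
    have "A * skew m F * transpose_mat A \<in> carrier_mat (2 * m) (2 * m)"
      "A * skew m F * transpose_mat E \<in> carrier_mat (2 * m) 2"
      "E * skew m F * transpose_mat A \<in> carrier_mat 2 (2 * m)"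
      "E * skew m F * transpose_mat E \<in> carrier_mat 2 2"
      using c by (auto intro!: mult_carrier_mat[of _ _ "2 * m"] simp del: assoc_mult_mat)
    note inj = four_block_mat_inject[OF eq this skew_carrier zero_carrier_mat zero_carrier_mat zero_carrier_mat]
    show "A * skew m F * transpose_mat A = skew m Y" "E * skew m F * transpose_mat A = 0\<^sub>m 2 (2 * m)"
      "E * skew m F * transpose_mat E = 0\<^sub>m 2 2"
      by (rule inj(1) inj(3) inj(4))+
  qed
  have g1: "M * gram m (1\<^sub>m m) * transpose_mat M = gram m (pencil m (D $$ (0, 0)) (D $$ (1, 0)))"
    and g2: "M * gram m (shift_mat m) * transpose_mat M = gram m (pencil m (D $$ (0, 1)) (D $$ (1, 1)))"
    using g D[of 0 0] D[of 1 0] D[of 0 1] D[of 1 1] by simp_all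
  \<comment> \<open>\<open>(E S, 0) M\<^sup>T = 0\<close> and \<open>M\<close>, \<open>S\<close> are invertible, hence \<open>E = 0\<close>.\<close>
  have E0: "E = 0\<^sub>m 2 (2 * m)"
  proof -
    let ?S = "skew m (1\<^sub>m m) :: 'a mat"
    let ?N = "four_block_mat (E * ?S) (0\<^sub>m 2 2) (0\<^sub>m (2 * m) (2 * m)) (0\<^sub>m (2 * m) 2) :: 'a mat"
    have ES: "E * ?S \<in> carrier_mat 2 (2 * m)" using c by auto
    have "?N * transpose_mat M = 0\<^sub>m (2 + 2 * m) (2 * m + 2)"
      unfolding Meq transpose_four_block_mat[OF c] using c ES tr[OF g1]
      by (subst mult_four_block_mat[of _ 2 "2 * m" _ 2 _ "2 * m" _ _ "2 * m" _ 2])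
        (simp_all del: assoc_mult_mat)
    moreover have "?N \<in> carrier_mat (lie_rank m) (lie_rank m)"
      using four_block_carrier_mat[OF ES, of "0\<^sub>m (2 * m) 2" "2 * m" 2] by (simp add: add.commute)
    moreover obtain W where W: "W \<in> carrier_mat (lie_rank m) (lie_rank m)"
      "transpose_mat M * W = 1\<^sub>m (lie_rank m)"
      using det_non_zero_imp_unit[of "transpose_mat M" "lie_rank m" "()"] M dM det_transpose[OF M]
      by (auto simp: Units_def ring_mat_def)
    ultimately have N: "?N \<in> carrier_mat (lie_rank m) (lie_rank m)"
      "?N * transpose_mat M = 0\<^sub>m (lie_rank m) (lie_rank m)"
      and W: "W \<in> carrier_mat (lie_rank m) (lie_rank m)" "transpose_mat M * W = 1\<^sub>m (lie_rank m)"
      by (simp_all only: add.commute[of 2])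
    have "?N = ?N * (transpose_mat M * W)"
      unfolding W(2) by (rule right_mult_one_mat[OF N(1), symmetric])
    also have "\<dots> = ?N * transpose_mat M * W"
      by (rule assoc_mult_mat[symmetric]) (use N M W in auto)
    also have "\<dots> = 0\<^sub>m (lie_rank m) (lie_rank m)"
      unfolding N(2) using W(1) by simp
    finally have "?N = 0\<^sub>m (lie_rank m) (lie_rank m)" .
    then have "?N = four_block_mat (0\<^sub>m 2 (2 * m)) (0\<^sub>m 2 2) (0\<^sub>m (2 * m) (2 * m)) (0\<^sub>m (2 * m) 2)"
      by (simp only: four_block_zero_mat add.commute)
    from four_block_mat_inject(1)[OF this ES zero_carrier_mat zero_carrier_mat zero_carrier_mat
        zero_carrier_mat zero_carrier_mat zero_carrier_mat zero_carrier_mat]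
    have "E * ?S = 0\<^sub>m 2 (2 * m)" .
    then have "E * ?S * ?S = 0\<^sub>m 2 (2 * m)" by simp
    then have "E * (?S * ?S) = 0\<^sub>m 2 (2 * m)" using assoc_mult_mat[OF c(3) skew_carrier skew_carrier] by simp
    then have "- E = 0\<^sub>m 2 (2 * m)" unfolding skew_one_square using c(3) by simp
    moreover have "- (0\<^sub>m 2 (2 * m)) = (0\<^sub>m 2 (2 * m) :: 'a mat)" by (intro eq_matI) auto
    ultimately show ?thesis by (metis uminus_uminus_mat)
  qed
  have dAD: "det A \<noteq> 0" "det D \<noteq> 0"
    using dM unfolding Meq by (simp_all add: det_four_block_mat_lower_left_zero[OF c(1,2) E0 c(4)])
  \<comment> \<open>The second Gram matrix is singular, so its transform cannot involve the first one.\<close>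
  have D01: "D $$ (0, 1) = 0"
  proof -
    have "det (A * skew m (shift_mat m) * transpose_mat A) = 0"
      using c(1) det_skew_pencil_eq_0_iff[OF m, of 0 1]
      by (subst det_mult[of _ "2 * m"], auto simp: pencil_0_1 det_mult[of _ "2 * m"])
    then show ?thesis unfolding tr(1)[OF g2] det_skew_pencil_eq_0_iff[OF m] .
  qed
  have "D \<in> carrier B2"
    using D01 dAD(2) c(4) unfolding B2_def by (auto simp: GL_carrier_iff less_2_cases_iff)
  then have "aut_blocks m A C D"
    unfolding aut_blocks_def using c dAD tr(1)[OF g1] tr(1)[OF g2] D01 by simp
  then show "\<exists>A C D. aut_blocks m A C D \<and> M = four_block_mat A C (0\<^sub>m 2 (2 * m)) D"
    using Meq E0 by blast
next
  assume "\<exists>A C D. aut_blocks m A C D \<and> M = four_block_mat A C (0\<^sub>m 2 (2 * m)) D"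
  then obtain A C D where AD: "aut_blocks m A C D" and Meq: "M = four_block_mat A C (0\<^sub>m 2 (2 * m)) D"
    by blast
  have c: "A \<in> carrier_mat (2 * m) (2 * m)" "C \<in> carrier_mat (2 * m) 2" "0\<^sub>m 2 (2 * m) \<in> carrier_mat 2 (2 * m)"
    "D \<in> carrier_mat 2 2" and dA: "det A \<noteq> 0" and D: "D \<in> carrier B2"
    using AD by (auto simp: aut_blocks_def B2_iff)
  have M: "M \<in> carrier_mat (lie_rank m) (lie_rank m)"
    unfolding Meq by (rule four_block_carrier_mat[OF c(1,4)])
  have "det M \<noteq> 0"
    unfolding Meq det_four_block_mat_lower_left_zero[OF c(1,2) refl c(4)]
    using dA D by (auto simp: B2_def GL_carrier_iff)
  moreover have "M $$ (2 * m + i, 2 * m + j) = D $$ (i, j)" if "i < 2" "j < 2" for i j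
    using that c by (auto simp: Meq)
  note this[of 0 0] this[of 1 0] this[of 0 1] this[of 1 1]
  moreover have "M $$ (2 * m, j) = 0" "M $$ (2 * m + 1, j) = 0" if "j < 2 * m" for j
    using that c by (auto simp: Meq)
  moreover have "gram m (pencil m 0 0) = (0\<^sub>m (lie_rank m) (lie_rank m) :: 'a mat)"
    by (intro eq_matI) (auto simp: gram_def skew_def pencil_def)
  moreover have "M * gram m F * transpose_mat M = gram m Y"
    if "A * skew m F * transpose_mat A = skew m Y" for F Y
    unfolding Meq gram_congruence(2)[OF c] gram_def[of m Y] using c that
    by (simp del: assoc_mult_mat)
  ultimately show "M \<in> carrier (lie_Aut m)"
    using M AD D unfolding lie_Aut_def
    by (simp add: GL_carrier_iff bracket_preserving_iff[OF M, folded pencil_def] aut_blocks_def B2_iff)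
qed

section \<open>The centre and the automorphisms fixing it\<close>

lemma sum_last_two:
  assumes "\<And>r. r < 2 * m \<Longrightarrow> f r = (0 :: 'a::comm_monoid_add)"
  shows "(\<Sum>r = 0..<lie_rank m. f r) = f (2 * m) + f (2 * m + 1)"
proof -
  have "{0..<lie_rank m} = insert (2 * m) (insert (2 * m + 1) {0..<2 * m})" by auto
  moreover have "(\<Sum>r = 0..<2 * m. f r) = 0" using assms by simp
  ultimately show ?thesis by (simp add: add_ac)
qed

lemma gram_one_mult_unit_vec:
  assumes "i < m"
  shows "gram m (1\<^sub>m m) *\<^sub>v unit_vec (lie_rank m) (m + i) = (unit_vec (lie_rank m) i :: 'a::comm_ring_1 vec)"
    and "gram m (1\<^sub>m m) *\<^sub>v unit_vec (lie_rank m) i = (- unit_vec (lie_rank m) (m + i) :: 'a::comm_ring_1 vec)"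
  using assms by (auto intro!: eq_vecI simp: gram_def skew_def)

lemma lie_centre_support:
  fixes z :: "'a::comm_ring_1 vec"
  assumes z: "z \<in> lie_centre m" and c: "c < 2 * m"
  shows "z $ c = 0"
proof -
  have zc: "z \<in> carrier_vec (lie_rank m)" using z by (simp add: lie_centre_def)
  have 0: "z \<bullet> (gram m (1\<^sub>m m) *\<^sub>v v) = 0" if v: "v \<in> carrier_vec (lie_rank m)" for v
  proof -
    have "lie_bracket m z v $ (2 * m) = 0" using z v by (simp add: lie_centre_def)
    then show ?thesis by (simp add: lie_bracket_gram[OF zc v])
  qed
  show ?thesis
  proof (cases "c < m")
    case True
    then show ?thesis using 0[of "unit_vec (lie_rank m) (m + c)"] zc by (simp add: gram_one_mult_unit_vec)
  next
    case False
    then have "c - m < m" "m + (c - m) = c" using c by auto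
    then show ?thesis using 0[of "unit_vec (lie_rank m) (c - m)"] zc by (simp add: gram_one_mult_unit_vec)
  qed
qed

lemma unit_vec_in_lie_centre:
  assumes "c \<in> {2 * m, 2 * m + 1}"
  shows "unit_vec (lie_rank m) c \<in> (lie_centre m :: 'a::comm_ring_1 vec set)"
proof -
  have "unit_vec (lie_rank m) c \<bullet> (gram m F *\<^sub>v v) = 0" if "v \<in> carrier_vec (lie_rank m)" for v and F :: "'a mat"
  proof -
    have "row (gram m F) c = 0\<^sub>v (lie_rank m)"
      using assms by (intro eq_vecI) (auto simp: gram_def)
    then show ?thesis
      using assms that mult_mat_vec_carrier[OF gram_carrier that]
      by (subst scalar_prod_left_unit[of _ "lie_rank m"]) auto
  qed
  then show ?thesis
    using assms by (auto simp: lie_centre_def lie_bracket_gram)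
qed

lemma unit_vec_in_ext_centre:
  assumes "c \<in> {2 * m, 2 * m + 1}"
  shows "unit_vec (lie_rank m) c \<in> (ext_centre m :: 'k::field vec set)"
proof -
  interpret vec_module "TYPE('k)" "lie_rank m" .
  have "map_vec of_int (unit_vec (lie_rank m) c :: int vec) = (unit_vec (lie_rank m) c :: 'k vec)"
    by (intro eq_vecI) (auto simp: unit_vec_def)
  then have "(unit_vec (lie_rank m) c :: 'k vec) \<in> map_vec of_int ` (lie_centre m :: int vec set)"
    using unit_vec_in_lie_centre[OF assms, where ?'a = int] by (metis imageI)
  moreover have "map_vec of_int ` (lie_centre m :: int vec set) \<subseteq> carrier_vec (lie_rank m)"
    by (auto simp: lie_centre_def)
  ultimately show ?thesis
    unfolding ext_centre_def using in_own_span by blast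
qed

text \<open>
  The centre contains nothing outside the span of \<open>z\<^sub>1\<close>, \<open>z\<^sub>2\<close> because \<open>B\<^sub>1\<close> is nondegenerate.
\<close>

lemma ext_centre_support:
  fixes z :: "'k::field vec"
  assumes z: "z \<in> ext_centre m"
  shows "z \<in> carrier_vec (lie_rank m)" and "c < 2 * m \<Longrightarrow> z $ c = 0"
proof -
  interpret vec_module "TYPE('k)" "lie_rank m" .
  define W where "W = {v \<in> carrier_vec (lie_rank m). \<forall>c<2 * m. v $ c = (0 :: 'k)}"
  have "submodule class_ring W V"
    unfolding submodule_def W_def using module_axioms by (auto simp: class_ring_simps module_vec_simps)
  moreover have "map_vec of_int ` (lie_centre m :: int vec set) \<subseteq> W"
  proof (rule image_subsetI)
    fix w :: "int vec" assume w: "w \<in> lie_centre m"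
    then have "w \<in> carrier_vec (lie_rank m)" by (simp add: lie_centre_def)
    with lie_centre_support[OF w] show "map_vec of_int w \<in> W" by (simp add: W_def)
  qed
  ultimately have "ext_centre m \<subseteq> W"
    unfolding ext_centre_def by (rule span_is_subset[rotated])
  with z show "z \<in> carrier_vec (lie_rank m)" "c < 2 * m \<Longrightarrow> z $ c = 0" by (auto simp: W_def)
qed

lemma fixes_ext_centre_iff:
  assumes A: "A \<in> carrier_mat (2 * m) (2 * m)" and C: "C \<in> carrier_mat (2 * m) 2"
    and D: "D \<in> carrier_mat 2 2"
  defines "M \<equiv> four_block_mat A C (0\<^sub>m 2 (2 * m)) D"
  shows "(\<forall>z \<in> ext_centre m. row_act z M = z) \<longleftrightarrow> D = (1\<^sub>m 2 :: 'k::field mat)"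
proof -
  have M: "M \<in> carrier_mat (lie_rank m) (lie_rank m)"
    unfolding M_def by (rule four_block_carrier_mat[OF A D])
  show ?thesis
  proof
    assume fix_z: "\<forall>z \<in> ext_centre m. row_act z M = z"
    show "D = 1\<^sub>m 2"
    proof (rule eq_matI)
      fix i j assume "i < dim_row (1\<^sub>m 2 :: 'k mat)" "j < dim_col (1\<^sub>m 2 :: 'k mat)"
      then have ij: "i < 2" "j < 2" by auto
      then have "row_act (unit_vec (lie_rank m) (2 * m + i)) M = (unit_vec (lie_rank m) (2 * m + i) :: 'k vec)"
        using fix_z unit_vec_in_ext_centre[of "2 * m + i" m] by (auto simp: less_2_cases_iff)
      then have "M $$ (2 * m + i, 2 * m + j) = unit_vec (lie_rank m) (2 * m + i) $ (2 * m + j)"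
        using row_act_unit[OF M, of "2 * m + i" "2 * m + j"] ij by simp
      then show "D $$ (i, j) = 1\<^sub>m 2 $$ (i, j)"
        using ij A C D by (auto simp: M_def)
    qed (use D in auto)
  next
    assume D1: "D = 1\<^sub>m 2"
    show "\<forall>z \<in> ext_centre m. row_act z M = z"
    proof
      fix z :: "'k vec" assume z: "z \<in> ext_centre m"
      note zs = ext_centre_support[OF z]
      show "row_act z M = z"
      proof (rule eq_vecI)
        fix c assume "c < dim_vec z"
        then have c: "c < lie_rank m" using zs(1) by simp
        have "row_act z M $ c = (\<Sum>r = 0..<lie_rank m. M $$ (r, c) * z $ r)"
          using M zs(1) c by (simp add: row_act_def scalar_prod_def)
        also have "\<dots> = M $$ (2 * m, c) * z $ (2 * m) + M $$ (2 * m + 1, c) * z $ (2 * m + 1)"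
          by (rule sum_last_two) (simp add: zs(2))
        also have "\<dots> = z $ c"
        proof (cases "c < 2 * m")
          case True then show ?thesis using A C D zs(2) by (simp add: M_def)
        next
          case False
          with c have "c = 2 * m \<or> c = 2 * m + 1" by auto
          then show ?thesis using A C D1 by (auto simp: M_def)
        qed
        finally show "row_act z M $ c = z $ c" .
      qed (use M zs(1) in \<open>simp add: row_act_def\<close>)
    qed
  qed
qed

lemma lie_Aut0_iff:
  assumes m: "m \<ge> 1"
  shows "M \<in> carrier (lie_Aut0 m) \<longleftrightarrow>
    (\<exists>A C. aut_blocks m A C (1\<^sub>m 2) \<and> M = (four_block_mat A C (0\<^sub>m 2 (2 * m)) (1\<^sub>m 2) :: 'a::field mat))"
proof -
  have "M \<in> carrier (lie_Aut0 m) \<longleftrightarrow>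
    (\<exists>A C D. aut_blocks m A C D \<and> M = four_block_mat A C (0\<^sub>m 2 (2 * m)) D \<and> (\<forall>z \<in> ext_centre m. row_act z M = z))"
    unfolding lie_Aut0_def using lie_Aut_iff[OF m, of M] by auto
  also have "\<dots> \<longleftrightarrow> (\<exists>A C D. aut_blocks m A C D \<and> M = four_block_mat A C (0\<^sub>m 2 (2 * m)) D \<and> D = 1\<^sub>m 2)"
  proof -
    have "(\<forall>z \<in> ext_centre m. row_act z (four_block_mat A C (0\<^sub>m 2 (2 * m)) D) = z) \<longleftrightarrow> D = 1\<^sub>m 2"
      if "aut_blocks m A C D" for A C D :: "'a mat"
      using that by (intro fixes_ext_centre_iff) (auto simp: aut_blocks_def B2_iff)
    then show ?thesis by (simp cong: conj_cong)
  qed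
  finally show ?thesis by auto
qed

section \<open>The homomorphism to the lower triangular group\<close>

lemma row_act_mult:
  assumes "M \<in> carrier_mat n n" "M' \<in> carrier_mat n n" "u \<in> carrier_vec n"
  shows "row_act u (M * M') = row_act (row_act u M) (M' :: 'a::comm_ring_1 mat)"
  using assms unfolding row_act_def transpose_mult[OF assms(1,2)]
  by (intro assoc_mult_mat_vec) auto

lemma row_act_one: "u \<in> carrier_vec n \<Longrightarrow> row_act u (1\<^sub>m n) = (u :: 'a::comm_ring_1 vec)"
  by (simp add: row_act_def)

lemma lie_bracket_carrier [simp]: "lie_bracket m u v \<in> carrier_vec (lie_rank m)"
  by (simp add: lie_bracket_def)

lemma subgroup_lie_Aut: "subgroup (carrier (lie_Aut m)) (GL (lie_rank m) :: 'a::field mat monoid)"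
proof -
  interpret GL: group "GL (lie_rank m) :: 'a mat monoid" by (rule group_GL)
  let ?n = "lie_rank m"
  note inv = GL.r_inv[simplified] GL.l_inv[simplified]
  note iff = GL_carrier_iff[of _ ?n]
  show ?thesis
  proof (rule GL.subgroupI)
    show "carrier (lie_Aut m) \<subseteq> carrier (GL ?n :: 'a mat monoid)" by (auto simp: lie_Aut_def)
    have "1\<^sub>m ?n \<in> carrier (lie_Aut m :: 'a mat monoid)"
      by (simp add: lie_Aut_def GL_carrier_iff row_act_one)
    then show "carrier (lie_Aut m :: 'a mat monoid) \<noteq> {}" by blast
  next
    fix M M' :: "'a mat" assume MM': "M \<in> carrier (lie_Aut m)" "M' \<in> carrier (lie_Aut m)"
    then have "M \<in> carrier_mat ?n ?n" "M' \<in> carrier_mat ?n ?n" "M * M' \<in> carrier (GL ?n)"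
      using GL.m_closed[of M M'] by (auto simp: lie_Aut_def GL_carrier_iff)
    with MM' show "M \<otimes>\<^bsub>GL ?n\<^esub> M' \<in> carrier (lie_Aut m)"
      unfolding lie_Aut_def by (simp add: row_act_mult[of _ ?n])
  next
    fix M :: "'a mat" assume MA: "M \<in> carrier (lie_Aut m)"
    then have Mg: "M \<in> carrier (GL ?n)" by (simp add: lie_Aut_def)
    define W where "W = inv\<^bsub>GL ?n\<^esub> M"
    have Wg: "W \<in> carrier (GL ?n)" unfolding W_def by (rule GL.inv_closed[OF Mg])
    have c: "M \<in> carrier_mat ?n ?n" "W \<in> carrier_mat ?n ?n" using Mg Wg by (simp_all add: GL_carrier_iff)
    have WM: "W * M = 1\<^sub>m ?n" "M * W = 1\<^sub>m ?n" unfolding W_def by (rule inv[OF Mg])+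
    have "lie_bracket m (row_act u W) (row_act v W) = row_act (lie_bracket m u v) W"
      if u: "u \<in> carrier_vec ?n" and v: "v \<in> carrier_vec ?n" for u v
    proof -
      let ?b = "lie_bracket m (row_act u W) (row_act v W)"
      have "row_act (lie_bracket m u v) W = row_act (lie_bracket m (row_act (row_act u W) M) (row_act (row_act v W) M)) W"
        by (simp only: row_act_mult[OF c(2,1) u, symmetric] row_act_mult[OF c(2,1) v, symmetric] WM row_act_one u v)
      also have "\<dots> = row_act (row_act ?b M) W"
        using MA c by (simp add: lie_Aut_def)
      also have "\<dots> = ?b"
        by (simp only: row_act_mult[OF c lie_bracket_carrier, symmetric] WM row_act_one lie_bracket_carrier)
      finally show ?thesis by simp
    qed
    with Wg show "inv\<^bsub>GL ?n\<^esub> M \<in> carrier (lie_Aut m)"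
      unfolding W_def[symmetric] by (simp add: lie_Aut_def)
  qed
qed

lemma group_lie_Aut: "group (lie_Aut m :: 'a::field mat monoid)"
proof -
  have "lie_Aut m = GL (lie_rank m)\<lparr>carrier := carrier (lie_Aut m :: 'a mat monoid)\<rparr>"
    by (simp add: lie_Aut_def)
  then show ?thesis
    using subgroup.subgroup_is_group[OF subgroup_lie_Aut group_GL] by metis
qed

lemma mult_2x2:
  assumes "D \<in> carrier_mat 2 2" "D' \<in> carrier_mat 2 2" "i < 2" "j < 2"
  shows "(D * D') $$ (i, j) = D $$ (i, 0) * D' $$ (0, j) + D $$ (i, 1) * (D' $$ (1, j) :: 'a::comm_ring_1)"
  using assms by (simp add: scalar_prod_def numeral_2_eq_2)

lemma subgroup_B2: "subgroup (carrier B2) (GL 2 :: 'a::field mat monoid)"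
proof -
  interpret GL: group "GL 2 :: 'a mat monoid" by (rule group_GL)
  show ?thesis
  proof (rule GL.subgroupI)
    show "carrier B2 \<subseteq> carrier (GL 2 :: 'a mat monoid)" by (auto simp: B2_def)
    have "1\<^sub>m 2 \<in> carrier (B2 :: 'a mat monoid)" by (simp add: B2_iff)
    then show "carrier (B2 :: 'a mat monoid) \<noteq> {}" by blast
  next
    fix D D' :: "'a mat" assume "D \<in> carrier B2" "D' \<in> carrier B2"
    then show "D \<otimes>\<^bsub>GL 2\<^esub> D' \<in> carrier B2"
      by (auto simp: B2_iff mult_2x2 simp del: index_mult_mat)
  next
    fix D :: "'a mat" assume D: "D \<in> carrier B2"
    then have Dg: "D \<in> carrier (GL 2)" by (simp add: B2_def)
    define W where "W = inv\<^bsub>GL 2\<^esub> D"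
    have Wg: "W \<in> carrier (GL 2)" unfolding W_def by (rule GL.inv_closed[OF Dg])
    have "D * W = 1\<^sub>m 2" using GL.r_inv[OF Dg] by (simp add: W_def)
    then have "(D * W) $$ (0, 1) = 0" by simp
    then have "W $$ (0, 1) = 0"
      using D Wg by (simp add: B2_iff GL_carrier_iff mult_2x2 del: index_mult_mat)
    with Wg show "inv\<^bsub>GL 2\<^esub> D \<in> carrier B2"
      unfolding W_def[symmetric] B2_def by (auto simp: less_2_cases_iff)
  qed
qed

lemma group_B2: "group (B2 :: 'a::field mat monoid)"
proof -
  have "B2 = GL 2\<lparr>carrier := carrier (B2 :: 'a mat monoid)\<rparr>" by (simp add: B2_def)
  then show ?thesis
    using subgroup.subgroup_is_group[OF subgroup_B2 group_GL] by metis
qed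

definition centre_block :: "nat \<Rightarrow> 'a mat \<Rightarrow> 'a mat" where
  "centre_block m M = mat 2 2 (\<lambda>(i, j). M $$ (2 * m + i, 2 * m + j))"

lemma centre_block_four_block:
  assumes "A \<in> carrier_mat (2 * m) (2 * m)" "D \<in> carrier_mat 2 2"
  shows "centre_block m (four_block_mat A C E D) = D"
  using assms by (intro eq_matI) (auto simp: centre_block_def)

lemma mult_upper_blocks:
  assumes "A \<in> carrier_mat n n" "C \<in> carrier_mat n 2" "D \<in> carrier_mat 2 2"
    "A' \<in> carrier_mat n n" "C' \<in> carrier_mat n 2" "D' \<in> carrier_mat 2 2"
  shows "four_block_mat A C (0\<^sub>m 2 n) D * four_block_mat A' C' (0\<^sub>m 2 n) D' =
    four_block_mat (A * A') (A * C' + C * D') (0\<^sub>m 2 n) (D * (D' :: 'a::comm_ring_1 mat))"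
  using assms by (subst mult_four_block_mat[of _ n n _ 2 _ 2 _ _ n _ 2]) auto

lemma group_hom_centre_block:
  assumes m: "m \<ge> 1"
  shows "group_hom (lie_Aut m) B2 (centre_block m :: 'a::field mat \<Rightarrow> 'a mat)"
proof (rule group_hom.intro[OF group_lie_Aut group_B2], unfold_locales, rule homI)
  fix M :: "'a mat" assume "M \<in> carrier (lie_Aut m)"
  then show "centre_block m M \<in> carrier B2"
    by (auto simp: lie_Aut_iff[OF m] aut_blocks_def B2_iff centre_block_four_block)
next
  fix M M' :: "'a mat" assume "M \<in> carrier (lie_Aut m)" "M' \<in> carrier (lie_Aut m)"
  then obtain A C D A' C' D' where
    c: "A \<in> carrier_mat (2 * m) (2 * m)" "C \<in> carrier_mat (2 * m) 2" "D \<in> carrier_mat 2 2"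
    "A' \<in> carrier_mat (2 * m) (2 * m)" "C' \<in> carrier_mat (2 * m) 2" "D' \<in> carrier_mat 2 2"
    and "M = four_block_mat A C (0\<^sub>m 2 (2 * m)) D" "M' = four_block_mat A' C' (0\<^sub>m 2 (2 * m)) D'"
    by (auto simp: lie_Aut_iff[OF m] aut_blocks_def B2_iff)
  then show "centre_block m (M \<otimes>\<^bsub>lie_Aut m\<^esub> M') = centre_block m M \<otimes>\<^bsub>B2\<^esub> centre_block m M'"
    by (simp add: mult_upper_blocks[OF c] centre_block_four_block[of _ m])
qed

lemma kernel_centre_block:
  assumes m: "m \<ge> 1"
  shows "kernel (lie_Aut m) B2 (centre_block m) = carrier (lie_Aut0 m :: 'a::field mat monoid)"
proof -
  have "M \<in> carrier (lie_Aut m) \<and> centre_block m M = 1\<^sub>m 2 \<longleftrightarrow> M \<in> carrier (lie_Aut0 m)" for M :: "'a mat"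
  proof -
    have "centre_block m (four_block_mat A C (0\<^sub>m 2 (2 * m)) D) = D" if "aut_blocks m A C D" for A C D :: "'a mat"
      using that by (intro centre_block_four_block) (auto simp: aut_blocks_def B2_iff)
    then show ?thesis
      unfolding lie_Aut_iff[OF m] lie_Aut0_iff[OF m] by metis
  qed
  then show ?thesis by (auto simp: kernel_def)
qed

section \<open>Split extensions\<close>

text \<open>
  The values outside \<open>N\<close> are undefined because \<^const>\<open>AutoGroup\<close> consists of extensional functions.
\<close>

definition conj_action :: "('g, 'b) monoid_scheme \<Rightarrow> 'g set \<Rightarrow> ('h \<Rightarrow> 'g) \<Rightarrow> 'h \<Rightarrow> 'g \<Rightarrow> 'g" where
  "conj_action G N s h = restrict (\<lambda>n. s h \<otimes>\<^bsub>G\<^esub> n \<otimes>\<^bsub>G\<^esub> inv\<^bsub>G\<^esub> (s h)) N"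

text \<open>
  A group homomorphism with a section presents its source as a semidirect product: \<open>g\<close> is the product of
  \<open>g (s (p g))\<^sup>-\<^sup>1\<close>, which lies in the kernel, and \<open>s (p g)\<close>.  The factor from the kernel stands on the left, to
  agree with the multiplication of \<^const>\<open>semidirect\<close>.
\<close>

lemma split_extension:
  fixes G (structure) and H (structure)
  assumes "group_hom G H p" and s: "s \<in> hom H G" and ps: "\<And>h. h \<in> carrier H \<Longrightarrow> p (s h) = h"
  defines "N \<equiv> G\<lparr>carrier := kernel G H p\<rparr>"
  defines "\<theta> \<equiv> conj_action G (carrier N) s"
  defines "\<Phi> \<equiv> \<lambda>(h, n). n \<otimes>\<^bsub>G\<^esub> s h"
  shows "\<theta> \<in> hom H (AutoGroup N)"
    and "\<Phi> \<in> iso (semidirect H N \<theta>) G"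
    and "\<And>g. g \<in> carrier G \<Longrightarrow>
      inv_into (carrier (semidirect H N \<theta>)) \<Phi> g = (p g, g \<otimes>\<^bsub>G\<^esub> inv\<^bsub>G\<^esub> (s (p g)))"
proof -
  interpret p: group_hom G H p by fact
  interpret s: group_hom H G s
    using s by (simp add: group_hom_def group_hom_axioms_def p.G.is_group p.H.is_group)
  have Nc: "carrier N = {n \<in> carrier G. p n = \<one>\<^bsub>H\<^esub>}" by (auto simp: N_def kernel_def)
  have \<theta>: "\<theta> h n = s h \<otimes>\<^bsub>G\<^esub> n \<otimes>\<^bsub>G\<^esub> inv\<^bsub>G\<^esub> (s h)" if "n \<in> carrier N" for h n
    using that by (simp add: \<theta>_def conj_action_def)
  have sG [simp]: "s h \<in> carrier G" if "h \<in> carrier H" for h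
    using that by (rule s.hom_closed)
  have \<theta>N: "\<theta> h n \<in> carrier N" if "h \<in> carrier H" "n \<in> carrier N" for h n
    using that by (simp add: \<theta> Nc ps)
  have \<theta>comp: "\<theta> (h \<otimes>\<^bsub>H\<^esub> h') n = \<theta> h (\<theta> h' n)"
    if "h \<in> carrier H" "h' \<in> carrier H" "n \<in> carrier N" for h h' n
    using that \<theta>N[OF that(2,3)] by (simp add: \<theta> Nc p.G.inv_mult_group p.G.m_assoc)
  have \<theta>one: "\<theta> \<one>\<^bsub>H\<^esub> n = n" if "n \<in> carrier N" for n
    using that by (simp add: \<theta>) (simp add: Nc)
  have \<theta>mult: "\<theta> h (n \<otimes>\<^bsub>G\<^esub> n') = \<theta> h n \<otimes>\<^bsub>G\<^esub> \<theta> h n'"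
    if "h \<in> carrier H" "n \<in> carrier N" "n' \<in> carrier N" for h n n'
  proof -
    have "n \<otimes>\<^bsub>G\<^esub> n' \<in> carrier N" using that by (simp add: Nc)
    then show ?thesis using that
      by (simp add: \<theta>) (simp add: Nc p.G.m_assoc p.G.inv_solve_left p.G.l_inv)
  qed
  have bij: "bij_betw (\<theta> h) (carrier N) (carrier N)" if h: "h \<in> carrier H" for h
  proof (rule bij_betw_byWitness[where f' = "\<theta> (inv\<^bsub>H\<^esub> h)"])
    show "\<forall>n\<in>carrier N. \<theta> (inv\<^bsub>H\<^esub> h) (\<theta> h n) = n"
      using h by (simp add: \<theta>comp[symmetric] \<theta>one)
    show "\<forall>n\<in>carrier N. \<theta> h (\<theta> (inv\<^bsub>H\<^esub> h) n) = n"
      using h by (simp add: \<theta>comp[symmetric] \<theta>one)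
  qed (use h \<theta>N in auto)
  have \<theta>auto: "\<theta> h \<in> auto N" if h: "h \<in> carrier H" for h
  proof -
    have "\<theta> h \<in> hom N N"
      using h \<theta>N by (intro homI) (simp_all add: N_def \<theta>mult[unfolded N_def])
    moreover have "\<theta> h \<in> extensional (carrier N)"
      unfolding \<theta>_def conj_action_def by (rule restrict_extensional)
    ultimately show ?thesis using bij[OF h] by (simp add: auto_def Bij_def)
  qed
  show "\<theta> \<in> hom H (AutoGroup N)"
  proof (rule homI)
    fix h h' assume hh: "h \<in> carrier H" "h' \<in> carrier H"
    have "\<theta> (h \<otimes>\<^bsub>H\<^esub> h') = compose (carrier N) (\<theta> h) (\<theta> h')"
    proof
      fix n show "\<theta> (h \<otimes>\<^bsub>H\<^esub> h') n = compose (carrier N) (\<theta> h) (\<theta> h') n"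
        using hh by (cases "n \<in> carrier N") (auto simp: compose_def \<theta>comp, simp add: \<theta>_def conj_action_def)
    qed
    then show "\<theta> (h \<otimes>\<^bsub>H\<^esub> h') = \<theta> h \<otimes>\<^bsub>AutoGroup N\<^esub> \<theta> h'"
      using \<theta>auto hh by (simp add: AutoGroup_def BijGroup_def auto_def)
  qed (use \<theta>auto in \<open>simp add: AutoGroup_def\<close>)
  have C: "carrier (semidirect H N \<theta>) = carrier H \<times> carrier N" by (simp add: semidirect_def)
  have inj: "p (n \<otimes>\<^bsub>G\<^esub> s h) = h \<and> n \<otimes>\<^bsub>G\<^esub> s h \<otimes>\<^bsub>G\<^esub> inv\<^bsub>G\<^esub> (s h) = n"
    if "h \<in> carrier H" "n \<in> carrier N" for h n
    using that by (simp add: Nc ps p.G.m_assoc)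
  have surj: "(p g, g \<otimes>\<^bsub>G\<^esub> inv\<^bsub>G\<^esub> (s (p g))) \<in> carrier H \<times> carrier N
      \<and> g \<otimes>\<^bsub>G\<^esub> inv\<^bsub>G\<^esub> (s (p g)) \<otimes>\<^bsub>G\<^esub> s (p g) = g" if "g \<in> carrier G" for g
    using that by (simp add: Nc ps p.G.m_assoc)
  have bijPhi: "bij_betw \<Phi> (carrier H \<times> carrier N) (carrier G)"
    by (rule bij_betw_byWitness[where f' = "\<lambda>g. (p g, g \<otimes>\<^bsub>G\<^esub> inv\<^bsub>G\<^esub> (s (p g)))"])
       (use inj surj in \<open>auto simp: \<Phi>_def Nc\<close>)
  show "\<Phi> \<in> iso (semidirect H N \<theta>) G"
  proof (rule isoI)
    show "\<Phi> \<in> hom (semidirect H N \<theta>) G"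
    proof (rule homI)
      fix hn hn' assume "hn \<in> carrier (semidirect H N \<theta>)" "hn' \<in> carrier (semidirect H N \<theta>)"
      then obtain h n h' n' where *: "hn = (h, n)" "hn' = (h', n')" "h \<in> carrier H" "h' \<in> carrier H"
        "n \<in> carrier N" "n' \<in> carrier N" unfolding C by auto
      have "n \<otimes>\<^bsub>G\<^esub> (s h \<otimes>\<^bsub>G\<^esub> n' \<otimes>\<^bsub>G\<^esub> inv\<^bsub>G\<^esub> (s h)) \<otimes>\<^bsub>G\<^esub> (s h \<otimes>\<^bsub>G\<^esub> s h')
        = n \<otimes>\<^bsub>G\<^esub> s h \<otimes>\<^bsub>G\<^esub> (n' \<otimes>\<^bsub>G\<^esub> (inv\<^bsub>G\<^esub> (s h) \<otimes>\<^bsub>G\<^esub> s h) \<otimes>\<^bsub>G\<^esub> s h')"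
        using *(3-6) by (simp only: Nc p.G.m_assoc p.G.m_closed p.G.inv_closed s.hom_closed mem_Collect_eq)
      also have "\<dots> = n \<otimes>\<^bsub>G\<^esub> s h \<otimes>\<^bsub>G\<^esub> (n' \<otimes>\<^bsub>G\<^esub> s h')"
        using *(3-6) by (simp add: Nc)
      finally show "\<Phi> (hn \<otimes>\<^bsub>semidirect H N \<theta>\<^esub> hn') = \<Phi> hn \<otimes>\<^bsub>G\<^esub> \<Phi> hn'"
        using * by (simp add: semidirect_def \<Phi>_def \<theta>) (simp add: N_def)
    qed (auto simp: C \<Phi>_def Nc)
    show "bij_betw \<Phi> (carrier (semidirect H N \<theta>)) (carrier G)" unfolding C by (rule bijPhi)
  qed
  show "inv_into (carrier (semidirect H N \<theta>)) \<Phi> g = (p g, g \<otimes>\<^bsub>G\<^esub> inv\<^bsub>G\<^esub> (s (p g)))"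
    if "g \<in> carrier G" for g
    unfolding C
    using surj[OF that] bijPhi
    by (intro inv_into_f_eq) (auto simp: bij_betw_def \<Phi>_def)
qed

section \<open>The section over the lower triangular group\<close>

text \<open>
  The coefficient of \<open>t\<^sup>j\<close> in \<open>\<psi>\<^sup>i\<close> for the power series \<open>\<psi> = c t / (d - a t)\<close>.  The recursion is
  \<open>d \<psi>\<^bsup>i+1\<^esup> = c t \<psi>\<^sup>i + a t \<psi>\<^bsup>i+1\<^esup>\<close>.
\<close>

fun subst_coeff :: "'a::field \<Rightarrow> 'a \<Rightarrow> 'a \<Rightarrow> nat \<Rightarrow> nat \<Rightarrow> 'a" where
  "subst_coeff c a d 0 j = of_bool (j = 0)"
| "subst_coeff c a d (Suc i) 0 = 0"
| "subst_coeff c a d (Suc i) (Suc j) = (c * subst_coeff c a d i j + a * subst_coeff c a d (Suc i) j) / d"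

definition subst_mat :: "nat \<Rightarrow> 'a::field mat \<Rightarrow> 'a mat" where
  "subst_mat m b = mat m m (\<lambda>(i, j). subst_coeff (b $$ (0, 0)) (b $$ (1, 0)) (b $$ (1, 1)) i j)"

lemma subst_mat_carrier [simp]: "subst_mat m b \<in> carrier_mat m m"
  by (simp add: subst_mat_def)

lemma subst_coeff_below: "j < i \<Longrightarrow> subst_coeff c a d i j = 0"
  by (induction c a d i j rule: subst_coeff.induct) auto

lemma shift_mult_entry:
  assumes "F \<in> carrier_mat m m" "i < m" "j < m"
  shows "(shift_mat m * F) $$ (i, j) = (if i + 1 < m then F $$ (i + 1, j) else (0 :: 'a::comm_ring_1))"
proof -
  have "(shift_mat m * F) $$ (i, j) = (\<Sum>k\<in>{0..<m}. if k = i + 1 then F $$ (k, j) else 0)"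
    using assms by (auto simp: scalar_prod_def shift_mat_def intro!: sum.cong)
  then show ?thesis by (simp add: sum.delta)
qed

lemma mult_shift_entry:
  assumes "F \<in> carrier_mat m m" "i < m" "j < m"
  shows "(F * shift_mat m) $$ (i, j) = (if j \<ge> 1 then F $$ (i, j - 1) else (0 :: 'a::comm_ring_1))"
proof (cases j)
  case 0
  then show ?thesis using assms by (simp add: scalar_prod_def shift_mat_def)
next
  case (Suc j')
  have "(F * shift_mat m) $$ (i, j) = (\<Sum>k\<in>{0..<m}. if k = j' then F $$ (i, k) else 0)"
    using assms Suc by (auto simp: scalar_prod_def shift_mat_def intro!: sum.cong)
  then show ?thesis using assms Suc by (simp add: sum.delta)
qed

lemma pencil_mult_entry:
  assumes "F \<in> carrier_mat m m" "i < m" "j < m"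
  shows "(pencil m c a * F) $$ (i, j) =
    c * F $$ (i, j) + a * (if i + 1 < m then F $$ (i + 1, j) else (0 :: 'a::comm_ring_1))"
proof -
  have "pencil m c a * F = c \<cdot>\<^sub>m F + a \<cdot>\<^sub>m (shift_mat m * F)"
    unfolding pencil_def using assms(1)
    by (simp add: add_mult_distrib_mat[of _ m m _ _ m] mult_smult_assoc_mat[of _ m m _ m])
  then show ?thesis using assms shift_mult_entry[OF assms] by (simp del: index_mult_mat(1))
qed

text \<open>
  Semilinearity in matrix form: with \<open>\<psi> = c t / (d - a t)\<close>, the matrix \<open>F\<close> turns multiplication by \<open>t\<close> into
  multiplication by \<open>\<psi>\<close>, in a form without denominators.  Read entrywise it is the recursion of
  \<^const>\<open>subst_coeff\<close>, so it determines \<open>F\<close> from its first row.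
\<close>

definition intertwines_shift :: "nat \<Rightarrow> 'a::comm_ring_1 mat \<Rightarrow> 'a mat \<Rightarrow> bool" where
  "intertwines_shift m b F \<longleftrightarrow> pencil m (b $$ (0, 0)) (b $$ (1, 0)) * F * shift_mat m = b $$ (1, 1) \<cdot>\<^sub>m (shift_mat m * F)"

lemma intertwines_shift_iff_recursion:
  assumes F: "F \<in> carrier_mat m m"
  shows "intertwines_shift m b F \<longleftrightarrow> (\<forall>i<m. \<forall>j<m.
    (if j \<ge> 1 then b $$ (0, 0) * F $$ (i, j - 1)
      + b $$ (1, 0) * (if i + 1 < m then F $$ (i + 1, j - 1) else 0) else 0)
    = b $$ (1, 1) * (if i + 1 < m then F $$ (i + 1, j) else (0 :: 'a::comm_ring_1)))"
    (is "_ \<longleftrightarrow> (\<forall>i<m. \<forall>j<m. ?l i j = ?r i j)")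
proof -
  let ?K = "pencil m (b $$ (0, 0)) (b $$ (1, 0))"
  have KF: "?K * F \<in> carrier_mat m m" using F by auto
  have l: "(?K * F * shift_mat m) $$ (i, j) = ?l i j" if "i < m" "j < m" for i j
    using that by (subst mult_shift_entry[OF KF that])
      (simp add: pencil_mult_entry[OF F] del: index_mult_mat(1) assoc_mult_mat)
  have r: "(b $$ (1, 1) \<cdot>\<^sub>m (shift_mat m * F)) $$ (i, j) = ?r i j" if "i < m" "j < m" for i j
    using that F shift_mult_entry[OF F that] by (simp del: index_mult_mat(1))
  have d: "dim_row (?K * F * shift_mat m) = m" "dim_col (?K * F * shift_mat m) = m"
    "dim_row (b $$ (1, 1) \<cdot>\<^sub>m (shift_mat m * F)) = m" "dim_col (b $$ (1, 1) \<cdot>\<^sub>m (shift_mat m * F)) = m"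
    using F by auto
  show ?thesis unfolding intertwines_shift_def
  proof
    assume "?K * F * shift_mat m = b $$ (1, 1) \<cdot>\<^sub>m (shift_mat m * F)"
    then show "\<forall>i<m. \<forall>j<m. ?l i j = ?r i j" using l r by metis
  next
    assume "\<forall>i<m. \<forall>j<m. ?l i j = ?r i j"
    then show "?K * F * shift_mat m = b $$ (1, 1) \<cdot>\<^sub>m (shift_mat m * F)"
      by (intro eq_matI) (metis d l r, use d in auto)
  qed
qed

lemma intertwines_shift_subst_mat:
  assumes "b $$ (1, 1) \<noteq> (0 :: 'a::field)"
  shows "intertwines_shift m b (subst_mat m b)"
  unfolding intertwines_shift_iff_recursion[OF subst_mat_carrier]
proof (intro allI impI)
  fix i j assume "i < m" "j < m"
  then show "(if 1 \<le> j then b $$ (0, 0) * subst_mat m b $$ (i, j - 1)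
      + b $$ (1, 0) * (if i + 1 < m then subst_mat m b $$ (i + 1, j - 1) else 0) else 0)
    = b $$ (1, 1) * (if i + 1 < m then subst_mat m b $$ (i + 1, j) else 0)"
    using assms by (cases j) (auto simp: subst_mat_def subst_coeff_below)
qed

lemma intertwines_shift_unique:
  assumes F: "F \<in> carrier_mat m m" and d: "b $$ (1, 1) \<noteq> (0 :: 'a::field)"
    and rel: "intertwines_shift m b F" and row: "\<And>j. j < m \<Longrightarrow> F $$ (0, j) = of_bool (j = 0)"
  shows "F = subst_mat m b"
proof (rule eq_matI)
  note rel = rel[unfolded intertwines_shift_iff_recursion[OF F], rule_format]
  have "F $$ (i, j) = subst_coeff (b $$ (0, 0)) (b $$ (1, 0)) (b $$ (1, 1)) i j" if "i < m" "j < m" for i j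
    using that
  proof (induction "b $$ (0, 0)" "b $$ (1, 0)" "b $$ (1, 1)" i j rule: subst_coeff.induct)
    case (1 j) then show ?case using row by simp
  next
    case (2 i) then show ?case using rel[of i 0] d by simp
  next
    case (3 i j) then show ?case using rel[of i "Suc j"] d by (simp add: field_simps)
  qed
  then show "F $$ (i, j) = subst_mat m b $$ (i, j)" if "i < dim_row (subst_mat m b)" "j < dim_col (subst_mat m b)" for i j
    using that by (simp add: subst_mat_def)
qed (use F in \<open>auto simp: subst_mat_def\<close>)

lemma subst_mat_one: "subst_mat m (1\<^sub>m 2) = (1\<^sub>m m :: 'a::field mat)"
  by (rule intertwines_shift_unique[symmetric])
     (auto simp: intertwines_shift_def pencil_1_0 smult_one)

lemma subst_mat_row_0:
  assumes "j < m" shows "subst_mat m b $$ (0, j) = of_bool (j = 0)"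
  using assms by (simp add: subst_mat_def)

lemma smult_smult_mat: "k \<cdot>\<^sub>m (l \<cdot>\<^sub>m A) = (k * l) \<cdot>\<^sub>m (A :: 'a::comm_ring_1 mat)"
  by (intro eq_matI) (auto simp: mult.assoc)

text \<open>
  Ring laws for matrices of one fixed size, which serve as rewrite rules because all side conditions mention this size.
\<close>

lemma square_mat_algebra:
  fixes A B C :: "'a::comm_ring_1 mat"
  shows "A \<in> carrier_mat m m \<Longrightarrow> B \<in> carrier_mat m m \<Longrightarrow> C \<in> carrier_mat m m \<Longrightarrow> A * B * C = A * (B * C)"
    "A \<in> carrier_mat m m \<Longrightarrow> B \<in> carrier_mat m m \<Longrightarrow> C \<in> carrier_mat m m \<Longrightarrow> (A + B) * C = A * C + B * C"
    "A \<in> carrier_mat m m \<Longrightarrow> B \<in> carrier_mat m m \<Longrightarrow> C \<in> carrier_mat m m \<Longrightarrow> A * (B + C) = A * B + A * C"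
    "A \<in> carrier_mat m m \<Longrightarrow> B \<in> carrier_mat m m \<Longrightarrow> A * (k \<cdot>\<^sub>m B) = k \<cdot>\<^sub>m (A * B)"
    "A \<in> carrier_mat m m \<Longrightarrow> B \<in> carrier_mat m m \<Longrightarrow> (k \<cdot>\<^sub>m A) * B = k \<cdot>\<^sub>m (A * B)"
    "A \<in> carrier_mat m m \<Longrightarrow> B \<in> carrier_mat m m \<Longrightarrow> A * B \<in> carrier_mat m m"
  by (simp_all add: add_mult_distrib_mat[of _ m m _ _ m] mult_add_distrib_mat[of _ m m _ m]
    mult_smult_assoc_mat[of _ m m _ m] mult_smult_distrib[of _ m m _ m])

lemma pencil_B2_mult:
  assumes "b \<in> carrier B2" "b' \<in> carrier B2"
  shows "pencil m ((b * b') $$ (0, 0)) ((b * b') $$ (1, 0)) =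
    b' $$ (0, 0) \<cdot>\<^sub>m pencil m (b $$ (0, 0)) (b $$ (1, 0))
    + (b' $$ (1, 0) * b $$ (1, 1)) \<cdot>\<^sub>m (shift_mat m :: 'a::field mat)"
  using assms
  by (intro eq_matI) (auto simp: B2_iff mult_2x2 pencil_def algebra_simps simp del: index_mult_mat(1))

lemma intertwines_shift_mult:
  assumes b: "b \<in> carrier B2" "b' \<in> carrier (B2 :: 'a::field mat monoid)"
    and F: "F \<in> carrier_mat m m" "F' \<in> carrier_mat m m"
    and rel: "intertwines_shift m b F" "intertwines_shift m b' F'"
  shows "intertwines_shift m (b * b') (F * F')"
proof -
  let ?K = "pencil m (b $$ (0, 0)) (b $$ (1, 0))" and ?K' = "pencil m (b' $$ (0, 0)) (b' $$ (1, 0))"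
  let ?N = "shift_mat m :: 'a mat"
  let ?c' = "b' $$ (0, 0)" and ?a' = "b' $$ (1, 0)" and ?d = "b $$ (1, 1)" and ?d' = "b' $$ (1, 1)"
  note sq = square_mat_algebra[where m = m]
  have r: "?K * F * ?N = ?d \<cdot>\<^sub>m (?N * F)" "?K' * F' * ?N = ?d' \<cdot>\<^sub>m (?N * F')"
    using rel by (simp_all add: intertwines_shift_def)
  have FN: "?K * (F * ?N) = ?d \<cdot>\<^sub>m (?N * F)" using r(1) F by (simp add: sq)
  have "(b * b') $$ (1, 1) \<cdot>\<^sub>m (?N * (F * F')) = ?d' \<cdot>\<^sub>m (?d \<cdot>\<^sub>m (?N * F) * F')"
  proof -
    have "(b * b') $$ (1, 1) = ?d' * ?d"
      using b by (simp add: B2_iff mult_2x2 mult.commute del: index_mult_mat(1))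
    then show ?thesis using F by (simp add: sq smult_smult_mat)
  qed
  also have "\<dots> = ?K * F * (?d' \<cdot>\<^sub>m (?N * F'))"
    unfolding r(1)[symmetric] using F by (simp add: sq)
  also have "\<dots> = ?K * (F * (?K' * (F' * ?N)))"
    unfolding r(2)[symmetric] using F by (simp add: sq)
  also have "\<dots> = ?c' \<cdot>\<^sub>m (?K * (F * (F' * ?N))) + ?a' \<cdot>\<^sub>m (?K * (F * ?N) * (F' * ?N))"
    unfolding pencil_def[of m ?c' ?a'] using F by (simp add: sq)
  also have "\<dots> = (?c' \<cdot>\<^sub>m ?K + (?a' * ?d) \<cdot>\<^sub>m ?N) * (F * F') * ?N"
    unfolding FN using F by (simp add: sq smult_smult_mat)
  finally show ?thesis
    unfolding intertwines_shift_def pencil_B2_mult[OF b] by simp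
qed

text \<open>
  The product of two substitution matrices satisfies the semilinearity relation of the product and has the right first
  row, so the uniqueness of such a matrix replaces a binomial identity.
\<close>

lemma subst_mat_mult:
  assumes b: "b \<in> carrier B2" "b' \<in> carrier (B2 :: 'a::field mat monoid)" and m: "m \<ge> 1"
  shows "subst_mat m (b * b') = subst_mat m b * subst_mat m b'"
proof (rule intertwines_shift_unique[symmetric])
  show "subst_mat m b * subst_mat m b' \<in> carrier_mat m m" by (rule mult_carrier_mat[of _ m m]) simp_all
  show "(b * b') $$ (1, 1) \<noteq> 0" using b by (simp add: B2_iff mult_2x2 del: index_mult_mat(1))
  show "intertwines_shift m (b * b') (subst_mat m b * subst_mat m b')"
    using b by (intro intertwines_shift_mult intertwines_shift_subst_mat) (auto simp: B2_iff)
  fix j assume j: "j < m"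
  have "(subst_mat m b * subst_mat m b') $$ (0, j) =
      (\<Sum>k\<in>{0..<m}. if k = 0 then subst_mat m b' $$ (k, j) else 0)"
    using j m by (auto simp: scalar_prod_def subst_mat_def intro!: sum.cong)
  then show "(subst_mat m b * subst_mat m b') $$ (0, j) = of_bool (j = 0)"
    using j m by (simp add: subst_mat_row_0)
qed

definition inv_B2 :: "'a::field mat \<Rightarrow> 'a mat" where
  "inv_B2 b = mat 2 2 (\<lambda>(i, j). if i = j then inverse (b $$ (i, i))
     else if i = 1 then - b $$ (1, 0) * inverse (b $$ (0, 0)) * inverse (b $$ (1, 1)) else 0)"

lemma inv_B2:
  assumes "b \<in> carrier (B2 :: 'a::field mat monoid)"
  shows "inv_B2 b \<in> carrier B2" "b * inv_B2 b = 1\<^sub>m 2" "inv_B2 b * b = 1\<^sub>m 2"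
proof -
  have c: "b \<in> carrier_mat 2 2" "inv_B2 b \<in> carrier_mat 2 2" using assms by (auto simp: inv_B2_def B2_iff)
  show "inv_B2 b \<in> carrier B2" using assms by (auto simp: inv_B2_def B2_iff)
  show "b * inv_B2 b = 1\<^sub>m 2"
    using assms c mult_2x2[OF c] 
    by (intro eq_matI) (auto simp: less_2_cases_iff inv_B2_def B2_iff simp del: index_mult_mat(1))
  show "inv_B2 b * b = 1\<^sub>m 2"
    using assms c mult_2x2[OF c(2,1)] 
    by (intro eq_matI) (auto simp: less_2_cases_iff inv_B2_def B2_iff simp del: index_mult_mat(1))
qed

lemma subst_mat_inverse:
  assumes "b \<in> carrier (B2 :: 'a::field mat monoid)" "m \<ge> 1"
  shows "subst_mat m b * subst_mat m (inv_B2 b) = 1\<^sub>m m" "subst_mat m (inv_B2 b) * subst_mat m b = 1\<^sub>m m"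
  using subst_mat_mult[OF assms(1) inv_B2(1)[OF assms(1)] assms(2)]
    subst_mat_mult[OF inv_B2(1)[OF assms(1)] assms] inv_B2[OF assms(1)]
  by (simp_all add: subst_mat_one)

text \<open>
  The transpose of the action on the \<open>y\<^sub>j\<close>: the first form requires that its product with \<^term>\<open>subst_mat m b\<close> is
  the matrix of \<open>c + a t\<close>.
\<close>

definition dual_mat :: "nat \<Rightarrow> 'a::field mat \<Rightarrow> 'a mat" where
  "dual_mat m b = subst_mat m (inv_B2 b) * pencil m (b $$ (0, 0)) (b $$ (1, 0))"

lemma dual_mat_carrier [simp]: "dual_mat m b \<in> carrier_mat m m"
  unfolding dual_mat_def by (rule mult_carrier_mat[of _ m m]) simp_all

text \<open>
  The first equation is the definition of \<^const>\<open>dual_mat\<close>; the second one, the condition from the other form, then holds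
  by semilinearity.
\<close>

lemma subst_mult_dual:
  assumes b: "b \<in> carrier (B2 :: 'a::field mat monoid)" and m: "m \<ge> 1"
  shows "subst_mat m b * dual_mat m b = pencil m (b $$ (0, 0)) (b $$ (1, 0))"
    and "subst_mat m b * shift_mat m * dual_mat m b = pencil m 0 (b $$ (1, 1))"
proof -
  let ?K = "pencil m (b $$ (0, 0)) (b $$ (1, 0))" and ?N = "shift_mat m :: 'a mat"
  let ?P = "subst_mat m b" and ?Q = "subst_mat m (inv_B2 b)" and ?d = "b $$ (1, 1)"
  note sq = square_mat_algebra[where m = m]
  note PQ = subst_mat_inverse[OF b m]
  have "?P * dual_mat m b = ?P * ?Q * ?K"
    unfolding dual_mat_def by (simp add: sq)
  then show "?P * dual_mat m b = ?K" unfolding PQ by simp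
  have KN: "?K * ?N = ?N * ?K"
    unfolding pencil_def by (simp add: sq)
  have rel: "?K * ?P * ?N = ?d \<cdot>\<^sub>m (?N * ?P)"
    using intertwines_shift_subst_mat[of b m] b by (auto simp: intertwines_shift_def B2_iff)
  have "?K * (?P * ?N * dual_mat m b) = (?K * ?P * ?N) * ?Q * ?K"
    unfolding dual_mat_def by (simp add: sq)
  also have "\<dots> = ?d \<cdot>\<^sub>m (?N * (?P * ?Q) * ?K)"
    unfolding rel by (simp add: sq)
  also have "\<dots> = ?d \<cdot>\<^sub>m (?K * ?N)"
    unfolding PQ KN by simp
  also have "\<dots> = ?K * (?d \<cdot>\<^sub>m ?N)"
    by (simp add: sq)
  also have "?d \<cdot>\<^sub>m ?N = pencil m 0 ?d"
    by (intro eq_matI) (auto simp: pencil_def)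
  finally have eq: "?K * (?P * ?N * dual_mat m b) = ?K * pencil m 0 ?d" .
  \<comment> \<open>\<open>c + a t\<close> is a unit, so it can be cancelled.\<close>
  have "?K \<in> Units (ring_mat TYPE('a) m ())"
    using b by (intro det_non_zero_imp_unit) (auto simp: det_pencil B2_iff)
  then obtain W where W: "W \<in> carrier_mat m m" "W * ?K = 1\<^sub>m m"
    by (auto simp: Units_def ring_mat_def)
  have "W * ?K * (?P * ?N * dual_mat m b) = W * ?K * pencil m 0 ?d"
    using eq W(1) by (simp add: sq)
  then show "?P * ?N * dual_mat m b = pencil m 0 ?d"
    unfolding W by (simp add: sq left_mult_one_mat[of _ m m])
qed

lemma dual_mat_mult:
  assumes b: "b \<in> carrier B2" "b' \<in> carrier (B2 :: 'a::field mat monoid)" and m: "m \<ge> 1"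
  shows "dual_mat m (b * b') = dual_mat m b' * dual_mat m b"
proof -
  let ?P = "subst_mat m b" and ?P' = "subst_mat m b'"
  let ?D = "dual_mat m b" and ?D' = "dual_mat m b'"
  let ?c' = "b' $$ (0, 0)" and ?a' = "b' $$ (1, 0)" and ?d = "b $$ (1, 1)"
  note sq = square_mat_algebra[where m = m]
  interpret B2: group "B2 :: 'a mat monoid" by (rule group_B2)
  have bb: "b * b' \<in> carrier B2" using B2.m_closed[OF b] by simp
  have "?P * ?P' * (?D' * ?D) = ?P * (?P' * ?D') * ?D" by (simp add: sq)
  also have "\<dots> = ?P * pencil m ?c' ?a' * ?D" unfolding subst_mult_dual(1)[OF b(2) m] ..
  also have "\<dots> = ?c' \<cdot>\<^sub>m (?P * ?D) + ?a' \<cdot>\<^sub>m (?P * shift_mat m * ?D)"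
    unfolding pencil_def by (simp add: sq left_mult_one_mat[of _ m m])
  also have "\<dots> = pencil m ((b * b') $$ (0, 0)) ((b * b') $$ (1, 0))"
    unfolding subst_mult_dual[OF b(1) m] pencil_B2_mult[OF b]
    by (intro eq_matI) (auto simp: pencil_def)
  also have "\<dots> = subst_mat m (b * b') * dual_mat m (b * b')"
    by (rule subst_mult_dual(1)[OF bb m, symmetric])
  finally have "subst_mat m (b * b') * dual_mat m (b * b') = subst_mat m (b * b') * (?D' * ?D)"
    unfolding subst_mat_mult[OF b m] by simp
  then have "subst_mat m (inv_B2 (b * b')) * subst_mat m (b * b') * dual_mat m (b * b')
    = subst_mat m (inv_B2 (b * b')) * subst_mat m (b * b') * (?D' * ?D)"
    by (simp add: sq)
  then show ?thesis unfolding subst_mat_inverse[OF bb m]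
    by (simp add: sq left_mult_one_mat[of _ m m])
qed

definition B2_section :: "nat \<Rightarrow> 'a::field mat \<Rightarrow> 'a mat" where
  "B2_section m b = four_block_mat
     (four_block_mat (subst_mat m b) (0\<^sub>m m m) (0\<^sub>m m m) (transpose_mat (dual_mat m b)))
     (0\<^sub>m (2 * m) 2) (0\<^sub>m 2 (2 * m)) b"

text \<open>
  A block diagonal change of basis keeps the \<open>x\<^sub>i\<close> and the \<open>y\<^sub>j\<close> isotropic, so it acts on the off-diagonal block alone.
\<close>

lemma block_diag_congruence:
  assumes "P \<in> carrier_mat m m" "Q \<in> carrier_mat m m" "F \<in> carrier_mat m m"
  shows "four_block_mat P (0\<^sub>m m m) (0\<^sub>m m m) Q * skew m F *
      transpose_mat (four_block_mat P (0\<^sub>m m m) (0\<^sub>m m m) Q) =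
    skew m (P * F * transpose_mat (Q :: 'a::comm_ring_1 mat))"
proof -
  have c: "P * F \<in> carrier_mat m m" "Q * transpose_mat F \<in> carrier_mat m m" 
    "P * F * transpose_mat Q \<in> carrier_mat m m" using assms by (auto simp del: assoc_mult_mat)
  have 1: "four_block_mat P (0\<^sub>m m m) (0\<^sub>m m m) Q * skew m F =
    four_block_mat (0\<^sub>m m m) (P * F) (- (Q * transpose_mat F)) (0\<^sub>m m m)"
    unfolding skew_def using assms c
    by (subst mult_square_blocks[where m = m]) auto
  have T: "transpose_mat (P * F * transpose_mat Q) = Q * transpose_mat F * transpose_mat P"
    using assms c by (simp add: transpose_mult[of _ m m _ m])
  have 2: "transpose_mat (four_block_mat P (0\<^sub>m m m) (0\<^sub>m m m) Q)
    = four_block_mat (transpose_mat P) (0\<^sub>m m m) (0\<^sub>m m m) (transpose_mat Q)"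
    using assms by (subst transpose_four_block_mat[of _ m m _ m _ m]) auto
  have PQ: "transpose_mat P \<in> carrier_mat m m" "transpose_mat Q \<in> carrier_mat m m"
    "- (Q * transpose_mat F) \<in> carrier_mat m m" "Q * transpose_mat F * transpose_mat P \<in> carrier_mat m m"
    using assms c(2) by (auto simp del: assoc_mult_mat)
  have "four_block_mat (0\<^sub>m m m) (P * F) (- (Q * transpose_mat F)) (0\<^sub>m m m) *
      four_block_mat (transpose_mat P) (0\<^sub>m m m) (0\<^sub>m m m) (transpose_mat Q) =
    four_block_mat (0\<^sub>m m m * transpose_mat P + P * F * 0\<^sub>m m m)
      (0\<^sub>m m m * 0\<^sub>m m m + P * F * transpose_mat Q)
      (- (Q * transpose_mat F) * transpose_mat P + 0\<^sub>m m m * 0\<^sub>m m m)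
      (- (Q * transpose_mat F) * 0\<^sub>m m m + 0\<^sub>m m m * transpose_mat Q)"
    by (rule mult_square_blocks[where m = m]) (use c PQ in simp_all)
  also have "\<dots> = four_block_mat (0\<^sub>m m m) (P * F * transpose_mat Q)
      (- (Q * transpose_mat F * transpose_mat P)) (0\<^sub>m m m)"
    by (rule cong_four_block_mat) (use c PQ assms in \<open>simp_all del: assoc_mult_mat\<close>)
  finally show ?thesis
    unfolding 1 2 skew_def[of m "P * F * transpose_mat Q"] T .
qed

lemma block_diag_carrier:
  assumes "P \<in> carrier_mat m m" "Q \<in> carrier_mat m m"
  shows "four_block_mat P F E Q \<in> carrier_mat (2 * m) (2 * m)"
  unfolding mult_2 using assms by simp

lemma aut_blocks_section:
  assumes b: "b \<in> carrier (B2 :: 'a::field mat monoid)" and m: "m \<ge> 1"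
  shows "aut_blocks m (four_block_mat (subst_mat m b) (0\<^sub>m m m) (0\<^sub>m m m) (transpose_mat (dual_mat m b)))
    (0\<^sub>m (2 * m) 2) b"
    (is "aut_blocks m ?A _ _")
proof -
  have A: "?A \<in> carrier_mat (2 * m) (2 * m)" by (rule block_diag_carrier) simp_all
  have tr: "?A * skew m F * transpose_mat ?A = skew m (subst_mat m b * F * dual_mat m b)"
    if "F \<in> carrier_mat m m" for F
    using block_diag_congruence[of "subst_mat m b" m "transpose_mat (dual_mat m b)" F] that by simp
  have 1: "?A * skew m (1\<^sub>m m) * transpose_mat ?A = skew m (pencil m (b $$ (0, 0)) (b $$ (1, 0)))"
    using subst_mult_dual(1)[OF b m] tr[of "1\<^sub>m m"] by (simp add: right_mult_one_mat[OF subst_mat_carrier])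
  have "det (?A * skew m (1\<^sub>m m) * transpose_mat ?A) \<noteq> 0"
    unfolding 1 using b by (simp add: B2_iff det_skew_pencil_eq_0_iff[OF m])
  then have "det ?A \<noteq> 0"
    using A by (auto simp: det_mult[of _ "2 * m"])
  then show ?thesis
    unfolding aut_blocks_def using A b 1 tr[OF shift_mat_carrier] subst_mult_dual(2)[OF b m] by simp
qed

lemma B2_section_in_lie_Aut:
  assumes "b \<in> carrier (B2 :: 'a::field mat monoid)" "m \<ge> 1"
  shows "B2_section m b \<in> carrier (lie_Aut m)"
  unfolding lie_Aut_iff[OF assms(2)] B2_section_def using aut_blocks_section[OF assms] by blast

lemma centre_block_section:
  assumes "b \<in> carrier (B2 :: 'a::field mat monoid)"
  shows "centre_block m (B2_section m b) = b"
  unfolding B2_section_def using assms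
  by (intro centre_block_four_block block_diag_carrier) (auto simp: B2_iff)

lemma B2_section_hom:
  assumes m: "m \<ge> 1"
  shows "B2_section m \<in> hom B2 (lie_Aut m :: 'a::field mat monoid)"
proof (rule homI)
  fix b b' :: "'a mat" assume b: "b \<in> carrier B2" "b' \<in> carrier B2"
  have 1: "four_block_mat (subst_mat m b) (0\<^sub>m m m) (0\<^sub>m m m) (transpose_mat (dual_mat m b)) *
    four_block_mat (subst_mat m b') (0\<^sub>m m m) (0\<^sub>m m m) (transpose_mat (dual_mat m b')) =
    four_block_mat (subst_mat m (b * b')) (0\<^sub>m m m) (0\<^sub>m m m) (transpose_mat (dual_mat m (b * b')))"
    unfolding subst_mat_mult[OF b m] dual_mat_mult[OF b m]
      transpose_mult[OF dual_mat_carrier dual_mat_carrier]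
    by (subst mult_square_blocks[where m = m])
       (simp_all add: mult_carrier_mat[of _ m m] left_mult_zero_mat[of _ m m] right_mult_zero_mat[of _ m m])
  have c: "b \<in> carrier_mat 2 2" "b' \<in> carrier_mat 2 2" using b by (auto simp: B2_iff)
  show "B2_section m (b \<otimes>\<^bsub>B2\<^esub> b') = B2_section m b \<otimes>\<^bsub>lie_Aut m\<^esub> B2_section m b'"
    unfolding B2_section_def B2_mult lie_Aut_mult using c
    by (subst mult_upper_blocks) (auto simp: block_diag_carrier 1 right_mult_zero_mat[OF block_diag_carrier])
qed (simp add: B2_section_in_lie_Aut[OF _ m])

section \<open>Matrices with regular entries\<close>

text \<open>
  Functions on \<open>S\<close> that form a ring containing \<open>\<rat>\<close>, where only the values on \<open>S\<close> matter.  The arguments about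
  entries of matrices are needed for two such rings: functions that are polynomial over \<open>\<rat>\<close> in given coordinates, for
  morphisms, and rational functions in one variable, for curves.
\<close>

locale regular_functions =
  fixes S :: "'x set" and \<F> :: "('x \<Rightarrow> 'a::field_char_0) set"
  assumes const: "c \<in> \<rat> \<Longrightarrow> (\<lambda>_. c) \<in> \<F>"
    and add: "f \<in> \<F> \<Longrightarrow> g \<in> \<F> \<Longrightarrow> (\<lambda>x. f x + g x) \<in> \<F>"
    and mult: "f \<in> \<F> \<Longrightarrow> g \<in> \<F> \<Longrightarrow> (\<lambda>x. f x * g x) \<in> \<F>"
    and cong: "f \<in> \<F> \<Longrightarrow> (\<And>x. x \<in> S \<Longrightarrow> f x = g x) \<Longrightarrow> g \<in> \<F>"
begin

lemma uminus: "f \<in> \<F> \<Longrightarrow> (\<lambda>x. - f x) \<in> \<F>"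
  using mult[OF const[of "- 1"], of f] by simp

lemma sum: "(\<And>i. i \<in> I \<Longrightarrow> f i \<in> \<F>) \<Longrightarrow> (\<lambda>x. \<Sum>i\<in>I. f i x) \<in> \<F>"
  by (induction I rule: infinite_finite_induct) (auto intro: add const)

lemma prod: "(\<And>i. i \<in> I \<Longrightarrow> f i \<in> \<F>) \<Longrightarrow> (\<lambda>x. \<Prod>i\<in>I. f i x) \<in> \<F>"
  by (induction I rule: infinite_finite_induct) (auto intro: mult const)

definition regular_mat :: "nat \<Rightarrow> nat \<Rightarrow> ('x \<Rightarrow> 'a mat) \<Rightarrow> bool" where
  "regular_mat n k M \<longleftrightarrow>
     (\<forall>x\<in>S. M x \<in> carrier_mat n k) \<and> (\<forall>i<n. \<forall>j<k. (\<lambda>x. M x $$ (i, j)) \<in> \<F>)"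

lemma regular_mat_carrier: "regular_mat n k M \<Longrightarrow> x \<in> S \<Longrightarrow> M x \<in> carrier_mat n k"
  and regular_mat_entry: "regular_mat n k M \<Longrightarrow> i < n \<Longrightarrow> j < k \<Longrightarrow> (\<lambda>x. M x $$ (i, j)) \<in> \<F>"
  by (auto simp: regular_mat_def)

lemma regular_matI:
  assumes "\<And>x. x \<in> S \<Longrightarrow> M x \<in> carrier_mat n k"
    and "\<And>i j. i < n \<Longrightarrow> j < k \<Longrightarrow> \<exists>f \<in> \<F>. \<forall>x\<in>S. f x = M x $$ (i, j)"
  shows "regular_mat n k M"
  unfolding regular_mat_def using assms cong by meson

lemma regular_mat_const:
  assumes "A \<in> carrier_mat n k" "\<And>i j. i < n \<Longrightarrow> j < k \<Longrightarrow> A $$ (i, j) \<in> \<rat>"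
  shows "regular_mat n k (\<lambda>_. A)"
  using assms by (auto simp: regular_mat_def intro: const)

lemma regular_mat_mult:
  assumes "regular_mat n k A" "regular_mat k l B"
  shows "regular_mat n l (\<lambda>x. A x * B x)"
proof (rule regular_matI)
  fix i j assume ij: "i < n" "j < l"
  have 1: "(\<lambda>x. \<Sum>r\<in>{0..<k}. A x $$ (i, r) * B x $$ (r, j)) \<in> \<F>"
    using assms ij by (intro sum mult regular_mat_entry) auto
  have 2: "(\<Sum>r\<in>{0..<k}. A x $$ (i, r) * B x $$ (r, j)) = (A x * B x) $$ (i, j)" if x: "x \<in> S" for x
    using ij regular_mat_carrier[OF assms(1) x] regular_mat_carrier[OF assms(2) x]
    by (simp add: scalar_prod_def)
  show "\<exists>f \<in> \<F>. \<forall>x\<in>S. f x = (A x * B x) $$ (i, j)" 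
    by (intro bexI[OF _ 1] ballI) (rule 2)
qed (use assms in \<open>auto intro: mult_carrier_mat dest: regular_mat_carrier\<close>)

lemma regular_mat_transpose:
  assumes "regular_mat n k A" shows "regular_mat k n (\<lambda>x. transpose_mat (A x))"
proof (rule regular_matI)
  fix i j assume ij: "i < k" "j < n"
  have "\<forall>x\<in>S. A x $$ (j, i) = transpose_mat (A x) $$ (i, j)"
    using ij by (auto dest!: regular_mat_carrier[OF assms])
  then show "\<exists>f \<in> \<F>. \<forall>x\<in>S. f x = transpose_mat (A x) $$ (i, j)"
    using regular_mat_entry[OF assms ij(2,1)] by (intro bexI[of _ "\<lambda>x. A x $$ (j, i)"]) auto
qed (use assms in \<open>auto dest: regular_mat_carrier\<close>)

lemma regular_mat_four_block:
  assumes A: "regular_mat n k A" and B: "regular_mat n l B"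
    and C: "regular_mat r k C" and D: "regular_mat r l D"
  shows "regular_mat (n + r) (k + l) (\<lambda>x. four_block_mat (A x) (B x) (C x) (D x))"
proof (rule regular_matI)
  fix i j assume ij: "i < n + r" "j < k + l"
  let ?f = "\<lambda>x. if i < n then if j < k then A x $$ (i, j) else B x $$ (i, j - k)
    else if j < k then C x $$ (i - n, j) else D x $$ (i - n, j - k)"
  have "?f \<in> \<F>"
    using ij regular_mat_entry[OF A, of i j] regular_mat_entry[OF B, of i "j - k"]
      regular_mat_entry[OF C, of "i - n" j] regular_mat_entry[OF D, of "i - n" "j - k"]
    by (cases "i < n"; cases "j < k"; auto)
  moreover have "\<forall>x\<in>S. ?f x = four_block_mat (A x) (B x) (C x) (D x) $$ (i, j)"
  proof
    fix x assume x: "x \<in> S"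
    show "?f x = four_block_mat (A x) (B x) (C x) (D x) $$ (i, j)"
      using ij regular_mat_carrier[OF A x] regular_mat_carrier[OF D x] by auto
  qed
  ultimately show "\<exists>f \<in> \<F>. \<forall>x\<in>S. f x = four_block_mat (A x) (B x) (C x) (D x) $$ (i, j)"
    by (intro bexI[where x = ?f])
qed (use A D in \<open>auto intro!: four_block_carrier_mat dest: regular_mat_carrier\<close>)

lemma regular_det:
  assumes "regular_mat n n M" shows "(\<lambda>x. det (M x)) \<in> \<F>"
proof (rule cong)
  show "(\<lambda>x. \<Sum>p\<in>{p. p permutes {0..<n}}. signof p * (\<Prod>i = 0..<n. M x $$ (i, p i))) \<in> \<F>"
  proof (intro sum mult prod)
    fix p assume p: "p \<in> {p. p permutes {0..<n}}"
    show "(\<lambda>x. signof p) \<in> \<F>" by (rule const) (simp add: sign_def)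
    fix i assume "i \<in> {0..<n}"
    then show "(\<lambda>x. M x $$ (i, p i)) \<in> \<F>"
      using p permutes_in_image[of p "{0..<n}" i] by (intro regular_mat_entry[OF assms]) auto
  qed
qed (rule det_def'[OF regular_mat_carrier[OF assms], symmetric])

lemma regular_mat_cong:
  assumes "regular_mat n k A" "\<And>x. x \<in> S \<Longrightarrow> A x = B x"
  shows "regular_mat n k B"
proof (rule regular_matI)
  fix i j assume "i < n" "j < k"
  then show "\<exists>f\<in>\<F>. \<forall>x\<in>S. f x = B x $$ (i, j)"
    using regular_mat_entry[OF assms(1)] assms(2) by (intro bexI[of _ "\<lambda>x. A x $$ (i, j)"]) auto
qed (use assms regular_mat_carrier in fastforce)

definition regular_B2 :: "('x \<Rightarrow> 'a mat) \<Rightarrow> bool" where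
  "regular_B2 b \<longleftrightarrow> (\<forall>x\<in>S. b x \<in> carrier B2) \<and> regular_mat 2 2 b \<and> regular_mat 2 2 (\<lambda>x. inv_B2 (b x))"

lemma regular_B2_inv:
  assumes "regular_B2 b" shows "regular_B2 (\<lambda>x. inv_B2 (b x))"
proof -
  have "inv_B2 (inv_B2 b) = b" if "b \<in> carrier B2" for b :: "'a mat"
    using that by (intro eq_matI) (auto simp: inv_B2_def B2_iff less_2_cases_iff field_simps)
  then show ?thesis
    using assms by (auto simp: regular_B2_def inv_B2 elim!: regular_mat_cong)
qed

lemma regular_B2I:
  assumes b: "\<And>x. x \<in> S \<Longrightarrow> b x \<in> carrier B2" and reg: "regular_mat 2 2 b"
    and inv: "(\<lambda>x. inverse (det (b x))) \<in> \<F>"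
  shows "regular_B2 b"
proof -
  have "regular_mat 2 2 (\<lambda>x. inv_B2 (b x))"
  proof (rule regular_matI)
  note e = regular_mat_entry[OF reg]
  have det: "det (b x) = b x $$ (0, 0) * b x $$ (1, 1)" if "x \<in> S" for x
    using b[OF that] by (intro det_lower_2x2) (auto simp: B2_iff)
  have inv0: "inverse (b x $$ (0, 0)) = b x $$ (1, 1) * inverse (det (b x))"
    "inverse (b x $$ (1, 1)) = b x $$ (0, 0) * inverse (det (b x))" if "x \<in> S" for x
    using b[OF that] by (auto simp: det[OF that] B2_iff)
  fix i j :: nat assume "i < 2" "j < 2"
  then consider "i = 0" "j = 0" | "i = 0" "j = 1" | "i = 1" "j = 0" | "i = 1" "j = 1" by linarith
  then show "\<exists>f\<in>\<F>. \<forall>x\<in>S. f x = inv_B2 (b x) $$ (i, j)"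
  proof cases
    case 1
    then show ?thesis using inv0 mult[OF e[of 1 1] inv]
      by (intro bexI[of _ "\<lambda>x. b x $$ (1, 1) * inverse (det (b x))"]) (auto simp: inv_B2_def)
  next
    case 2
    then show ?thesis by (intro bexI[of _ "\<lambda>x. 0"]) (auto simp: inv_B2_def const)
  next
    case 3
    then show ?thesis using uminus[OF mult[OF e[of 1 0] inv]] det b
      by (intro bexI[of _ "\<lambda>x. - (b x $$ (1, 0) * inverse (det (b x)))"])
        (auto simp: inv_B2_def B2_iff mult.assoc)
  next
    case 4
    then show ?thesis using inv0 mult[OF e[of 0 0] inv]
      by (intro bexI[of _ "\<lambda>x. b x $$ (0, 0) * inverse (det (b x))"]) (auto simp: inv_B2_def)
  qed
  qed (simp add: inv_B2_def)
  then show ?thesis using b reg by (simp add: regular_B2_def)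
qed

lemma regular_subst_coeff:
  assumes "c \<in> \<F>" "a \<in> \<F>" "(\<lambda>x. inverse (d x)) \<in> \<F>"
  shows "(\<lambda>x. subst_coeff (c x) (a x) (d x) i j) \<in> \<F>"
proof (induction "undefined :: 'a" "undefined :: 'a" "undefined :: 'a" i j rule: subst_coeff.induct)
  case (3 i j)
  then show ?case using assms by (auto simp: divide_inverse intro!: mult add)
qed (auto simp: const)

lemma regular_subst_mat:
  assumes "regular_B2 b" shows "regular_mat m m (\<lambda>x. subst_mat m (b x))"
proof (rule regular_matI)
  fix i j assume ij: "i < m" "j < m"
  from assms have b: "regular_mat 2 2 b" "regular_mat 2 2 (\<lambda>x. inv_B2 (b x))" by (auto simp: regular_B2_def)
  have "(\<lambda>x. inverse (b x $$ (1, 1))) \<in> \<F>"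
    using regular_mat_entry[OF b(2), of 1 1] by (simp add: inv_B2_def)
  then have "(\<lambda>x. subst_coeff (b x $$ (0, 0)) (b x $$ (1, 0)) (b x $$ (1, 1)) i j) \<in> \<F>"
    using b(1) by (intro regular_subst_coeff) (auto intro: regular_mat_entry)
  with ij show "\<exists>f\<in>\<F>. \<forall>x\<in>S. f x = subst_mat m (b x) $$ (i, j)"
    by (auto simp: subst_mat_def)
qed simp

lemma regular_pencil:
  assumes "a \<in> \<F>" "b \<in> \<F>" shows "regular_mat m m (\<lambda>x. pencil m (a x) (b x))"
proof (rule regular_matI)
  fix i j assume ij: "i < m" "j < m"
  have "(\<lambda>x. a x * of_bool (i = j) + b x * of_bool (i + 1 = j)) \<in> \<F>"
    using assms by (intro add mult const) auto
  with ij show "\<exists>f\<in>\<F>. \<forall>x\<in>S. f x = pencil m (a x) (b x) $$ (i, j)"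
    by (intro bexI[of _ "\<lambda>x. a x * of_bool (i = j) + b x * of_bool (i + 1 = j)"])
       (auto simp: pencil_def shift_mat_def)
qed simp

lemma regular_mat_zero: "regular_mat n k (\<lambda>_. 0\<^sub>m n k)"
  by (rule regular_mat_const) auto

lemma regular_B2_section:
  assumes b: "regular_B2 b"
  shows "regular_mat (lie_rank m) (lie_rank m) (\<lambda>x. B2_section m (b x))"
proof -
  have reg: "regular_mat 2 2 b" using b by (simp add: regular_B2_def)
  have "regular_mat m m (\<lambda>x. dual_mat m (b x))"
    unfolding dual_mat_def
    by (intro regular_mat_mult[where k = m] regular_subst_mat regular_B2_inv regular_pencil
        regular_mat_entry[OF reg] b) simp_all
  then have "regular_mat (m + m) (m + m) (\<lambda>x. four_block_mat (subst_mat m (b x)) (0\<^sub>m m m) (0\<^sub>m m m)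
      (transpose_mat (dual_mat m (b x))))"
    by (intro regular_mat_four_block regular_mat_transpose regular_subst_mat b regular_mat_zero)
  then show ?thesis
    unfolding B2_section_def
    by (intro regular_mat_four_block regular_mat_zero reg) (simp add: mult_2)
qed

end

section \<open>Rationality of the splitting\<close>

definition regular_on :: "'x set \<Rightarrow> ('x \<Rightarrow> 'a::field_char_0) set \<Rightarrow> ('x \<Rightarrow> 'a) \<Rightarrow> bool" where
  "regular_on S V f \<longleftrightarrow> (\<exists>p \<in> poly_funs \<rat> V. \<forall>x\<in>S. f x = p x)"

lemma regular_functions_regular_on: "regular_functions S {f. regular_on S V f}"
proof
  fix f g :: "'a \<Rightarrow> 'b" assume "f \<in> {f. regular_on S V f}" "g \<in> {f. regular_on S V f}"
  then obtain p q where "p \<in> poly_funs \<rat> V" "\<forall>x\<in>S. f x = p x" "q \<in> poly_funs \<rat> V" "\<forall>x\<in>S. g x = q x"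
    by (auto simp: regular_on_def)
  then show "(\<lambda>x. f x + g x) \<in> {f. regular_on S V f}" "(\<lambda>x. f x * g x) \<in> {f. regular_on S V f}"
    using poly_funs.add[of p \<rat> V q] poly_funs.mult[of p \<rat> V q] unfolding regular_on_def by fastforce+
next
  fix c :: 'b assume "c \<in> \<rat>"
  then show "(\<lambda>_. c) \<in> {f. regular_on S V f}"
    using poly_funs.const[of c \<rat> V] by (auto simp: regular_on_def)
qed (auto simp: regular_on_def)

lemma regular_on_coord: "f \<in> V \<Longrightarrow> regular_on S V f"
  using poly_funs.coord[of f V \<rat>] by (auto simp: regular_on_def)

lemma rat_morphism_iff: "rat_morphism S V W \<Phi> \<longleftrightarrow> (\<forall>f\<in>W. regular_on S V (\<lambda>x. f (\<Phi> x)))"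
  by (simp add: rat_morphism_def regular_on_def)

lemma inv_B2_eq:
  assumes "b \<in> carrier (B2 :: 'a::field mat monoid)"
  shows "inv\<^bsub>B2\<^esub> b = inv_B2 b"
proof -
  interpret B2: group "B2 :: 'a mat monoid" by (rule group_B2)
  show ?thesis using B2.inv_equality[of "inv_B2 b" b] inv_B2[OF assms] assms by simp
qed

lemma B2_section_inv:
  assumes b: "b \<in> carrier (B2 :: 'a::field mat monoid)" and m: "m \<ge> 1"
  shows "inv\<^bsub>lie_Aut m\<^esub> (B2_section m b) = B2_section m (inv_B2 b)"
    and "B2_section m b * B2_section m (inv_B2 b) = 1\<^sub>m (lie_rank m)"
proof -
  interpret s: group_hom B2 "lie_Aut m" "B2_section m :: 'a mat \<Rightarrow> 'a mat"
    by (rule group_hom.intro[OF group_B2 group_lie_Aut group_hom_axioms.intro[OF B2_section_hom[OF m]]])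
  show 1: "inv\<^bsub>lie_Aut m\<^esub> (B2_section m b) = B2_section m (inv_B2 b)"
    using s.hom_inv[OF b] inv_B2_eq[OF b] by simp
  show "B2_section m b * B2_section m (inv_B2 b) = 1\<^sub>m (lie_rank m)"
    unfolding 1[symmetric] using s.H.r_inv[OF s.hom_closed[OF b]] by simp
qed

lemma lie_Aut_carrier:
  assumes "M \<in> carrier (lie_Aut m)"
  shows "M \<in> carrier_mat (lie_rank m) (lie_rank m)" "det M \<noteq> (0 :: 'a::field)"
  using assms by (auto simp: lie_Aut_def GL_carrier_iff)

lemma inverse_det_section:
  assumes b: "b \<in> carrier (B2 :: 'a::field mat monoid)" and m: "m \<ge> 1"
  shows "inverse (det (B2_section m b)) = det (B2_section m (inv_B2 b))"
    "det (B2_section m b) * det (B2_section m (inv_B2 b)) = 1"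
proof -
  note c = lie_Aut_carrier(1)[OF B2_section_in_lie_Aut[OF b m]]
    lie_Aut_carrier(1)[OF B2_section_in_lie_Aut[OF inv_B2(1)[OF b] m]]
  show *: "det (B2_section m b) * det (B2_section m (inv_B2 b)) = 1"
    unfolding det_mult[OF c, symmetric] B2_section_inv(2)[OF b m] by simp
  then show "inverse (det (B2_section m b)) = det (B2_section m (inv_B2 b))"
    by (rule inverse_unique)
qed

text \<open>
  Besides the entries, the inverse of the determinant has to be regular.  The determinant of a lift of \<open>b\<close> is inverse
  to that of the lift of \<open>b\<^sup>-\<^sup>1\<close>, which has polynomial entries in the coordinates of \<open>b\<close>.
\<close>

lemma rat_morphism_conj_and_mult:
  fixes m :: nat
  assumes m: "m \<ge> 1"
  defines "S \<equiv> carrier B2 \<times> carrier (lie_Aut0 m :: 'k::field_char_0 mat monoid)"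
  defines "V \<equiv> prod_coords (GL_coords 2) (GL_coords (lie_rank m))"
  shows "rat_morphism S V (GL_coords (lie_rank m)) (\<lambda>(b, g). conj_action (lie_Aut m) (carrier (lie_Aut0 m)) (B2_section m) b g)"
    and "rat_morphism S V (GL_coords (lie_rank m)) (\<lambda>(b, g). g \<otimes>\<^bsub>lie_Aut m\<^esub> B2_section m b)"
proof -
  let ?n = "lie_rank m"
    and ?\<theta> = "conj_action (lie_Aut m) (carrier (lie_Aut0 m :: 'k mat monoid)) (B2_section m)"
  interpret R: regular_functions S "{f. regular_on S V f}" by (rule regular_functions_regular_on)
  have g: "g \<in> carrier_mat ?n ?n" "det g \<noteq> 0" if "(b, g) \<in> S" for b g
    using that lie_Aut_carrier[of g m] by (auto simp: S_def lie_Aut0_def)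
  have b: "b \<in> carrier B2" if "(b, g) \<in> S" for b g using that by (simp add: S_def)
  have coord1: "regular_on S V (\<lambda>x. f (fst x))" if "f \<in> GL_coords 2" for f
    using that by (intro regular_on_coord) (auto simp: V_def prod_coords_def comp_def)
  have coord2: "regular_on S V (\<lambda>x. f (snd x))" if "f \<in> GL_coords ?n" for f
    using that by (intro regular_on_coord) (auto simp: V_def prod_coords_def comp_def)
  have entries: "regular_on S V (\<lambda>x. fst x $$ (i, j))" if "i < 2" "j < 2" for i j
    using that coord1[of "\<lambda>M. M $$ (i, j)"] by (auto simp: GL_coords_def mat_coords_def)
  have entries': "regular_on S V (\<lambda>x. snd x $$ (i, j))" if "i < ?n" "j < ?n" for i j
    using that coord2[of "\<lambda>M. M $$ (i, j)"] by (auto simp: GL_coords_def mat_coords_def)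
  have rg: "R.regular_mat ?n ?n snd"
    unfolding R.regular_mat_def using g entries' by auto
  have "R.regular_mat 2 2 fst"
    unfolding R.regular_mat_def using b entries by (auto simp: B2_iff)
  moreover have "(\<lambda>x. inverse (det (fst x))) \<in> {f. regular_on S V f}"
    using coord1[of "\<lambda>M. inverse (det M)"] by (simp add: GL_coords_def)
  ultimately have rb: "R.regular_B2 fst"
    using b by (intro R.regular_B2I) auto
  note rs = R.regular_B2_section[OF rb, of m] and rsi = R.regular_B2_section[OF R.regular_B2_inv[OF rb], of m]
  have inv_g: "regular_on S V (\<lambda>x. inverse (det (snd x)))"
    using coord2[of "\<lambda>M. inverse (det M)"] by (simp add: GL_coords_def)
  have morphI: "rat_morphism S V (GL_coords ?n) \<Psi>"
    if "R.regular_mat ?n ?n \<Psi>" "regular_on S V (\<lambda>x. inverse (det (\<Psi> x)))" for \<Psi>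
    using that by (auto simp: rat_morphism_iff GL_coords_def mat_coords_def R.regular_mat_def)
  have sc: "B2_section m b \<in> carrier_mat ?n ?n" "B2_section m (inv_B2 b) \<in> carrier_mat ?n ?n"
    if "b \<in> carrier B2" for b :: "'k mat"
    using that lie_Aut_carrier(1)[OF B2_section_in_lie_Aut[OF _ m]] inv_B2(1) by auto
  have conj: "?\<theta> b g
      = B2_section m b * g * B2_section m (inv_B2 b)" if "(b, g) \<in> S" for b g
    using that B2_section_inv(1)[OF b[OF that] m] by (simp add: conj_action_def S_def)
  show "rat_morphism S V (GL_coords ?n) (\<lambda>(b, g). ?\<theta> b g)"
  proof (rule morphI)
    show "R.regular_mat ?n ?n (\<lambda>(b, g). ?\<theta> b g)"
      using R.regular_mat_mult[OF R.regular_mat_mult[OF rs rg] rsi]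
      by (rule R.regular_mat_cong) (auto simp: conj)
    have "inverse (det (case x of (b, g) \<Rightarrow> ?\<theta> b g))
      = inverse (det (snd x))" if x: "x \<in> S" for x
    proof -
      obtain b g where bg: "x = (b, g)" "(b, g) \<in> S" using x by (cases x) auto
      have "det (B2_section m b * g * B2_section m (inv_B2 b)) = det (B2_section m b) * det (B2_section m (inv_B2 b)) * det g"
        using sc[OF b[OF bg(2)]] g[OF bg(2)] by (simp add: det_mult[of _ ?n] del: assoc_mult_mat)
      then show ?thesis using inverse_det_section(2)[OF b[OF bg(2)] m] bg by (simp add: conj)
    qed
    then show "regular_on S V (\<lambda>x. inverse (det (case x of (b, g) \<Rightarrow> ?\<theta> b g)))"
      using R.cong[of "\<lambda>x. inverse (det (snd x))"] inv_g by (simp only: mem_Collect_eq)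
  qed
  show "rat_morphism S V (GL_coords ?n) (\<lambda>(b, g). g \<otimes>\<^bsub>lie_Aut m\<^esub> B2_section m b)"
  proof (rule morphI)
    show "R.regular_mat ?n ?n (\<lambda>(b, g). g \<otimes>\<^bsub>lie_Aut m\<^esub> B2_section m b)"
      using R.regular_mat_mult[OF rg rs] by (rule R.regular_mat_cong) auto
    have "inverse (det (snd x)) * det (B2_section m (inv_B2 (fst x)))
      = inverse (det (case x of (b, g) \<Rightarrow> g \<otimes>\<^bsub>lie_Aut m\<^esub> B2_section m b))" if x: "x \<in> S" for x
    proof -
      obtain b g where bg: "x = (b, g)" "(b, g) \<in> S" using x by (cases x) auto
      show ?thesis
        using sc(1)[OF b[OF bg(2)]] g[OF bg(2)] inverse_det_section(1)[OF b[OF bg(2)] m] bg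
        by (simp add: det_mult[of _ ?n])
    qed
    moreover have "regular_on S V (\<lambda>x. inverse (det (snd x)) * det (B2_section m (inv_B2 (fst x))))"
      using R.mult[of "\<lambda>x. inverse (det (snd x))"] inv_g R.regular_det[OF rsi] by simp
    ultimately show "regular_on S V (\<lambda>x. inverse (det (case x of (b, g) \<Rightarrow> g \<otimes>\<^bsub>lie_Aut m\<^esub> B2_section m b)))"
      using R.cong[of "\<lambda>x. inverse (det (snd x)) * det (B2_section m (inv_B2 (fst x)))"]
      by (simp only: mem_Collect_eq)
  qed
qed

text \<open>
  The inverse of the multiplication map.  The inverse of the determinant of the centre block \<open>D\<close> is polynomial in the
  coordinates of \<open>M\<close>, since it equals \<open>det A / det M\<close> for the other diagonal block \<open>A\<close>.
\<close>

lemma rat_morphism_decompose: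
  fixes m :: nat
  assumes m: "m \<ge> 1"
  shows "rat_morphism (carrier (lie_Aut m :: 'k::field_char_0 mat monoid)) (GL_coords (lie_rank m))
    (prod_coords (GL_coords 2) (GL_coords (lie_rank m)))
    (\<lambda>M. (centre_block m M, M \<otimes>\<^bsub>lie_Aut m\<^esub> inv\<^bsub>lie_Aut m\<^esub> (B2_section m (centre_block m M))))"
proof -
  let ?n = "lie_rank m"
  define S where "S = carrier (lie_Aut m :: 'k mat monoid)"
  define V where "V = (GL_coords ?n :: ('k mat \<Rightarrow> 'k) set)"
  interpret R: regular_functions S "{f. regular_on S V f}" by (rule regular_functions_regular_on)
  interpret p: group_hom "lie_Aut m" B2 "centre_block m :: 'k mat \<Rightarrow> 'k mat"
    by (rule group_hom_centre_block[OF m])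
  have M: "M \<in> carrier_mat ?n ?n" "det M \<noteq> 0" if "M \<in> S" for M
    using that lie_Aut_carrier[of M m] by (auto simp: S_def)
  have b: "centre_block m M \<in> carrier B2" if "M \<in> S" for M
    using that p.hom_closed by (simp add: S_def)
  have rM: "R.regular_mat ?n ?n (\<lambda>M. M)"
    unfolding R.regular_mat_def using M
    by (auto simp: V_def GL_coords_def mat_coords_def intro!: regular_on_coord)
  have inv_M: "regular_on S V (\<lambda>M. inverse (det M))"
    by (auto simp: V_def GL_coords_def intro!: regular_on_coord)
  have rb: "R.regular_mat 2 2 (centre_block m)"
  proof (rule R.regular_matI)
    fix i j :: nat assume "i < 2" "j < 2"
    then show "\<exists>f\<in>{f. regular_on S V f}. \<forall>x\<in>S. f x = centre_block m x $$ (i, j)"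
      using R.regular_mat_entry[OF rM, of "2 * m + i" "2 * m + j"]
      by (intro bexI[of _ "\<lambda>x. x $$ (2 * m + i, 2 * m + j)"]) (auto simp: centre_block_def)
  qed (simp add: centre_block_def)
  \<comment> \<open>\<open>det M = det A * det D\<close> with \<open>A\<close> the upper left block\<close>
  define P where "P M = mat (2 * m) (2 * m) (\<lambda>(i, j). M $$ (i, j))" for M :: "'k mat"
  have rP: "R.regular_mat (2 * m) (2 * m) P"
  proof (rule R.regular_matI)
    fix i j assume "i < 2 * m" "j < 2 * m"
    then show "\<exists>f\<in>{f. regular_on S V f}. \<forall>x\<in>S. f x = P x $$ (i, j)"
      using R.regular_mat_entry[OF rM, of i j]
      by (intro bexI[of _ "\<lambda>x. x $$ (i, j)"]) (auto simp: P_def)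
  qed (simp add: P_def)
  have "det (P M) * inverse (det M) = inverse (det (centre_block m M))" if MS: "M \<in> S" for M
  proof -
    obtain A C D where AD: "aut_blocks m A C D" "M = four_block_mat A C (0\<^sub>m 2 (2 * m)) D"
      using MS unfolding S_def lie_Aut_iff[OF m] by blast
    then have c: "A \<in> carrier_mat (2 * m) (2 * m)" "C \<in> carrier_mat (2 * m) 2" "D \<in> carrier_mat 2 2" "det A \<noteq> 0"
      by (auto simp: aut_blocks_def B2_iff)
    have "P M = A" using c(1,3) by (intro eq_matI) (auto simp: P_def AD(2))
    moreover have "centre_block m M = D" unfolding AD(2) by (rule centre_block_four_block[OF c(1,3)])
    moreover have "det M = det A * det D"
      unfolding AD(2) by (rule det_four_block_mat_lower_left_zero[OF c(1,2) refl c(3)])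
    ultimately show ?thesis using c(4) by (simp add: field_simps)
  qed
  moreover have "regular_on S V (\<lambda>M. det (P M) * inverse (det M))"
    using R.mult[of "\<lambda>M. det (P M)" "\<lambda>M. inverse (det M)"] R.regular_det[OF rP] inv_M by simp
  ultimately have inv_b: "regular_on S V (\<lambda>M. inverse (det (centre_block m M)))"
    using R.cong[of "\<lambda>M. det (P M) * inverse (det M)"] by (simp only: mem_Collect_eq)
  then have RB: "R.regular_B2 (centre_block m)"
    using b rb by (intro R.regular_B2I) auto
  note rs = R.regular_B2_section[OF RB, of m] and rsi = R.regular_B2_section[OF R.regular_B2_inv[OF RB], of m]
  let ?n_part = "\<lambda>M. M \<otimes>\<^bsub>lie_Aut m\<^esub> inv\<^bsub>lie_Aut m\<^esub> (B2_section m (centre_block m M))"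
  have n_part: "?n_part M = M * B2_section m (inv_B2 (centre_block m M))" if "M \<in> S" for M
    using B2_section_inv(1)[OF b[OF that] m] by simp
  have rn: "R.regular_mat ?n ?n ?n_part"
    using R.regular_mat_mult[OF rM rsi] by (rule R.regular_mat_cong) (simp only: n_part)
  have "inverse (det M) * det (B2_section m (centre_block m M)) = inverse (det (?n_part M))" if "M \<in> S" for M
  proof -
    note bM = b[OF that]
    have sc: "B2_section m (inv_B2 (centre_block m M)) \<in> carrier_mat ?n ?n"
      using lie_Aut_carrier(1)[OF B2_section_in_lie_Aut[OF inv_B2(1)[OF bM] m]] .
    have "inverse (det (B2_section m (inv_B2 (centre_block m M)))) = det (B2_section m (centre_block m M))"
      using inverse_det_section(1)[OF bM m] by (metis inverse_inverse_eq)
    then show ?thesis unfolding n_part[OF that] det_mult[OF M(1)[OF that] sc] by simp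
  qed
  moreover have "regular_on S V (\<lambda>M. inverse (det M) * det (B2_section m (centre_block m M)))"
    using R.mult[of "\<lambda>M. inverse (det M)"] R.regular_det[OF rs] inv_M by simp
  ultimately have inv_n: "regular_on S V (\<lambda>M. inverse (det (?n_part M)))"
    using R.cong[of "\<lambda>M. inverse (det M) * det (B2_section m (centre_block m M))"]
    by (simp only: mem_Collect_eq)
  have "regular_on S V (\<lambda>M. f (centre_block m M))" if "f \<in> GL_coords 2" for f
    using that inv_b rb by (auto simp: GL_coords_def mat_coords_def R.regular_mat_def)
  moreover have "regular_on S V (\<lambda>M. f (?n_part M))" if "f \<in> GL_coords ?n" for f
    using that inv_n rn by (auto simp: GL_coords_def mat_coords_def R.regular_mat_def)
  ultimately show ?thesis
    unfolding S_def[symmetric] rat_morphism_iff prod_coords_def V_def by auto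
qed

section \<open>Toeplitz matrices and truncated polynomials\<close>

text \<open>
  Multiplication by \<open>p\<close> on \<open>k[t]/(t\<^sup>m)\<close>, acting on column vectors in the basis of the powers of \<open>t\<close>.
\<close>

definition toeplitz :: "nat \<Rightarrow> 'a::comm_ring_1 poly \<Rightarrow> 'a mat" where
  "toeplitz m p = mat m m (\<lambda>(i, j). if j \<le> i then coeff p (i - j) else 0)"

text \<open>
  The permutation matrix that reverses the order of the basis.  It is needed for the \<open>x\<^sub>i\<close>: on column vectors, \<open>t\<close>
  raises the indices of the \<open>y\<^sub>j\<close> but lowers those of the \<open>x\<^sub>i\<close>.
\<close>

definition rev_mat :: "nat \<Rightarrow> 'a::comm_ring_1 mat" where
  "rev_mat m = mat m m (\<lambda>(i, j). of_bool (i + j + 1 = m))"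

definition coeff_col :: "nat \<Rightarrow> 'a::comm_ring_1 poly \<Rightarrow> 'a mat" where
  "coeff_col m p = mat m 1 (\<lambda>(i, j). coeff p i)"

lemma toeplitz_carrier [simp]: "toeplitz m p \<in> carrier_mat m m"
  and rev_mat_carrier [simp]: "rev_mat m \<in> carrier_mat m m"
  and coeff_col_carrier [simp]: "coeff_col m p \<in> carrier_mat m 1"
  by (simp_all add: toeplitz_def rev_mat_def coeff_col_def)

lemma toeplitz_add: "toeplitz m (p + q) = toeplitz m p + toeplitz m q"
  and toeplitz_diff: "toeplitz m (p - q) = toeplitz m p - toeplitz m q"
  and toeplitz_0: "toeplitz m 0 = 0\<^sub>m m m"
  and toeplitz_1: "toeplitz m 1 = 1\<^sub>m m"
  by (rule eq_matI; force simp: toeplitz_def)+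

lemma toeplitz_t: "toeplitz m ([:0, 1:]) = transpose_mat (shift_mat m)"
  by (intro eq_matI) (auto simp: toeplitz_def shift_mat_def coeff_pCons split: nat.splits)

lemma toeplitz_mult: "toeplitz m (p * q) = toeplitz m p * toeplitz m (q :: 'a::comm_ring_1 poly)"
proof (rule eq_matI)
  fix i j assume "i < dim_row (toeplitz m p * toeplitz m q)" "j < dim_col (toeplitz m p * toeplitz m q)"
  then have ij: "i < m" "j < m" by (simp_all add: toeplitz_def)
  have "(toeplitz m p * toeplitz m q) $$ (i, j) =
      (\<Sum>k\<in>{0..<m}. if j \<le> k \<and> k \<le> i then coeff p (i - k) * coeff q (k - j) else 0)"
    using ij by (auto simp: toeplitz_def scalar_prod_def intro!: sum.cong)
  also have "\<dots> = (\<Sum>k\<in>{j..i}. coeff p (i - k) * coeff q (k - j))"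
    using ij by (intro sum.mono_neutral_cong_right) auto
  also have "\<dots> = toeplitz m (p * q) $$ (i, j)"
  proof (cases "j \<le> i")
    case True
    have "(\<Sum>k\<in>{j..i}. coeff p (i - k) * coeff q (k - j)) = (\<Sum>l\<le>i - j. coeff p l * coeff q (i - j - l))"
      using True by (intro sum.reindex_bij_witness[of _ "\<lambda>l. i - l" "\<lambda>k. i - k"]) auto
    then show ?thesis using True ij by (simp add: toeplitz_def coeff_mult)
  qed (use ij in \<open>simp add: toeplitz_def\<close>)
  finally show "toeplitz m (p * q) $$ (i, j) = (toeplitz m p * toeplitz m q) $$ (i, j)" ..
qed (simp_all add: toeplitz_def)

lemma toeplitz_eq_iff: "toeplitz m p = toeplitz m q \<longleftrightarrow> (\<forall>i<m. coeff p i = coeff q i)"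
proof
  assume eq: "toeplitz m p = toeplitz m q"
  have "toeplitz m r $$ (i, 0) = coeff r i" if "i < m" for r :: "'a poly" and i
    using that by (auto simp: toeplitz_def)
  then show "\<forall>i<m. coeff p i = coeff q i" using eq by metis
qed (auto simp: toeplitz_def)

lemma coeff_col_eq_iff: "coeff_col m p = coeff_col m q \<longleftrightarrow> (\<forall>i<m. coeff p i = coeff q i)"
proof
  assume eq: "coeff_col m p = coeff_col m q"
  have "coeff_col m r $$ (i, 0) = coeff r i" if "i < m" for r :: "'a poly" and i
    using that by (simp add: coeff_col_def)
  then show "\<forall>i<m. coeff p i = coeff q i" using eq by metis
qed (auto simp: coeff_col_def)

lemma coeff_col_eq_toeplitz: "coeff_col m p = toeplitz m p * coeff_col m (1 :: 'a::comm_ring_1 poly)"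
proof (rule eq_matI)
  fix i j assume "i < dim_row (toeplitz m p * coeff_col m 1)" "j < dim_col (toeplitz m p * coeff_col m 1)"
  then have ij: "i < m" "j = 0" by (simp_all add: toeplitz_def coeff_col_def)
  have "(toeplitz m p * coeff_col m 1) $$ (i, j) = (\<Sum>k\<in>{0..<m}. if k = 0 then coeff p i else 0)"
    using ij by (auto simp: toeplitz_def coeff_col_def scalar_prod_def intro!: sum.cong)
  then show "coeff_col m p $$ (i, j) = (toeplitz m p * coeff_col m 1) $$ (i, j)"
    using ij by (simp add: coeff_col_def)
qed (simp_all add: toeplitz_def coeff_col_def)

lemma toeplitz_mult_coeff_col: "toeplitz m p * coeff_col m q = coeff_col m (p * q)"
proof -
  have "coeff_col m (p * q) = toeplitz m p * toeplitz m q * coeff_col m 1"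
    by (simp add: coeff_col_eq_toeplitz[of m "p * q"] toeplitz_mult)
  also have "\<dots> = toeplitz m p * (toeplitz m q * coeff_col m 1)"
    by (rule assoc_mult_mat[of _ m m _ m _ 1]) (rule toeplitz_carrier coeff_col_carrier)+
  also have "toeplitz m q * coeff_col m 1 = coeff_col m q" by (rule coeff_col_eq_toeplitz[symmetric])
  finally show ?thesis by (rule sym)
qed

lemma coeff_col_add: "coeff_col m (p + q) = coeff_col m p + coeff_col m q"
  by (intro eq_matI) (auto simp: coeff_col_def)

lemma rev_mult_entry:
  assumes "F \<in> carrier_mat m k" "i < m" "j < k"
  shows "(rev_mat m * F) $$ (i, j) = (F $$ (m - 1 - i, j) :: 'a::comm_ring_1)"
proof -
  have "(rev_mat m * F) $$ (i, j) = (\<Sum>r\<in>{0..<m}. rev_mat m $$ (i, r) * F $$ (r, j))"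
    using assms by (simp add: scalar_prod_def rev_mat_def)
  also have "\<dots> = (\<Sum>r\<in>{0..<m}. if r = m - 1 - i then F $$ (r, j) else 0)"
    using assms by (intro sum.cong[OF refl]) (auto simp: rev_mat_def)
  finally have "(rev_mat m * F) $$ (i, j) = (\<Sum>r\<in>{0..<m}. if r = m - 1 - i then F $$ (r, j) else 0)" .
  then show ?thesis using assms by simp
qed

lemma mult_rev_entry:
  assumes "F \<in> carrier_mat k m" "i < k" "j < m"
  shows "(F * rev_mat m) $$ (i, j) = (F $$ (i, m - 1 - j) :: 'a::comm_ring_1)"
proof -
  have "(F * rev_mat m) $$ (i, j) = (\<Sum>r\<in>{0..<m}. F $$ (i, r) * rev_mat m $$ (r, j))"
    using assms by (simp add: scalar_prod_def rev_mat_def)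
  also have "\<dots> = (\<Sum>r\<in>{0..<m}. if r = m - 1 - j then F $$ (i, r) else 0)"
    using assms by (intro sum.cong[OF refl]) (auto simp: rev_mat_def)
  finally have "(F * rev_mat m) $$ (i, j) = (\<Sum>r\<in>{0..<m}. if r = m - 1 - j then F $$ (i, r) else 0)" .
  then show ?thesis using assms by simp
qed

lemma rev_mat_square: "rev_mat m * rev_mat m = (1\<^sub>m m :: 'a::comm_ring_1 mat)"
proof (rule eq_matI)
  fix i j assume ij: "i < dim_row (1\<^sub>m m :: 'a mat)" "j < dim_col (1\<^sub>m m :: 'a mat)"
  then show "(rev_mat m * rev_mat m) $$ (i, j) = (1\<^sub>m m :: 'a mat) $$ (i, j)"
    by (subst rev_mult_entry[of _ m m]) (auto simp: rev_mat_def)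
qed (simp_all add: rev_mat_def)

lemma rev_mat_cancel:
  assumes "F \<in> carrier_mat m k"
  shows "rev_mat m * (rev_mat m * F) = (F :: 'a::comm_ring_1 mat)"
proof -
  have "rev_mat m * (rev_mat m * F) = rev_mat m * rev_mat m * F"
    using assms by (intro assoc_mult_mat[of _ m m _ m _ k, symmetric]) auto
  then show ?thesis using assms by (simp add: rev_mat_square)
qed

lemma transpose_rev_mat: "transpose_mat (rev_mat m) = rev_mat m"
  by (intro eq_matI) (auto simp: rev_mat_def)

text \<open>
  Toeplitz matrices are persymmetric; this is the self-adjointness of multiplication by \<open>p\<close> for the form that takes
  \<open>u\<close>, \<open>v\<close> to the coefficient of \<open>t\<^bsup>m-1\<^esup>\<close> in \<open>u v\<close>.
\<close>

lemma transpose_toeplitz: "transpose_mat (toeplitz m p) = rev_mat m * toeplitz m p * (rev_mat m :: 'a::comm_ring_1 mat)"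
proof (rule eq_matI)
  have RT: "rev_mat m * toeplitz m p \<in> carrier_mat m m" by (rule mult_carrier_mat[of _ m m]) simp_all
  fix i j assume "i < dim_row (rev_mat m * toeplitz m p * rev_mat m)" "j < dim_col (rev_mat m * toeplitz m p * rev_mat m)"
  then have ij: "i < m" "j < m" by (simp_all add: rev_mat_def)
  have "(rev_mat m * toeplitz m p * rev_mat m) $$ (i, j) = toeplitz m p $$ (m - 1 - i, m - 1 - j)"
    using ij by (subst mult_rev_entry[OF RT ij], subst rev_mult_entry[of _ m m]) auto
  then show "transpose_mat (toeplitz m p) $$ (i, j) = (rev_mat m * toeplitz m p * rev_mat m) $$ (i, j)"
    using ij by (auto simp: toeplitz_def)
qed (simp_all add: rev_mat_def toeplitz_def)

lemma shift_mat_eq: "shift_mat m = rev_mat m * toeplitz m ([:0, 1:]) * (rev_mat m :: 'a::comm_ring_1 mat)"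
  unfolding transpose_toeplitz[symmetric] by (simp add: toeplitz_t)

text \<open>
  A map commuting with \<open>t\<close> is linear over \<open>k[t]/(t\<^sup>m)\<close>, hence multiplication by the image of 1, its first column.
\<close>

lemma centralizer_shift:
  assumes F: "F \<in> carrier_mat m m" and comm: "F * toeplitz m ([:0, 1:]) = toeplitz m ([:0, 1:]) * F"
  shows "\<exists>p. F = toeplitz m (p :: 'a::comm_ring_1 poly)"
proof -
  \<comment> \<open>the image of 1 under \<open>F\<close>\<close>
  define p where "p = (\<Sum>i<m. monom (F $$ (i, 0)) i)"
  have p: "coeff p i = (if i < m then F $$ (i, 0) else 0)" for i
    by (simp add: p_def coeff_sum)
  have r: "(F * toeplitz m ([:0, 1:])) $$ (i, j) = (if j + 1 < m then F $$ (i, j + 1) else 0)"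
    if "i < m" "j < m" for i j
  proof -
    have "(F * toeplitz m ([:0, 1:])) $$ (i, j) = (\<Sum>k\<in>{0..<m}. F $$ (i, k) * of_bool (j + 1 = k))"
      using that F by (simp add: toeplitz_t scalar_prod_def shift_mat_def)
    also have "\<dots> = (\<Sum>k\<in>{0..<m}. if k = j + 1 then F $$ (i, k) else 0)"
      by (intro sum.cong[OF refl]) auto
    finally show ?thesis by simp
  qed
  have l: "(toeplitz m ([:0, 1:]) * F) $$ (i, j) = (if i \<ge> 1 then F $$ (i - 1, j) else 0)"
    if "i < m" "j < m" for i j
  proof (cases i)
    case 0 then show ?thesis using that F by (simp add: toeplitz_t scalar_prod_def shift_mat_def)
  next
    case (Suc i')
    have "(toeplitz m ([:0, 1:]) * F) $$ (i, j) = (\<Sum>k\<in>{0..<m}. if k = i' then F $$ (k, j) else 0)"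
      using that F Suc by (auto simp: toeplitz_t scalar_prod_def shift_mat_def intro!: sum.cong)
    then show ?thesis using that Suc by simp
  qed
  have rec: "F $$ (i, Suc j) = (if i \<ge> 1 then F $$ (i - 1, j) else 0)" if "i < m" "Suc j < m" for i j
    using r[of i j] l[of i j] comm that by simp
  have T: "F $$ (i, j) = (if j \<le> i then F $$ (i - j, 0) else 0)" if "i < m" "j < m" for i j
    using that
  proof (induction j arbitrary: i)
    case (Suc j)
    then show ?case using rec[of i j] by (cases i) auto
  qed simp
  have "F = toeplitz m p"
  proof (rule eq_matI)
    fix i j assume "i < dim_row (toeplitz m p)" "j < dim_col (toeplitz m p)"
    then show "F $$ (i, j) = toeplitz m p $$ (i, j)"
      using T[of i j] by (auto simp: toeplitz_def p)
  qed (use F in \<open>auto simp: toeplitz_def\<close>)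
  then show ?thesis by blast
qed

section \<open>Isometries of both forms\<close>

text \<open>
  A \<open>2 \<times> 2\<close> matrix over \<open>k[t]/(t\<^sup>m)\<close>, acting on pairs of polynomials: in a column vector, the
  entries for the \<open>x\<^sub>i\<close>, in reverse order, and those for the \<open>y\<^sub>j\<close> are the coefficients of the two polynomials.
\<close>

definition sl_mat :: "nat \<Rightarrow> 'a::comm_ring_1 poly \<Rightarrow> 'a poly \<Rightarrow> 'a poly \<Rightarrow> 'a poly \<Rightarrow> 'a mat" where
  "sl_mat m \<alpha> \<beta> \<gamma> \<delta> = four_block_mat
     (rev_mat m * toeplitz m \<alpha> * rev_mat m) (rev_mat m * toeplitz m \<beta>)
     (toeplitz m \<gamma> * rev_mat m) (toeplitz m \<delta>)"

lemma square_mult_closed [simp]: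
  "A \<in> carrier_mat m m \<Longrightarrow> B \<in> carrier_mat m m \<Longrightarrow> A * B \<in> carrier_mat m m"
  by (rule mult_carrier_mat)

lemma sl_mat_carrier [simp]: "sl_mat m \<alpha> \<beta> \<gamma> \<delta> \<in> carrier_mat (2 * m) (2 * m)"
  unfolding sl_mat_def by (rule block_diag_carrier) simp_all

lemma sl_mat_mult:
  "sl_mat m \<alpha> \<beta> \<gamma> \<delta> * sl_mat m \<alpha>' \<beta>' \<gamma>' \<delta>' =
   sl_mat m (\<alpha> * \<alpha>' + \<beta> * \<gamma>') (\<alpha> * \<beta>' + \<beta> * \<delta>') (\<gamma> * \<alpha>' + \<delta> * \<gamma>') (\<gamma> * \<beta>' + \<delta> * (\<delta>' :: 'a::comm_ring_1 poly))"
  unfolding sl_mat_def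
  by (subst mult_square_blocks[where m = m])
     (simp_all add: toeplitz_add toeplitz_mult square_mat_algebra[where m = m] rev_mat_cancel[of _ m m] right_mult_one_mat[of _ m m])

lemma block_congruence:
  fixes F :: "'a::comm_ring_1 mat"
  assumes A: "A1 \<in> carrier_mat m m" "A2 \<in> carrier_mat m m" "A3 \<in> carrier_mat m m" "A4 \<in> carrier_mat m m"
    and F: "F \<in> carrier_mat m m"
  shows "four_block_mat A1 A2 A3 A4 * skew m F * transpose_mat (four_block_mat A1 A2 A3 A4) =
    four_block_mat (A1 * F * transpose_mat A2 - A2 * transpose_mat F * transpose_mat A1)
      (A1 * F * transpose_mat A4 - A2 * transpose_mat F * transpose_mat A3)
      (A3 * F * transpose_mat A2 - A4 * transpose_mat F * transpose_mat A1)
      (A3 * F * transpose_mat A4 - A4 * transpose_mat F * transpose_mat A3)"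
proof -
  have 1: "four_block_mat A1 A2 A3 A4 * skew m F =
      four_block_mat (- (A2 * transpose_mat F)) (A1 * F) (- (A4 * transpose_mat F)) (A3 * F)"
    unfolding skew_def using A F
    by (subst mult_square_blocks[where m = m])
       (simp_all add: right_mult_zero_mat[of _ m m])
  have diff: "- B + C = C - B" if "B \<in> carrier_mat m m" "C \<in> carrier_mat m m" for B C :: "'a mat"
    using that by (intro eq_matI) auto
  show ?thesis
    unfolding 1 transpose_four_block_mat[OF A] using A F
    by (subst mult_square_blocks[where m = m])
       (simp_all add: diff square_mat_algebra(1)[where m = m])
qed

lemma skew_rev_toeplitz:
  "skew m (rev_mat m * toeplitz m f * rev_mat m) =
   four_block_mat (0\<^sub>m m m) (rev_mat m * toeplitz m f * rev_mat m) (- toeplitz m f) (0\<^sub>m m m :: 'a::comm_ring_1 mat)"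
proof -
  have "transpose_mat (rev_mat m * toeplitz m f * rev_mat m) = toeplitz m f"
    unfolding transpose_toeplitz[symmetric] by simp
  then show ?thesis by (simp add: skew_def)
qed

text \<open>
  A \<open>2 \<times> 2\<close> matrix transforms the determinant form by its determinant.  For \<open>f = 1\<close> and \<open>f = t\<close> the matrices are
  those of the two forms \<open>B\<^sub>1\<close> and \<open>B\<^sub>2\<close>.
\<close>

lemma sl_mat_congruence:
  "sl_mat m \<alpha> \<beta> \<gamma> \<delta> * skew m (rev_mat m * toeplitz m f * rev_mat m) * transpose_mat (sl_mat m \<alpha> \<beta> \<gamma> \<delta>) =
   skew m (rev_mat m * toeplitz m (f * (\<alpha> * \<delta> - \<beta> * \<gamma>)) * (rev_mat m :: 'a::comm_ring_1 mat))"
proof -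
  let ?R = "rev_mat m :: 'a mat" and ?t = "toeplitz m :: 'a poly \<Rightarrow> 'a mat"
  note R = rev_mat_cancel[of _ m m] rev_mat_square right_mult_one_mat[of _ m m]
  have t: "transpose_mat (?R * ?t p * ?R) = ?t p" "transpose_mat (?R * ?t p) = ?R * ?t p"
    "transpose_mat (?t p * ?R) = ?t p * ?R" "transpose_mat (?t p) = ?R * ?t p * ?R" for p
    by (simp_all add: transpose_mult[of _ m m _ m] transpose_rev_mat transpose_toeplitz
        square_mat_algebra(1)[where m = m] R)
  have mm: "?t p * (?t q * F) = ?t (p * q) * F" if "F \<in> carrier_mat m m" for p q F
    using that by (simp add: toeplitz_mult square_mat_algebra(1)[where m = m])
  have d: "A * ?R - B * ?R = (A - B) * ?R" "?R * A - ?R * B = ?R * (A - B)"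
    if "A \<in> carrier_mat m m" "B \<in> carrier_mat m m" for A B
    using that by (simp_all add: minus_mult_distrib_mat[of _ m m _ _ m] mult_minus_distrib_mat[of _ m m])
  have z: "A - A = 0\<^sub>m m m" if "A \<in> carrier_mat m m" for A :: "'a mat"
    using that by (intro eq_matI) auto
  note s = square_mat_algebra(1)[where m = m] R mm toeplitz_mult[symmetric]
  show ?thesis
    unfolding sl_mat_def
    apply (subst block_congruence)
    apply (simp_all only: square_mult_closed toeplitz_carrier rev_mat_carrier)
    unfolding skew_rev_toeplitz
  proof (rule cong_four_block_mat)
    show "?R * ?t \<alpha> * ?R * (?R * ?t f * ?R) * transpose_mat (?R * ?t \<beta>) -
      ?R * ?t \<beta> * transpose_mat (?R * ?t f * ?R) * transpose_mat (?R * ?t \<alpha> * ?R) = 0\<^sub>m m m"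
      unfolding t by (simp add: s) (simp add: mult_ac z)
    show "?R * ?t \<alpha> * ?R * (?R * ?t f * ?R) * transpose_mat (?t \<delta>) -
      ?R * ?t \<beta> * transpose_mat (?R * ?t f * ?R) * transpose_mat (?t \<gamma> * ?R)
      = ?R * ?t (f * (\<alpha> * \<delta> - \<beta> * \<gamma>)) * ?R"
      unfolding t by (simp add: s) (simp add: d toeplitz_diff[symmetric] algebra_simps)
    show "?t \<gamma> * ?R * (?R * ?t f * ?R) * transpose_mat (?R * ?t \<beta>) -
      ?t \<delta> * transpose_mat (?R * ?t f * ?R) * transpose_mat (?R * ?t \<alpha> * ?R)
      = - ?t (f * (\<alpha> * \<delta> - \<beta> * \<gamma>))"
    proof -
      have "- ?t (f * (\<alpha> * \<delta> - \<beta> * \<gamma>)) = ?t (\<gamma> * (f * \<beta>)) - ?t (\<delta> * (f * \<alpha>))"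
      proof -
        have "f * (\<alpha> * \<delta> - \<beta> * \<gamma>) = \<delta> * (f * \<alpha>) - \<gamma> * (f * \<beta>)" by (simp add: algebra_simps)
        then show ?thesis
          by (simp only: toeplitz_diff) (intro eq_matI, auto simp: toeplitz_def)
      qed
      then show ?thesis unfolding t by (simp add: s mult.assoc)
    qed
    show "?t \<gamma> * ?R * (?R * ?t f * ?R) * transpose_mat (?t \<delta>) -
      ?t \<delta> * transpose_mat (?R * ?t f * ?R) * transpose_mat (?t \<gamma> * ?R) = 0\<^sub>m m m"
      unfolding t by (simp add: s) (simp add: mult_ac z)
  qed
qed

lemma skew_one_eq: "skew m (1\<^sub>m m) = skew m (rev_mat m * toeplitz m 1 * (rev_mat m :: 'a::comm_ring_1 mat))"
  by (simp add: toeplitz_1 rev_mat_square right_mult_one_mat[of _ m m])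

text \<open>
  A common isometry of two forms, one of them nondegenerate, commutes with the operator \<open>T\<close> relating them.
\<close>

lemma isometries_commute:
  assumes A: "A \<in> carrier_mat (2 * m) (2 * m)" "det A \<noteq> 0"
    and 1: "A * skew m (1\<^sub>m m) * transpose_mat A = skew m (1\<^sub>m m)"
    and F: "F \<in> carrier_mat m m" and 2: "A * skew m F * transpose_mat A = skew m (F :: 'a::field mat)"
  defines "T \<equiv> four_block_mat F (0\<^sub>m m m) (0\<^sub>m m m) (transpose_mat F)"
  shows "A * T = T * A"
proof -
  let ?J = "skew m (1\<^sub>m m) :: 'a mat"
  have T: "T \<in> carrier_mat (2 * m) (2 * m)" unfolding T_def using F by (intro block_diag_carrier) auto
  have FT: "skew m F = T * ?J" unfolding T_def by (rule skew_eq_block_diag_mult[OF F])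
  have At: "transpose_mat A \<in> carrier_mat (2 * m) (2 * m)" using A by simp
  obtain W where W: "W \<in> carrier_mat (2 * m) (2 * m)" "transpose_mat A * W = 1\<^sub>m (2 * m)"
    using det_non_zero_imp_unit[OF At, of "()"] A det_transpose[OF A(1)]
    by (auto simp: Units_def ring_mat_def)
  note sq = square_mat_algebra(1)[where m = "2 * m"]
  have cancel: "A * G = H * W" if "A * G * transpose_mat A = H" "G \<in> carrier_mat (2 * m) (2 * m)" for G H
  proof -
    have "H * W = A * G * (transpose_mat A * W)"
      unfolding that(1)[symmetric] using that(2) A At W(1) by (simp add: sq)
    then show ?thesis unfolding W(2) using that(2) A by simp
  qed
  \<comment> \<open>Both Gram matrices are carried through \<open>A\<close> by the same matrix \<open>W\<close>, the inverse of its transpose.\<close>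
  have JW: "A * ?J = ?J * W" by (rule cancel[OF 1]) simp
  have "A * (T * ?J) = T * ?J * W"
    using cancel[OF 2] unfolding FT using T by simp
  also have "\<dots> = T * (A * ?J)" unfolding JW using T W(1) by (simp add: sq)
  finally have "A * (T * ?J) * ?J = T * (A * ?J) * ?J" by simp
  then have "A * T * (?J * ?J) = T * A * (?J * ?J)" using A T by (simp add: sq)
  then have "- (A * T) = - (T * A)" unfolding skew_one_square using A T by simp
  then show ?thesis by simp
qed

text \<open>
  Isometries of both forms commute with \<open>t\<close>, so that their four blocks are given by polynomials; the remaining condition
  is that the determinant is 1 modulo \<open>t\<^sup>m\<close>.
\<close>

lemma aut_blocks_one_iff:
  assumes m: "m \<ge> 1"
  shows "aut_blocks m A C (1\<^sub>m 2) \<longleftrightarrow> C \<in> carrier_mat (2 * m) 2 \<and>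
    (\<exists>\<alpha> \<beta> \<gamma> \<delta>. A = sl_mat m \<alpha> \<beta> \<gamma> \<delta> \<and> toeplitz m (\<alpha> * \<delta> - \<beta> * \<gamma>) = toeplitz m (1 :: 'a::field poly))"
    (is "_ \<longleftrightarrow> _ \<and> ?sl")
proof -
  let ?R = "rev_mat m :: 'a mat" and ?Z = "toeplitz m [:0, 1:] :: 'a mat"
  note sq = square_mat_algebra(1)[where m = m] rev_mat_cancel[of _ m m] rev_mat_square right_mult_one_mat[of _ m m]
  let ?ab = "A \<in> carrier_mat (2 * m) (2 * m) \<and> det A \<noteq> 0
     \<and> A * skew m (1\<^sub>m m) * transpose_mat A = skew m (1\<^sub>m m)
     \<and> A * skew m (shift_mat m) * transpose_mat A = skew m (shift_mat m)"
  have "aut_blocks m A C (1\<^sub>m 2) \<longleftrightarrow> C \<in> carrier_mat (2 * m) 2 \<and> ?ab"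
    by (auto simp: aut_blocks_def B2_iff pencil_1_0 pencil_0_1)
  moreover have "?ab \<longleftrightarrow> ?sl"
  proof
    assume ?sl
    then obtain \<alpha> \<beta> \<gamma> \<delta> where A: "A = sl_mat m \<alpha> \<beta> \<gamma> \<delta>"
      and det: "toeplitz m (\<alpha> * \<delta> - \<beta> * \<gamma>) = (1\<^sub>m m :: 'a mat)" by (auto simp: toeplitz_1)
    have tr: "A * skew m (?R * toeplitz m f * ?R) * transpose_mat A = skew m (?R * toeplitz m f * ?R)" for f
      unfolding A sl_mat_congruence toeplitz_mult det by (simp add: right_mult_one_mat[of _ m m])
    have 1: "A * skew m (1\<^sub>m m) * transpose_mat A = skew m (1\<^sub>m m)"
      unfolding skew_one_eq by (rule tr)
    have "det (skew m (pencil m 1 0)) \<noteq> (0 :: 'a)" by (simp add: det_skew_pencil_eq_0_iff[OF m])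
    then have "det (A * skew m (1\<^sub>m m) * transpose_mat A) \<noteq> 0"
      unfolding 1 pencil_1_0 .
    then have "det A \<noteq> 0"
      by (auto simp: A det_mult[of _ "2 * m"])
    then show ?ab using 1 tr[of "[:0, 1:]"] by (simp add: A shift_mat_eq)
  next
    assume ab: ?ab
    obtain A1 A2 A3 A4 where "split_block A m m = (A1, A2, A3, A4)" by (metis prod_cases4)
    from split_block[OF this, of m m] ab
    have c: "A1 \<in> carrier_mat m m" "A2 \<in> carrier_mat m m" "A3 \<in> carrier_mat m m" "A4 \<in> carrier_mat m m"
      and Aeq: "A = four_block_mat A1 A2 A3 A4" by auto
    let ?N = "shift_mat m :: 'a mat"
    have N: "?N = ?R * ?Z * ?R" by (rule shift_mat_eq)
    have Nt: "transpose_mat ?N = ?Z" by (rule toeplitz_t[symmetric])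
    have "A * four_block_mat ?N (0\<^sub>m m m) (0\<^sub>m m m) (transpose_mat ?N) =
      four_block_mat ?N (0\<^sub>m m m) (0\<^sub>m m m) (transpose_mat ?N) * A"
      using ab by (intro isometries_commute) auto
    moreover have "A * four_block_mat ?N (0\<^sub>m m m) (0\<^sub>m m m) (transpose_mat ?N) =
        four_block_mat (A1 * ?N) (A2 * ?Z) (A3 * ?N) (A4 * ?Z)"
      unfolding Aeq Nt using c by (subst mult_square_blocks[where m = m])
        (auto simp: right_mult_zero_mat[of _ m m])
    moreover have "four_block_mat ?N (0\<^sub>m m m) (0\<^sub>m m m) (transpose_mat ?N) * A =
        four_block_mat (?N * A1) (?N * A2) (?Z * A3) (?Z * A4)"
      unfolding Aeq Nt using c by (subst mult_square_blocks[where m = m])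
        (auto simp: left_mult_zero_mat[of _ m m])
    ultimately have eq: "four_block_mat (A1 * ?N) (A2 * ?Z) (A3 * ?N) (A4 * ?Z) =
      four_block_mat (?N * A1) (?N * A2) (?Z * A3) (?Z * A4)" by simp
    have comm: "A1 * ?N = ?N * A1" "A2 * ?Z = ?N * A2" "A3 * ?N = ?Z * A3" "A4 * ?Z = ?Z * A4"
      using four_block_mat_inject[OF eq, of m m m m] c by auto
    have "\<exists>p. ?R * A1 * ?R = toeplitz m p"
    proof (rule centralizer_shift)
      have "?R * A1 * ?R * ?Z = ?R * (A1 * ?N) * ?R" unfolding N using c by (simp add: sq)
      also have "\<dots> = ?Z * (?R * A1 * ?R)" unfolding comm unfolding N using c by (simp add: sq)
      finally show "?R * A1 * ?R * ?Z = ?Z * (?R * A1 * ?R)" .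
    qed (use c in simp)
    then obtain \<alpha> where "?R * A1 * ?R = toeplitz m \<alpha>" by blast
    then have "?R * toeplitz m \<alpha> * ?R = ?R * (?R * A1 * ?R) * ?R" by simp
    then have \<alpha>: "A1 = ?R * toeplitz m \<alpha> * ?R" using c by (simp add: sq)
    have "\<exists>p. ?R * A2 = toeplitz m p"
    proof (rule centralizer_shift)
      have "?R * A2 * ?Z = ?R * (?N * A2)" unfolding comm(2)[symmetric] using c by (simp add: sq)
      also have "\<dots> = ?Z * (?R * A2)" unfolding N using c by (simp add: sq)
      finally show "?R * A2 * ?Z = ?Z * (?R * A2)" .
    qed (use c in simp)
    then obtain \<beta> where "?R * A2 = toeplitz m \<beta>" by blast
    then have "?R * toeplitz m \<beta> = ?R * (?R * A2)" by simp
    then have \<beta>: "A2 = ?R * toeplitz m \<beta>" using c by (simp add: sq)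
    have "\<exists>p. A3 * ?R = toeplitz m p"
    proof (rule centralizer_shift)
      have "A3 * ?R * ?Z = A3 * ?N * ?R" unfolding N using c by (simp add: sq)
      also have "\<dots> = ?Z * (A3 * ?R)" unfolding comm using c by (simp add: sq)
      finally show "A3 * ?R * ?Z = ?Z * (A3 * ?R)" .
    qed (use c in simp)
    then obtain \<gamma> where "A3 * ?R = toeplitz m \<gamma>" by blast
    then have "toeplitz m \<gamma> * ?R = A3 * ?R * ?R" by simp
    then have \<gamma>: "A3 = toeplitz m \<gamma> * ?R" using c by (simp add: sq)
    obtain \<delta> where \<delta>: "A4 = toeplitz m \<delta>" using centralizer_shift[OF c(4) comm(4)] by blast
    have A: "A = sl_mat m \<alpha> \<beta> \<gamma> \<delta>"
      unfolding sl_mat_def Aeq \<alpha>[symmetric] \<beta>[symmetric] \<gamma>[symmetric] \<delta>[symmetric] ..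
    have "skew m (?R * toeplitz m (1 * (\<alpha> * \<delta> - \<beta> * \<gamma>)) * ?R) = skew m (?R * toeplitz m 1 * ?R)"
      using ab unfolding sl_mat_congruence[symmetric] skew_one_eq[symmetric] A by simp
    then have "?R * toeplitz m (\<alpha> * \<delta> - \<beta> * \<gamma>) * ?R = ?R * toeplitz m 1 * ?R"
      by (simp add: skew_inject)
    then have "?R * (?R * toeplitz m (\<alpha> * \<delta> - \<beta> * \<gamma>) * ?R) * ?R = ?R * (?R * toeplitz m 1 * ?R) * ?R"
      by simp
    then have "toeplitz m (\<alpha> * \<delta> - \<beta> * \<gamma>) = toeplitz m 1" by (simp add: sq)
    with A show ?sl by blast
  qed
  ultimately show ?thesis by simp
qed

section \<open>Automorphisms fixing the centre and the special linear group\<close>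

text \<open>
  The two columns are two elements of the standard module, in the coordinates of \<^const>\<open>sl_mat\<close>.
\<close>

definition trans_mat :: "nat \<Rightarrow> 'a::comm_ring_1 poly \<times> 'a poly \<Rightarrow> 'a poly \<times> 'a poly \<Rightarrow> 'a mat" where
  "trans_mat m v v' = four_block_mat (rev_mat m * coeff_col m (fst v)) (rev_mat m * coeff_col m (fst v'))
     (coeff_col m (snd v)) (coeff_col m (snd v'))"

text \<open>
  The arguments are arranged like the elements of \<^const>\<open>SL2_V_st_V_st\<close>, but with polynomials in place of their
  classes modulo \<open>t\<^sup>m\<close>.
\<close>

fun aut0_mat :: "nat \<Rightarrow> (('a::comm_ring_1 poly \<times> 'a poly) \<times> ('a poly \<times> 'a poly)) \<times>
    (('a poly \<times> 'a poly) \<times> ('a poly \<times> 'a poly)) \<Rightarrow> 'a mat" where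
  "aut0_mat m (((\<alpha>, \<beta>), (\<gamma>, \<delta>)), (v, v')) =
     four_block_mat (sl_mat m \<alpha> \<beta> \<gamma> \<delta>) (trans_mat m v v') (0\<^sub>m 2 (2 * m)) (1\<^sub>m 2)"

declare aut0_mat.simps [simp del]

lemma poly_mat_dims [simp]:
  "dim_row (rev_mat m) = m" "dim_col (rev_mat m) = m"
  "dim_row (coeff_col m p) = m" "dim_col (coeff_col m p) = 1"
  by (simp_all add: rev_mat_def coeff_col_def)

lemma rev_coeff_col_carrier [simp]: "rev_mat m * coeff_col m p \<in> carrier_mat m 1"
  by (rule mult_carrier_mat[OF rev_mat_carrier coeff_col_carrier])

lemma trans_mat_carrier [simp]: "trans_mat m v v' \<in> carrier_mat (2 * m) 2"
proof -
  have "trans_mat m v v' \<in> carrier_mat (m + m) (1 + 1)"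
    unfolding trans_mat_def by (rule four_block_carrier_mat[OF rev_coeff_col_carrier coeff_col_carrier])
  then show ?thesis by (simp only: mult_2 one_add_one)
qed

lemma trans_mat_surj:
  assumes C: "C \<in> carrier_mat (2 * m) 2"
  shows "\<exists>v v'. C = trans_mat m v (v' :: 'a::comm_ring_1 poly \<times> 'a poly)"
proof -
  define p where "p f = (\<Sum>i<m. monom (f i) i)" for f :: "nat \<Rightarrow> 'a"
  have p: "coeff (p f) i = (if i < m then f i else 0)" for f i
    by (simp add: p_def coeff_sum)
  let ?v = "\<lambda>j. (p (\<lambda>i. C $$ (m - 1 - i, j)), p (\<lambda>i. C $$ (m + i, j)))"
  have R: "(rev_mat m * coeff_col m q) $$ (i, 0) = coeff q (m - 1 - i)" if "i < m" for q :: "'a poly" and i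
    using that by (subst rev_mult_entry[OF coeff_col_carrier]) (auto simp: coeff_col_def)
  have "C = trans_mat m (?v 0) (?v 1)"
  proof (rule eq_matI)
    fix i j assume "i < dim_row (trans_mat m (?v 0) (?v 1))" "j < dim_col (trans_mat m (?v 0) (?v 1))"
    then have ij: "i < m + m" "j < 1 + 1" by (simp_all add: trans_mat_def)
    have e: "coeff_col m q $$ (i - m, 0) = coeff q (i - m)" if "\<not> i < m" for q :: "'a poly"
      using that ij by (simp add: coeff_col_def)
    have "j = 0 \<or> j = 1" using ij by auto
    then show "C $$ (i, j) = trans_mat m (?v 0) (?v 1) $$ (i, j)"
      using ij by (cases "i < m") (auto simp: trans_mat_def R e p simp del: index_mult_mat(1))
  qed (use C in \<open>simp_all add: trans_mat_def\<close>)
  then show ?thesis by blast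
qed

lemma lie_Aut0_iff_aut0_mat:
  assumes m: "m \<ge> 1"
  shows "M \<in> carrier (lie_Aut0 m) \<longleftrightarrow> (\<exists>\<alpha> \<beta> \<gamma> \<delta> v v'.
    toeplitz m (\<alpha> * \<delta> - \<beta> * \<gamma>) = toeplitz m (1 :: 'a::field poly) \<and> M = aut0_mat m (((\<alpha>, \<beta>), (\<gamma>, \<delta>)), (v, v')))"
  unfolding lie_Aut0_iff[OF m] aut_blocks_one_iff[OF m] aut0_mat.simps
  using trans_mat_surj trans_mat_carrier by blast

lemma aut0_mat_mult:
  fixes v1 v2 w1 w2 :: "'a::comm_ring_1 poly \<times> 'a poly"
  shows "aut0_mat m (((\<alpha>, \<beta>), (\<gamma>, \<delta>)), (v1, v2)) * aut0_mat m (((\<alpha>', \<beta>'), (\<gamma>', \<delta>')), (w1, w2)) =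
    aut0_mat m (((\<alpha> * \<alpha>' + \<beta> * \<gamma>', \<alpha> * \<beta>' + \<beta> * \<delta>'), (\<gamma> * \<alpha>' + \<delta> * \<gamma>', \<gamma> * \<beta>' + \<delta> * \<delta>')),
      ((fst v1 + (\<alpha> * fst w1 + \<beta> * snd w1), snd v1 + (\<gamma> * fst w1 + \<delta> * snd w1)),
       (fst v2 + (\<alpha> * fst w2 + \<beta> * snd w2), snd v2 + (\<gamma> * fst w2 + \<delta> * snd w2))))"
proof -
  let ?R = "rev_mat m :: 'a mat" and ?t = "toeplitz m :: 'a poly \<Rightarrow> 'a mat" and ?c = "coeff_col m :: 'a poly \<Rightarrow> 'a mat"
  note c1 = coeff_col_carrier[of m] rev_coeff_col_carrier[of m]
  have as: "A * B * G = A * (B * G)" if "A \<in> carrier_mat m m" "B \<in> carrier_mat m m" "G \<in> carrier_mat m 1" for A B G :: "'a mat"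
    using that by (rule assoc_mult_mat)
  have Rd: "?R * A + ?R * B = ?R * (A + B)" if "A \<in> carrier_mat m 1" "B \<in> carrier_mat m 1" for A B
    using that by (simp add: mult_add_distrib_mat[of _ m m _ 1])
  have R1: "?R * ?t p * ?R * (?R * ?c q) = ?R * ?c (p * q)" for p q
    using c1[of q] by (simp add: as square_mat_algebra(1)[where m = m] rev_mat_cancel[of _ m 1] toeplitz_mult_coeff_col del: One_nat_def)
  have R2: "?R * ?t p * ?c q = ?R * ?c (p * q)" for p q
    using c1[of q] by (simp add: as toeplitz_mult_coeff_col del: One_nat_def)
  have R3: "?t p * ?R * (?R * ?c q) = ?c (p * q)" for p q
    using c1[of q] by (simp add: as rev_mat_cancel[of _ m 1] toeplitz_mult_coeff_col del: One_nat_def)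
  have "sl_mat m \<alpha> \<beta> \<gamma> \<delta> * trans_mat m w1 w2 = trans_mat m
      (\<alpha> * fst w1 + \<beta> * snd w1, \<gamma> * fst w1 + \<delta> * snd w1) (\<alpha> * fst w2 + \<beta> * snd w2, \<gamma> * fst w2 + \<delta> * snd w2)"
    unfolding sl_mat_def trans_mat_def
    by (subst mult_four_block_mat[of _ m m _ m _ m _ _ 1 _ 1])
       (simp_all add: R1 R2 R3 Rd toeplitz_mult_coeff_col coeff_col_add del: One_nat_def assoc_mult_mat)
  moreover have "trans_mat m x y + trans_mat m v1 v2 =
      trans_mat m (fst v1 + fst x, snd v1 + snd x) (fst v2 + fst y, snd v2 + snd y)" for x y
    unfolding trans_mat_def
    by (subst add_four_block_mat[of _ m 1 _ 1 _ m])
       (simp_all add: Rd coeff_col_add[symmetric] add.commute del: One_nat_def)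
  ultimately show ?thesis
    unfolding aut0_mat.simps
    by (subst mult_upper_blocks) (simp_all add: sl_mat_mult right_mult_one_mat[of _ "2 * m" 2])
qed

definition trunc_eq :: "nat \<Rightarrow> 'a::zero poly \<Rightarrow> 'a poly \<Rightarrow> bool" where
  "trunc_eq m p q \<longleftrightarrow> (\<forall>i<m. coeff p i = coeff q i)"

lemma aut0_mat_eq_iff:
  "aut0_mat m (((\<alpha>, \<beta>), (\<gamma>, \<delta>)), ((v1, v2), (v3, v4))) = aut0_mat m (((\<alpha>', \<beta>'), (\<gamma>', \<delta>')), ((w1, w2), (w3, w4)))
   \<longleftrightarrow> trunc_eq m \<alpha> \<alpha>' \<and> trunc_eq m \<beta> \<beta>' \<and> trunc_eq m \<gamma> \<gamma>' \<and> trunc_eq m \<delta> (\<delta>' :: 'a::comm_ring_1 poly)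
     \<and> trunc_eq m v1 w1 \<and> trunc_eq m v2 w2 \<and> trunc_eq m v3 w3 \<and> trunc_eq m v4 w4"
    (is "?L \<longleftrightarrow> ?R")
proof
  assume ?R
  then have "toeplitz m \<alpha> = toeplitz m \<alpha>'" "toeplitz m \<beta> = toeplitz m \<beta>'" "toeplitz m \<gamma> = toeplitz m \<gamma>'" "toeplitz m \<delta> = toeplitz m \<delta>'"
    "coeff_col m v1 = coeff_col m w1" "coeff_col m v2 = coeff_col m w2" "coeff_col m v3 = coeff_col m w3" "coeff_col m v4 = coeff_col m w4"
    by (simp_all add: trunc_eq_def toeplitz_eq_iff coeff_col_eq_iff)
  then show ?L by (simp add: aut0_mat.simps sl_mat_def trans_mat_def)
next
  assume L: ?L
  have Rinj: "A = B" if "rev_mat m * A = rev_mat m * B" "A \<in> carrier_mat m k" "B \<in> carrier_mat m k" for A B :: "'a mat" and k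
    using that rev_mat_cancel by metis
  have Rinj': "A = B" if eq: "A * rev_mat m = B * rev_mat m" and c: "A \<in> carrier_mat m m" "B \<in> carrier_mat m m" for A B :: "'a mat"
  proof -
    have "A * rev_mat m * rev_mat m = B * rev_mat m * rev_mat m" by (simp only: eq)
    then show ?thesis using c by (simp add: square_mat_algebra(1)[where m = m] rev_mat_square)
  qed
  have eq: "sl_mat m \<alpha> \<beta> \<gamma> \<delta> = sl_mat m \<alpha>' \<beta>' \<gamma>' \<delta>'" "trans_mat m (v1, v2) (v3, v4) = trans_mat m (w1, w2) (w3, w4)"
    using four_block_mat_inject(1,2)[OF L[unfolded aut0_mat.simps], of "2 * m" "2 * m" 2 2] by simp_all
  note e = four_block_mat_inject[OF eq(1)[unfolded sl_mat_def], of m m m m, simplified]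
  have "rev_mat m * toeplitz m \<alpha> = rev_mat m * toeplitz m \<alpha>'" by (rule Rinj'[OF e(1)]) simp_all
  then have "toeplitz m \<alpha> = toeplitz m \<alpha>'" by (rule Rinj[of _ _ m]) simp_all
  moreover have "toeplitz m \<beta> = toeplitz m \<beta>'" by (rule Rinj[OF e(2), of m]) simp_all
  moreover have "toeplitz m \<gamma> = toeplitz m \<gamma>'" by (rule Rinj'[OF e(3)]) simp_all
  moreover note e(4)
  moreover note f = four_block_mat_inject[OF eq(2)[unfolded trans_mat_def fst_conv snd_conv]
    rev_coeff_col_carrier rev_coeff_col_carrier coeff_col_carrier coeff_col_carrier
    rev_coeff_col_carrier rev_coeff_col_carrier coeff_col_carrier coeff_col_carrier]
  have "coeff_col m v1 = coeff_col m w1" by (rule Rinj[OF f(1) coeff_col_carrier coeff_col_carrier])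
  moreover have "coeff_col m v3 = coeff_col m w3" by (rule Rinj[OF f(2) coeff_col_carrier coeff_col_carrier])
  ultimately show ?R using f(3,4) by (simp add: trunc_eq_def toeplitz_eq_iff coeff_col_eq_iff)
qed

definition trunc_class :: "nat \<Rightarrow> 'k::field poly \<Rightarrow> 'k poly set" where
  "trunc_class m p = PIdl\<^bsub>(ring_of_type_algebra :: 'k poly ring)\<^esub> (monom 1 m) +>\<^bsub>(ring_of_type_algebra :: 'k poly ring)\<^esub> p"

lemma trunc_class_arith:
  fixes p q :: "'k::field poly"
  shows "trunc_class m p \<oplus>\<^bsub>trunc_ring m\<^esub> trunc_class m q = trunc_class m (p + q)"
    and "trunc_class m p \<otimes>\<^bsub>trunc_ring m\<^esub> trunc_class m q = trunc_class m (p * q)"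
    and "trunc_class m p \<ominus>\<^bsub>trunc_ring m\<^esub> trunc_class m q = trunc_class m (p - q)"
    and "\<one>\<^bsub>trunc_ring m\<^esub> = trunc_class m (1 :: 'k poly)"
    and "carrier (trunc_ring m) = range (trunc_class m :: 'k poly \<Rightarrow> _)"
    and "trunc_class m p = trunc_class m q \<longleftrightarrow> trunc_eq m p q"
proof -
  let ?P = "ring_of_type_algebra :: 'k poly ring"
  let ?I = "PIdl\<^bsub>?P\<^esub> (monom 1 m)"
  interpret P: cring ?P by (rule cring_from_type_algebra)
  have ops: "carrier ?P = UNIV" "p \<oplus>\<^bsub>?P\<^esub> q = p + q" "p \<otimes>\<^bsub>?P\<^esub> q = p * q" "\<one>\<^bsub>?P\<^esub> = 1" "\<zero>\<^bsub>?P\<^esub> = 0" for p q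
    by (simp_all add: ring_of_type_algebra_def)
  have I: "ideal ?I ?P" by (rule P.cgenideal_ideal) (simp add: ops)
  interpret h: ring_hom_ring ?P "trunc_ring m :: 'k poly set ring" "trunc_class m"
  proof -
    have "trunc_class m = (+>\<^bsub>?P\<^esub>) ?I" by (rule ext) (simp add: trunc_class_def)
    then show "ring_hom_ring ?P (trunc_ring m :: 'k poly set ring) (trunc_class m)"
      using ideal.rcos_ring_hom_ring[OF I] by (simp add: trunc_ring_def)
  qed
  have minus: "p \<ominus>\<^bsub>?P\<^esub> q = p - q" for p q
  proof -
    have "\<ominus>\<^bsub>?P\<^esub> q = - q" by (rule P.minus_equality) (simp_all add: ops)
    then show ?thesis by (simp add: a_minus_def ops)
  qed
  show "trunc_class m p \<oplus>\<^bsub>trunc_ring m\<^esub> trunc_class m q = trunc_class m (p + q)"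
    using h.hom_add[of p q] by (simp add: ops)
  show "trunc_class m p \<otimes>\<^bsub>trunc_ring m\<^esub> trunc_class m q = trunc_class m (p * q)"
    using h.hom_mult[of p q] by (simp add: ops)
  show "trunc_class m p \<ominus>\<^bsub>trunc_ring m\<^esub> trunc_class m q = trunc_class m (p - q)"
    using h.hom_add[of p "\<ominus>\<^bsub>?P\<^esub> q"] h.hom_a_inv[of q] minus[of p q] by (simp add: ops a_minus_def)
  show "\<one>\<^bsub>trunc_ring m\<^esub> = trunc_class m (1 :: 'k poly)"
    using h.hom_one by (simp add: ops)
  show "carrier (trunc_ring m) = range (trunc_class m :: 'k poly \<Rightarrow> _)"
    by (auto simp: trunc_ring_def FactRing_def A_RCOSETS_def' ops trunc_class_def)
  have "trunc_class m p = trunc_class m q \<longleftrightarrow> p - q \<in> ?I"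
    using P.quotient_eq_iff_same_a_r_cos[OF I, of p q] by (simp add: ops minus trunc_class_def)
  also have "\<dots> \<longleftrightarrow> monom 1 m dvd p - q"
    by (auto simp: cgenideal_def ops dvd_def mult.commute)
  also have "\<dots> \<longleftrightarrow> trunc_eq m p q"
    by (simp add: monom_1_dvd_iff' trunc_eq_def)
  finally show "trunc_class m p = trunc_class m q \<longleftrightarrow> trunc_eq m p q" .
qed

definition trunc_tuple :: "nat \<Rightarrow> (('k::field poly \<times> 'k poly) \<times> ('k poly \<times> 'k poly)) \<times>
    (('k poly \<times> 'k poly) \<times> ('k poly \<times> 'k poly)) \<Rightarrow> _" where
  "trunc_tuple m = map_prod (map_prod (map_prod (trunc_class m) (trunc_class m)) (map_prod (trunc_class m) (trunc_class m)))
     (map_prod (map_prod (trunc_class m) (trunc_class m)) (map_prod (trunc_class m) (trunc_class m)))"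

lemma trunc_tuple_eq_iff: "trunc_tuple m x = trunc_tuple m y \<longleftrightarrow> aut0_mat m x = aut0_mat m y"
proof -
  obtain a b c d e f g h where x: "x = (((a, b), (c, d)), ((e, f), (g, h)))" by (metis surj_pair)
  obtain a' b' c' d' e' f' g' h' where y: "y = (((a', b'), (c', d')), ((e', f'), (g', h')))" by (metis surj_pair)
  show ?thesis
    unfolding x y aut0_mat_eq_iff by (simp add: trunc_tuple_def trunc_class_arith(6))
qed

lemma carrier_SL2_V:
  "carrier (SL2_V_st_V_st (trunc_ring m :: 'k::field poly set ring)) =
   {trunc_tuple m (((\<alpha>, \<beta>), (\<gamma>, \<delta>)), (v, v')) | \<alpha> \<beta> \<gamma> \<delta> v v'. toeplitz m (\<alpha> * \<delta> - \<beta> * \<gamma>) = toeplitz m 1}"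
    (is "?L = ?R")
proof -
  have det: "trunc_class m \<alpha> \<otimes>\<^bsub>trunc_ring m\<^esub> trunc_class m \<delta> \<ominus>\<^bsub>trunc_ring m\<^esub> trunc_class m \<beta> \<otimes>\<^bsub>trunc_ring m\<^esub> trunc_class m \<gamma> = \<one>\<^bsub>trunc_ring m\<^esub>
    \<longleftrightarrow> toeplitz m (\<alpha> * \<delta> - \<beta> * \<gamma>) = toeplitz m 1" for \<alpha> \<beta> \<gamma> \<delta> :: "'k poly"
    unfolding trunc_class_arith trunc_eq_def toeplitz_eq_iff ..
  show ?thesis
  proof (intro equalityI subsetI)
    fix x assume "x \<in> ?L"
    then obtain a b c d e f g h where x: "x = (((a, b), (c, d)), ((e, f), (g, h)))"
      and in_range: "{a, b, c, d, e, f, g, h} \<subseteq> carrier (trunc_ring m)"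
      and d: "a \<otimes>\<^bsub>trunc_ring m\<^esub> d \<ominus>\<^bsub>trunc_ring m\<^esub> b \<otimes>\<^bsub>trunc_ring m\<^esub> c = \<one>\<^bsub>trunc_ring m\<^esub>"
      by (auto simp: SL2_V_st_V_st_def semidirect_def SL2_def V_st_def DirProd_def)
    from in_range obtain a' b' c' d' e' f' g' h' where
      "a = trunc_class m a'" "b = trunc_class m b'" "c = trunc_class m c'" "d = trunc_class m d'"
      "e = trunc_class m e'" "f = trunc_class m f'" "g = trunc_class m g'" "h = trunc_class m h'"
      unfolding trunc_class_arith(5) by (auto simp: image_iff)
    then have "x = trunc_tuple m (((a', b'), (c', d')), ((e', f'), (g', h')))"
      "toeplitz m (a' * d' - b' * c') = toeplitz m 1"
      using x d by (simp_all add: trunc_tuple_def det)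
    then show "x \<in> ?R" by blast
  next
    fix x assume "x \<in> ?R"
    then show "x \<in> ?L"
      by (auto simp: trunc_tuple_def SL2_V_st_V_st_def semidirect_def SL2_def V_st_def DirProd_def det)
         (auto simp: trunc_class_arith(5))
  qed
qed

lemma mult_SL2_V:
  fixes \<alpha> \<beta> \<gamma> \<delta> \<alpha>' \<beta>' \<gamma>' \<delta>' :: "'k::field poly"
  shows "trunc_tuple m (((\<alpha>, \<beta>), (\<gamma>, \<delta>)), (v1, v2)) \<otimes>\<^bsub>SL2_V_st_V_st (trunc_ring m)\<^esub>
    trunc_tuple m (((\<alpha>', \<beta>'), (\<gamma>', \<delta>')), (w1, w2)) =
    trunc_tuple m (((\<alpha> * \<alpha>' + \<beta> * \<gamma>', \<alpha> * \<beta>' + \<beta> * \<delta>'), (\<gamma> * \<alpha>' + \<delta> * \<gamma>', \<gamma> * \<beta>' + \<delta> * \<delta>')),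
      ((fst v1 + (\<alpha> * fst w1 + \<beta> * snd w1), snd v1 + (\<gamma> * fst w1 + \<delta> * snd w1)),
       (fst v2 + (\<alpha> * fst w2 + \<beta> * snd w2), snd v2 + (\<gamma> * fst w2 + \<delta> * snd w2))))"
  by (cases v1; cases v2; cases w1; cases w2)
     (simp add: trunc_tuple_def SL2_V_st_V_st_def semidirect_def SL2_def V_st_def V_st_act_def DirProd_def
       trunc_class_arith(1,2))

text \<open>
  Polynomials with equal classes modulo \<open>t\<^sup>m\<close> give the same matrix and conversely (\<open>trunc_tuple_eq_iff\<close>), so reading off
  the classes is well defined and injective.
\<close>

theorem lie_Aut0_iso:
  assumes m: "m \<ge> 1"
  shows "(lie_Aut0 m :: 'k::field mat monoid) \<cong> SL2_V_st_V_st (trunc_ring m :: 'k poly set ring)"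
proof -
  let ?G = "lie_Aut0 m :: 'k mat monoid" and ?H = "SL2_V_st_V_st (trunc_ring m :: 'k poly set ring)"
  define h where "h M = trunc_tuple m (SOME x. aut0_mat m x = M)" for M :: "'k mat"
  have h: "h (aut0_mat m x) = trunc_tuple m x" for x
    unfolding h_def trunc_tuple_eq_iff by (rule someI) (rule refl)
  have G: "M \<in> carrier ?G \<longleftrightarrow> (\<exists>\<alpha> \<beta> \<gamma> \<delta> v v'.
    toeplitz m (\<alpha> * \<delta> - \<beta> * \<gamma>) = toeplitz m 1 \<and> M = aut0_mat m (((\<alpha>, \<beta>), (\<gamma>, \<delta>)), (v, v')))" for M
    by (rule lie_Aut0_iff_aut0_mat[OF m])
  have "h \<in> hom ?G ?H"
  proof (rule homI)
    fix M assume "M \<in> carrier ?G"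
    then obtain \<alpha> \<beta> \<gamma> \<delta> v v' where "toeplitz m (\<alpha> * \<delta> - \<beta> * \<gamma>) = (toeplitz m 1 :: 'k mat)"
      "h M = trunc_tuple m (((\<alpha>, \<beta>), (\<gamma>, \<delta>)), (v, v'))"
      unfolding G using h by blast
    then show "h M \<in> carrier ?H" unfolding carrier_SL2_V by blast
  next
    fix M M' assume "M \<in> carrier ?G" "M' \<in> carrier ?G"
    then obtain \<alpha> \<beta> \<gamma> \<delta> v v' \<alpha>' \<beta>' \<gamma>' \<delta>' w w' where
      "M = aut0_mat m (((\<alpha>, \<beta>), (\<gamma>, \<delta>)), (v, v'))" "M' = aut0_mat m (((\<alpha>', \<beta>'), (\<gamma>', \<delta>')), (w, w'))"
      unfolding G by blast
    then show "h (M \<otimes>\<^bsub>?G\<^esub> M') = h M \<otimes>\<^bsub>?H\<^esub> h M'"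
      by (simp only: lie_Aut0_mult aut0_mat_mult h mult_SL2_V)
  qed
  moreover have "bij_betw h (carrier ?G) (carrier ?H)"
  proof (rule bij_betw_imageI)
    show "inj_on h (carrier ?G)"
      by (rule inj_onI) (auto simp: G h trunc_tuple_eq_iff)
    show "h ` carrier ?G = carrier ?H"
    proof (intro equalityI image_subsetI subsetI)
      fix y assume "y \<in> carrier ?H"
      then obtain \<alpha> \<beta> \<gamma> \<delta> v v' where x: "toeplitz m (\<alpha> * \<delta> - \<beta> * \<gamma>) = (toeplitz m 1 :: 'k mat)"
        "y = h (aut0_mat m (((\<alpha>, \<beta>), (\<gamma>, \<delta>)), (v, v')))"
        unfolding carrier_SL2_V h by blast
      then show "y \<in> h ` carrier ?G" using G by blast
    qed (use \<open>h \<in> hom ?G ?H\<close> in \<open>simp add: hom_in_carrier\<close>)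
  qed
  ultimately show ?thesis by (auto simp: is_iso_def iso_def)
qed

section \<open>Zariski topology and rational curves\<close>

abbreviation mat_polys :: "nat \<Rightarrow> ('a::field mat \<Rightarrow> 'a) set" where
  "mat_polys n \<equiv> poly_funs UNIV (mat_coords n)"

text \<open>The principal open sets form a basis, as they are closed under intersection.\<close>

lemma zariski_open_nbhd:
  assumes "openin (zariski n) E" "M \<in> E"
  shows "\<exists>p \<in> mat_polys n. p M \<noteq> 0 \<and> {M' \<in> carrier_mat n n. p M' \<noteq> (0 :: 'a::field)} \<subseteq> E"
proof -
  have "generate_topology_on {{M \<in> carrier_mat n n. p M \<noteq> (0 :: 'a)} | p. p \<in> mat_polys n} E"
    using assms(1) unfolding zariski_def openin_topology_generated_by_iff .
  then show ?thesis using assms(2)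
  proof (induction E)
    case (Int E1 E2)
    then obtain p q where "p \<in> mat_polys n" "p M \<noteq> 0" "{M' \<in> carrier_mat n n. p M' \<noteq> 0} \<subseteq> E1"
      "q \<in> mat_polys n" "q M \<noteq> 0" "{M' \<in> carrier_mat n n. q M' \<noteq> 0} \<subseteq> E2" by blast
    then show ?case
      by (intro bexI[of _ "\<lambda>M. p M * q M"] poly_funs.mult) auto
  next
    case (UN K)
    then show ?case by (meson UnionE Union_upper subset_trans)
  qed auto
qed

lemma topspace_zariski: "topspace (zariski n :: 'a::field mat topology) = carrier_mat n n"
proof -
  have "(\<lambda>_. 1 :: 'a) \<in> mat_polys n" by (rule poly_funs.const) simp
  then have "carrier_mat n n \<in> {{M \<in> carrier_mat n n. p M \<noteq> (0 :: 'a)} | p. p \<in> mat_polys n}"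
    by (intro CollectI exI[of _ "\<lambda>_. 1"]) auto
  then show ?thesis unfolding zariski_def topology_generated_by_topspace by blast
qed

lemma poly_funs_sum:
  assumes "\<And>i. i \<in> I \<Longrightarrow> f i \<in> poly_funs UNIV V"
  shows "(\<lambda>x. \<Sum>i\<in>I. f i x) \<in> poly_funs UNIV V"
  using assms by (induction I rule: infinite_finite_induct) (auto intro: poly_funs.add poly_funs.const)

lemma poly_funs_translate:
  assumes A: "A \<in> carrier_mat n n" and p: "p \<in> mat_polys n"
  shows "\<exists>q \<in> mat_polys n. \<forall>M \<in> carrier_mat n n. p (A * M) = (q M :: 'a::field)"
  using p
proof induction
  case (const c)
  then show ?case by (intro bexI[of _ "\<lambda>_. c"] poly_funs.const) auto
next
  case (coord f)
  then obtain i j where f: "f = (\<lambda>M. M $$ (i, j))" "i < n" "j < n" by (auto simp: mat_coords_def)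
  have "(\<lambda>M. \<Sum>k\<in>{0..<n}. A $$ (i, k) * M $$ (k, j)) \<in> mat_polys n"
    using f by (intro poly_funs_sum poly_funs.mult poly_funs.const poly_funs.coord) (auto simp: mat_coords_def)
  then show ?case
    using f A by (intro bexI[of _ "\<lambda>M. \<Sum>k\<in>{0..<n}. A $$ (i, k) * M $$ (k, j)"]) (auto simp: scalar_prod_def)
next
  case (add f g)
  then obtain q r where "q \<in> mat_polys n" "\<forall>M \<in> carrier_mat n n. f (A * M) = q M"
    "r \<in> mat_polys n" "\<forall>M \<in> carrier_mat n n. g (A * M) = r M" by blast
  then show ?case by (intro bexI[of _ "\<lambda>M. q M + r M"] poly_funs.add) auto
next
  case (mult f g)
  then obtain q r where "q \<in> mat_polys n" "\<forall>M \<in> carrier_mat n n. f (A * M) = q M"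
    "r \<in> mat_polys n" "\<forall>M \<in> carrier_mat n n. g (A * M) = r M" by blast
  then show ?case by (intro bexI[of _ "\<lambda>M. q M * r M"] poly_funs.mult) auto
qed

lemma zariski_continuous_translate:
  assumes A: "A \<in> carrier_mat n n"
  shows "continuous_map (zariski n) (zariski n) (\<lambda>M. A * (M :: 'a::field mat))"
  unfolding zariski_def[of n]
proof (subst continuous_on_generated_topo_iff, intro conjI allI impI)
  let ?B = "{{M \<in> carrier_mat n n. p M \<noteq> (0 :: 'a)} | p. p \<in> mat_polys n}"
  have top: "topspace (topology_generated_by ?B) = carrier_mat n n"
    using topspace_zariski[of n, where ?'a = 'a] by (simp add: zariski_def)
  show "(\<lambda>M. A * M) ` topspace (topology_generated_by ?B) \<subseteq> \<Union>?B"
  proof (rule image_subsetI)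
    fix M assume "M \<in> topspace (topology_generated_by ?B)"
    then have "A * M \<in> topspace (topology_generated_by ?B)" using A unfolding top by simp
    then show "A * M \<in> \<Union>?B" unfolding topology_generated_by_topspace .
  qed
  fix E assume "E \<in> ?B"
  then obtain p where p: "p \<in> mat_polys n" and E: "E = {M \<in> carrier_mat n n. p M \<noteq> 0}" by blast
  obtain q where q: "q \<in> mat_polys n" "\<forall>M \<in> carrier_mat n n. p (A * M) = q M"
    using poly_funs_translate[OF A p] by blast
  have "(\<lambda>M. A * M) -` E \<inter> topspace (topology_generated_by ?B) = {M \<in> carrier_mat n n. q M \<noteq> 0}"
    using q(2) A unfolding top E by auto
  then show "openin (topology_generated_by ?B) ((\<lambda>M. A * M) -` E \<inter> topspace (topology_generated_by ?B))"
    using q(1) by (auto intro!: topology_generated_by_Basis)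
qed

definition rational_on :: "'a::field set \<Rightarrow> ('a \<Rightarrow> 'a) \<Rightarrow> bool" where
  "rational_on U f \<longleftrightarrow> (\<exists>p q. \<forall>s\<in>U. poly q s \<noteq> 0 \<and> f s = poly p s / poly q s)"

lemma rational_on_const: "rational_on U (\<lambda>_. c)"
  unfolding rational_on_def by (intro exI[of _ "[:c:]"] exI[of _ 1]) simp

lemma rational_on_id: "rational_on U (\<lambda>s. s)"
  unfolding rational_on_def by (intro exI[of _ "[:0, 1:]"] exI[of _ 1]) simp

lemma rational_on_add:
  assumes "rational_on U f" "rational_on U g" shows "rational_on U (\<lambda>s. f s + g s)"
proof -
  obtain p q p' q' where "\<forall>s\<in>U. poly q s \<noteq> 0 \<and> f s = poly p s / poly q s"
    "\<forall>s\<in>U. poly q' s \<noteq> 0 \<and> g s = poly p' s / poly q' s"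
    using assms by (auto simp: rational_on_def)
  then show ?thesis unfolding rational_on_def
    by (intro exI[of _ "p * q' + p' * q"] exI[of _ "q * q'"]) (auto simp: field_simps)
qed

lemma rational_on_mult:
  assumes "rational_on U f" "rational_on U g" shows "rational_on U (\<lambda>s. f s * g s)"
proof -
  obtain p q p' q' where "\<forall>s\<in>U. poly q s \<noteq> 0 \<and> f s = poly p s / poly q s"
    "\<forall>s\<in>U. poly q' s \<noteq> 0 \<and> g s = poly p' s / poly q' s"
    using assms by (auto simp: rational_on_def)
  then show ?thesis unfolding rational_on_def
    by (intro exI[of _ "p * p'"] exI[of _ "q * q'"]) auto
qed

lemma rational_on_inverse:
  assumes "rational_on U f" "\<And>s. s \<in> U \<Longrightarrow> f s \<noteq> 0" shows "rational_on U (\<lambda>s. inverse (f s))"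
proof -
  obtain p q where "\<forall>s\<in>U. poly q s \<noteq> 0 \<and> f s = poly p s / poly q s"
    using assms by (auto simp: rational_on_def)
  then show ?thesis unfolding rational_on_def using assms(2)
    by (intro exI[of _ q] exI[of _ p]) (auto simp: field_simps)
qed

lemma regular_functions_rational_on: "regular_functions U {f. rational_on U (f :: 'a::field_char_0 \<Rightarrow> 'a)}"
proof
  fix f g :: "'a \<Rightarrow> 'a" assume "f \<in> {f. rational_on U f}" "\<And>x. x \<in> U \<Longrightarrow> f x = g x"
  then show "g \<in> {f. rational_on U f}" by (auto simp: rational_on_def)
qed (auto intro: rational_on_const rational_on_add rational_on_mult)

lemma finite_zeros_rational_on:
  assumes f: "rational_on U f" and s: "s \<in> U" "f s \<noteq> 0"
  shows "finite {s \<in> U. f s = 0}"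
proof -
  obtain p q where pq: "\<forall>s\<in>U. poly q s \<noteq> 0 \<and> f s = poly p s / poly q s"
    using f by (auto simp: rational_on_def)
  then have "p \<noteq> 0" using s by auto
  moreover have "{s \<in> U. f s = 0} \<subseteq> {s. poly p s = 0}" using pq by auto
  ultimately show ?thesis using poly_roots_finite finite_subset by blast
qed

text \<open>
  Two disjoint nonempty open parts of the curve would contain the images of two cofinite subsets of an infinite
  field, and these meet.
\<close>

lemma connectedin_rational_curve:
  fixes M :: "'a::field_char_0 \<Rightarrow> 'a mat"
  assumes U: "finite (- U)" and M: "\<And>s. s \<in> U \<Longrightarrow> M s \<in> carrier_mat n n"
    and rat: "\<And>i j. i < n \<Longrightarrow> j < n \<Longrightarrow> rational_on U (\<lambda>s. M s $$ (i, j))"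
  shows "connectedin (zariski n) (M ` U)"
  unfolding connectedin topspace_zariski
proof (intro conjI notI)
  show "M ` U \<subseteq> carrier_mat n n" using M by blast
  have comp: "rational_on U (\<lambda>s. p (M s))" if "p \<in> mat_polys n" for p
    using that by induction (auto simp: mat_coords_def intro: rational_on_const rat rational_on_add rational_on_mult)
  assume "\<exists>E1 E2. openin (zariski n) E1 \<and> openin (zariski n) E2 \<and> M ` U \<subseteq> E1 \<union> E2 \<and>
    E1 \<inter> E2 \<inter> M ` U = {} \<and> E1 \<inter> M ` U \<noteq> {} \<and> E2 \<inter> M ` U \<noteq> {}"
  then obtain E1 E2 where E: "openin (zariski n) E1" "openin (zariski n) E2"
    and disj: "E1 \<inter> E2 \<inter> M ` U = {}" and ne: "E1 \<inter> M ` U \<noteq> {}" "E2 \<inter> M ` U \<noteq> {}"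
    by (elim exE conjE)
  obtain s1 s2 where s: "s1 \<in> U" "M s1 \<in> E1" "s2 \<in> U" "M s2 \<in> E2"
    using ne by blast
  obtain p where p: "p \<in> mat_polys n" "p (M s1) \<noteq> 0" "{M' \<in> carrier_mat n n. p M' \<noteq> 0} \<subseteq> E1"
    using zariski_open_nbhd[OF E(1) s(2)] by blast
  obtain q where q: "q \<in> mat_polys n" "q (M s2) \<noteq> 0" "{M' \<in> carrier_mat n n. q M' \<noteq> 0} \<subseteq> E2"
    using zariski_open_nbhd[OF E(2) s(4)] by blast
  have fin: "finite (- U \<union> {s \<in> U. p (M s) = 0} \<union> {s \<in> U. q (M s) = 0})"
    by (intro finite_UnI U finite_zeros_rational_on[OF comp[OF p(1)] s(1) p(2)]
        finite_zeros_rational_on[OF comp[OF q(1)] s(3) q(2)])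
  obtain s where "s \<notin> - U \<union> {s \<in> U. p (M s) = 0} \<union> {s \<in> U. q (M s) = 0}"
    using ex_new_if_finite[OF infinite_UNIV_char_0 fin] by (rule exE)
  then have sU: "s \<in> U" "p (M s) \<noteq> 0" "q (M s) \<noteq> 0" by auto
  then have "M s \<in> E1" "M s \<in> E2" using p(3) q(3) M[OF sU(1)] by (simp_all add: subset_iff)
  with disj sU(1) show False by blast
qed

section \<open>Connectedness\<close>

definition joined_to_one :: "nat \<Rightarrow> 'a::field_char_0 mat \<Rightarrow> bool" where
  "joined_to_one m M \<longleftrightarrow> (\<exists>S. connectedin (zariski (lie_rank m)) S \<and> S \<subseteq> carrier (lie_Aut m)
     \<and> 1\<^sub>m (lie_rank m) \<in> S \<and> M \<in> S)"

text \<open>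
  Left translation by \<open>M\<close> is continuous, so it moves a connected set joining 1 to \<open>M'\<close> to one joining \<open>M\<close> to
  \<open>M M'\<close>.
\<close>

lemma joined_to_one_mult:
  assumes "joined_to_one m M" "joined_to_one m M'"
  shows "joined_to_one m (M * M')"
proof -
  let ?n = "lie_rank m"
  interpret G: group "lie_Aut m :: 'a mat monoid" by (rule group_lie_Aut)
  obtain S where S: "connectedin (zariski ?n) S" "S \<subseteq> carrier (lie_Aut m)" "1\<^sub>m ?n \<in> S" "M \<in> S"
    using assms(1) by (auto simp: joined_to_one_def)
  obtain S' where S': "connectedin (zariski ?n) S'" "S' \<subseteq> carrier (lie_Aut m)" "1\<^sub>m ?n \<in> S'" "M' \<in> S'"
    using assms(2) by (auto simp: joined_to_one_def)
  have M: "M \<in> carrier (lie_Aut m)" using S by blast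
  then have Mc: "M \<in> carrier_mat ?n ?n" by (rule lie_Aut_carrier)
  let ?T = "(\<lambda>B. M * B) ` S'"
  have T: "connectedin (zariski ?n) ?T"
    by (rule connectedin_continuous_map_image[OF zariski_continuous_translate[OF Mc] S'(1)])
  have "M \<in> ?T" using S'(3) Mc by (intro image_eqI[of _ _ "1\<^sub>m ?n"]) simp_all
  then have "connectedin (zariski ?n) (S \<union> ?T)" using S(4) by (intro connectedin_Un S(1) T) blast
  moreover have "?T \<subseteq> carrier (lie_Aut m)" using S'(2) G.m_closed[OF M] by auto
  ultimately show ?thesis unfolding joined_to_one_def using S S'(4)
    by (intro exI[of _ "S \<union> ?T"]) auto
qed

lemma joined_to_one_curve:
  fixes M :: "'a::field_char_0 \<Rightarrow> 'a mat"
  assumes U: "finite (- U)" "0 \<in> U" "1 \<in> U" and M: "\<And>s. s \<in> U \<Longrightarrow> M s \<in> carrier (lie_Aut m)"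
    and one: "M 0 = 1\<^sub>m (lie_rank m)"
    and rat: "\<And>i j. i < lie_rank m \<Longrightarrow> j < lie_rank m \<Longrightarrow> rational_on U (\<lambda>s. M s $$ (i, j))"
  shows "joined_to_one m (M 1)"
  unfolding joined_to_one_def
proof (intro exI conjI)
  show "connectedin (zariski (lie_rank m)) (M ` U)"
    using U M rat by (intro connectedin_rational_curve) (auto dest: lie_Aut_carrier)
  show "1\<^sub>m (lie_rank m) \<in> M ` U" using one U(2) by force
qed (use U M in auto)

text \<open>
  The lower triangular matrices \<open>1 + s (b - 1)\<close> are invertible for all but finitely many \<open>s\<close>, and \<open>s = 0, 1\<close> are not
  among the exceptions.
\<close>

lemma joined_to_one_section:
  assumes m: "m \<ge> 1" and b: "b \<in> carrier (B2 :: 'a::field_char_0 mat monoid)"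
  shows "joined_to_one m (B2_section m b)"
proof -
  let ?p = "\<lambda>i. [:1, b $$ (i, i) - 1:]"
  define U where "U = {s. poly (?p 0) s \<noteq> 0 \<and> poly (?p 1) s \<noteq> 0}"
  define c where "c s = mat 2 2 (\<lambda>(i, j). (1 - s) * of_bool (i = j) + s * b $$ (i, j))" for s
  interpret R: regular_functions U "{f. rational_on U f}" by (rule regular_functions_rational_on)
  have c: "c s \<in> carrier B2" if "s \<in> U" for s
    using that b by (auto simp: c_def U_def B2_iff algebra_simps)
  have reg: "R.regular_mat 2 2 c"
  proof (rule R.regular_matI)
    fix i j :: nat assume "i < 2" "j < 2"
    moreover have "rational_on U (\<lambda>s. of_bool (i = j) + s * (b $$ (i, j) - of_bool (i = j)))"
      by (intro rational_on_add rational_on_mult rational_on_const rational_on_id)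
    ultimately show "\<exists>f\<in>{f. rational_on U f}. \<forall>x\<in>U. f x = c x $$ (i, j)"
      by (intro bexI[of _ "\<lambda>s. of_bool (i = j) + s * (b $$ (i, j) - of_bool (i = j))"])
         (auto simp: c_def algebra_simps)
  qed (simp add: c_def)
  have "rational_on U (\<lambda>s. inverse (det (c s)))"
    using R.regular_det[OF reg] c by (intro rational_on_inverse) (auto simp: B2_def GL_carrier_iff)
  then have rb: "R.regular_B2 c" using c reg by (intro R.regular_B2I) auto
  have "joined_to_one m ((\<lambda>s. B2_section m (c s)) 1)"
  proof (rule joined_to_one_curve[where U = U])
    have "- U \<subseteq> {s. poly (?p 0) s = 0} \<union> {s. poly (?p 1) s = 0}" by (auto simp: U_def)
    moreover have "finite {s. poly (?p i) s = 0}" for i by (rule poly_roots_finite) simp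
    ultimately show "finite (- U)" using finite_subset by blast
    show "0 \<in> U" by (simp add: U_def)
    show "1 \<in> U" using b by (simp add: U_def B2_iff)
    show "B2_section m (c s) \<in> carrier (lie_Aut m)" if "s \<in> U" for s
      by (rule B2_section_in_lie_Aut[OF c[OF that] m])
    have "c 0 = 1\<^sub>m 2" by (intro eq_matI) (auto simp: c_def)
    moreover have "B2_section m (1\<^sub>m 2) = (1\<^sub>m (lie_rank m) :: 'a mat)"
    proof -
      interpret s: group_hom B2 "lie_Aut m" "B2_section m :: 'a mat \<Rightarrow> 'a mat"
        by (rule group_hom.intro[OF group_B2 group_lie_Aut group_hom_axioms.intro[OF B2_section_hom[OF m]]])
      show ?thesis using s.hom_one by simp
    qed
    ultimately show "B2_section m (c 0) = 1\<^sub>m (lie_rank m)" by simp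
    show "rational_on U (\<lambda>s. B2_section m (c s) $$ (i, j))" if "i < lie_rank m" "j < lie_rank m" for i j
      using R.regular_mat_entry[OF R.regular_B2_section[OF rb] that] by simp
  qed
  moreover have "c 1 = b" using b by (intro eq_matI) (auto simp: c_def B2_iff)
  ultimately show ?thesis by simp
qed

context regular_functions
begin

lemma regular_aut0_mat:
  assumes "\<And>i. (\<lambda>x. coeff (\<alpha> x) i) \<in> \<F>" "\<And>i. (\<lambda>x. coeff (\<beta> x) i) \<in> \<F>"
    "\<And>i. (\<lambda>x. coeff (\<gamma> x) i) \<in> \<F>" "\<And>i. (\<lambda>x. coeff (\<delta> x) i) \<in> \<F>"
    "\<And>i. (\<lambda>x. coeff (v1 x) i) \<in> \<F>" "\<And>i. (\<lambda>x. coeff (v2 x) i) \<in> \<F>"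
    "\<And>i. (\<lambda>x. coeff (w1 x) i) \<in> \<F>" "\<And>i. (\<lambda>x. coeff (w2 x) i) \<in> \<F>"
  shows "regular_mat (lie_rank m) (lie_rank m)
    (\<lambda>x. aut0_mat m (((\<alpha> x, \<beta> x), (\<gamma> x, \<delta> x)), ((v1 x, v2 x), (w1 x, w2 x))))"
proof -
  have t: "regular_mat m m (\<lambda>x. toeplitz m (p x))" if "\<And>i. (\<lambda>x. coeff (p x) i) \<in> \<F>" for p
  proof (rule regular_matI)
    fix i j assume "i < m" "j < m"
    moreover have "(\<lambda>x. if j \<le> i then coeff (p x) (i - j) else 0) \<in> \<F>"
      using that const[of 0] by (cases "j \<le> i") auto
    ultimately show "\<exists>f\<in>\<F>. \<forall>x\<in>S. f x = toeplitz m (p x) $$ (i, j)"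
      by (intro bexI[of _ "\<lambda>x. if j \<le> i then coeff (p x) (i - j) else 0"]) (auto simp: toeplitz_def)
  qed simp
  have c: "regular_mat m 1 (\<lambda>x. coeff_col m (p x))" if "\<And>i. (\<lambda>x. coeff (p x) i) \<in> \<F>" for p
  proof (rule regular_matI)
    fix i j assume "i < m" "j < (1 :: nat)"
    then show "\<exists>f\<in>\<F>. \<forall>x\<in>S. f x = coeff_col m (p x) $$ (i, j)"
      using that by (intro bexI[of _ "\<lambda>x. coeff (p x) i"]) (auto simp: coeff_col_def)
  qed (rule coeff_col_carrier)
  have R: "regular_mat m m (\<lambda>_. rev_mat m)"
    by (rule regular_mat_const) (auto simp: rev_mat_def)
  have one: "regular_mat 2 2 (\<lambda>_. 1\<^sub>m 2)"
    by (rule regular_mat_const) auto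
  have "regular_mat (m + m) (m + m) (\<lambda>x. sl_mat m (\<alpha> x) (\<beta> x) (\<gamma> x) (\<delta> x))"
    unfolding sl_mat_def
    by (intro regular_mat_four_block regular_mat_mult[where k = m] R t assms)
  moreover have "regular_mat (m + m) (1 + 1) (\<lambda>x. trans_mat m (v1 x, v2 x) (w1 x, w2 x))"
    unfolding trans_mat_def fst_conv snd_conv
    by (intro regular_mat_four_block regular_mat_mult[where k = m] R c assms)
  ultimately show ?thesis
    unfolding aut0_mat.simps
    by (intro regular_mat_four_block regular_mat_zero one) (simp_all only: mult_2 one_add_one)
qed

end

lemma aut0_mat_in_lie_Aut:
  assumes "m \<ge> 1" "toeplitz m (\<alpha> * \<delta> - \<beta> * \<gamma>) = toeplitz m (1 :: 'a::field poly)"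
  shows "aut0_mat m (((\<alpha>, \<beta>), (\<gamma>, \<delta>)), (v, v')) \<in> carrier (lie_Aut m)"
proof -
  have "aut0_mat m (((\<alpha>, \<beta>), (\<gamma>, \<delta>)), (v, v')) \<in> carrier (lie_Aut0 m)"
    using assms(2) unfolding lie_Aut0_iff_aut0_mat[OF assms(1)] by blast
  then show ?thesis by (simp add: lie_Aut0_def)
qed

lemma aut0_mat_one: "aut0_mat m (((1, 0), (0, 1)), ((0, 0), (0, 0))) = (1\<^sub>m (lie_rank m) :: 'a::comm_ring_1 mat)"
proof -
  have z: "coeff_col m 0 = (0\<^sub>m m 1 :: 'a mat)" by (intro eq_matI) (auto simp: coeff_col_def)
  have "sl_mat m 1 0 0 1 = (1\<^sub>m (2 * m) :: 'a mat)"
    by (simp add: sl_mat_def toeplitz_0 toeplitz_1 rev_mat_square right_mult_one_mat[of _ m m]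
        right_mult_zero_mat[of _ m m] left_mult_zero_mat[of _ m m] mult_2)
  moreover have "trans_mat m (0, 0) (0, 0) = (0\<^sub>m (2 * m) 2 :: 'a mat)"
    by (simp add: trans_mat_def z right_mult_zero_mat[of _ m m] mult_2 del: One_nat_def)
  ultimately show ?thesis by (simp add: aut0_mat.simps)
qed

text \<open>Each of these lies on an affine line of automorphisms through the identity.\<close>

lemma joined_to_one_unipotent:
  fixes u v1 v2 w1 w2 :: "'a::field_char_0 poly"
  assumes m: "m \<ge> 1"
  shows "joined_to_one m (aut0_mat m (((1, u), (0, 1)), ((0, 0), (0, 0))))"
    and "joined_to_one m (aut0_mat m (((1, 0), (u, 1)), ((0, 0), (0, 0))))"
    and "joined_to_one m (aut0_mat m (((1, 0), (0, 1)), ((v1, v2), (w1, w2))))"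
proof -
  interpret R: regular_functions "UNIV :: 'a set" "{f. rational_on UNIV f}" by (rule regular_functions_rational_on)
  have rat: "rational_on UNIV (\<lambda>s. coeff (smult s p) i)" "rational_on UNIV (\<lambda>s. coeff (p :: 'a poly) i)" for p i
    by (auto intro: rational_on_mult rational_on_const rational_on_id)
  have line: "joined_to_one m (aut0_mat m (((1, p), (q, 1)), ((v1, v2), (w1, w2))))"
    if pq: "p * q = 0" for p q v1 v2 w1 w2 :: "'a poly"
  proof -
    let ?M = "\<lambda>s. aut0_mat m (((1, smult s p), (smult s q, 1)), ((smult s v1, smult s v2), (smult s w1, smult s w2)))"
    have "joined_to_one m (?M 1)"
    proof (rule joined_to_one_curve[where U = UNIV])
      fix s :: 'a
      have "1 * 1 - smult s p * smult s q = 1" using pq by simp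
      then show "?M s \<in> carrier (lie_Aut m)"
        by (intro aut0_mat_in_lie_Aut m) (simp only:)
    next
      fix i j assume ij: "i < lie_rank m" "j < lie_rank m"
      have "R.regular_mat (lie_rank m) (lie_rank m) ?M"
        by (intro R.regular_aut0_mat CollectI rat)
      from R.regular_mat_entry[OF this ij] show "rational_on UNIV (\<lambda>s. ?M s $$ (i, j))"
        by simp
    qed (simp_all add: aut0_mat_one)
    then show ?thesis by simp
  qed
  show "joined_to_one m (aut0_mat m (((1, u), (0, 1)), ((0, 0), (0, 0))))"
    "joined_to_one m (aut0_mat m (((1, 0), (u, 1)), ((0, 0), (0, 0))))"
    "joined_to_one m (aut0_mat m (((1, 0), (0, 1)), ((v1, v2), (w1, w2))))"
    by (intro line; simp)+
qed

lemma trunc_eq_iff_dvd: "trunc_eq m p q \<longleftrightarrow> monom 1 m dvd p - (q :: 'a::field poly)"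
  by (simp add: monom_1_dvd_iff' trunc_eq_def)

text \<open>
  The geometric series for \<open>1 / p\<close>, after scaling to constant term 1, terminates modulo \<open>t\<^sup>m\<close>.
\<close>

lemma trunc_inverse:
  assumes "coeff (p :: 'a::field poly) 0 \<noteq> 0"
  shows "\<exists>q. trunc_eq m (p * q) 1"
proof -
  define y where "y = 1 - smult (1 / coeff p 0) p"
  have "[:0, 1:] dvd y"
    using assms by (simp add: y_def dvd_iff_poly_eq_0 poly_0_coeff_0)
  then have "monom 1 m dvd y ^ m"
    by (simp add: monom_altdef dvd_power_same)
  moreover have "p * smult (1 / coeff p 0) (\<Sum>i<m. y ^ i) = 1 - y ^ m"
  proof -
    have "1 - y ^ m = (1 - y) * (\<Sum>i<m. y ^ i)" by (rule one_diff_power_eq)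
    also have "1 - y = smult (1 / coeff p 0) p" by (simp add: y_def)
    finally show ?thesis by simp
  qed
  ultimately have "trunc_eq m (p * smult (1 / coeff p 0) (\<Sum>i<m. y ^ i)) 1"
    by (simp add: trunc_eq_iff_dvd)
  then show ?thesis by blast
qed

text \<open>
  A matrix of determinant 1 whose lower left entry is a unit is the product of three elementary matrices.
\<close>

lemma joined_to_one_sl_unit:
  fixes \<alpha> \<beta> \<gamma> \<delta> :: "'a::field_char_0 poly"
  assumes m: "m \<ge> 1" and det: "trunc_eq m (\<alpha> * \<delta> - \<beta> * \<gamma>) 1" and unit: "coeff \<gamma> 0 \<noteq> 0"
  shows "joined_to_one m (aut0_mat m (((\<alpha>, \<beta>), (\<gamma>, \<delta>)), ((0, 0), (0, 0))))"
proof -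
  \<comment> \<open>\<open>\<eta>\<close> is an inverse of \<open>\<gamma>\<close>; the upper and lower diagonal entries determine \<open>?u\<close> and \<open>?w\<close>.\<close>
  obtain \<eta> where \<eta>: "trunc_eq m (\<gamma> * \<eta>) 1" using trunc_inverse[OF unit] by blast
  obtain D where D: "\<alpha> * \<delta> - \<beta> * \<gamma> - 1 = monom 1 m * D" using det by (auto simp: trunc_eq_iff_dvd)
  obtain e where e: "\<gamma> * \<eta> - 1 = monom 1 m * e" using \<eta> by (auto simp: trunc_eq_iff_dvd)
  let ?u = "(\<alpha> - 1) * \<eta>" and ?w = "(\<delta> - 1) * \<eta>"
  have "(1 + ?u * \<gamma>) - \<alpha> = (\<alpha> - 1) * (\<gamma> * \<eta> - 1)" by (simp add: algebra_simps)
  then have 1: "trunc_eq m (1 + ?u * \<gamma>) \<alpha>" unfolding trunc_eq_iff_dvd e by simp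
  have "(\<gamma> * ?w + 1) - \<delta> = (\<delta> - 1) * (\<gamma> * \<eta> - 1)" by (simp add: algebra_simps)
  then have 2: "trunc_eq m (\<gamma> * ?w + 1) \<delta>" unfolding trunc_eq_iff_dvd e by simp
  have "((1 + ?u * \<gamma>) * ?w + ?u) - \<beta> =
      \<eta> * (\<alpha> * \<delta> - \<beta> * \<gamma> - 1) + (\<beta> + (\<alpha> - 1) * ?w) * (\<gamma> * \<eta> - 1)"
    by (simp add: algebra_simps)
  then have 3: "trunc_eq m ((1 + ?u * \<gamma>) * ?w + ?u) \<beta>" unfolding trunc_eq_iff_dvd e D by simp
  have "aut0_mat m (((1, ?u), (0, 1)), ((0, 0), (0, 0))) * aut0_mat m (((1, 0), (\<gamma>, 1)), ((0, 0), (0, 0)))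
      * aut0_mat m (((1, ?w), (0, 1)), ((0, 0), (0, 0)))
    = aut0_mat m (((1 + ?u * \<gamma>, (1 + ?u * \<gamma>) * ?w + ?u), (\<gamma>, \<gamma> * ?w + 1)), ((0, 0), (0, 0)))"
    by (simp add: aut0_mat_mult)
  also have "\<dots> = aut0_mat m (((\<alpha>, \<beta>), (\<gamma>, \<delta>)), ((0, 0), (0, 0)))"
    unfolding aut0_mat_eq_iff using 1 2 3 by (simp add: trunc_eq_def)
  finally show ?thesis
    using joined_to_one_mult[OF joined_to_one_mult[OF joined_to_one_unipotent(1)[OF m, of ?u]
      joined_to_one_unipotent(2)[OF m, of \<gamma>]] joined_to_one_unipotent(1)[OF m, of ?w]] by simp
qed

text \<open>
  Over a local ring one of the entries of the first column is a unit; if it is the upper one only, adding the first row to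
  the second makes the lower one a unit.
\<close>

lemma joined_to_one_sl:
  fixes \<alpha> \<beta> \<gamma> \<delta> :: "'a::field_char_0 poly"
  assumes m: "m \<ge> 1" and det: "trunc_eq m (\<alpha> * \<delta> - \<beta> * \<gamma>) 1"
  shows "joined_to_one m (aut0_mat m (((\<alpha>, \<beta>), (\<gamma>, \<delta>)), ((0, 0), (0, 0))))"
proof (cases "coeff \<gamma> 0 = 0")
  case False
  then show ?thesis by (rule joined_to_one_sl_unit[OF m det])
next
  case True
  have "coeff (\<alpha> * \<delta> - \<beta> * \<gamma>) 0 = 1" using det m by (simp add: trunc_eq_def)
  then have "coeff \<alpha> 0 \<noteq> 0" using True by (auto simp: coeff_mult)
  then have "coeff (\<alpha> + \<gamma>) 0 \<noteq> 0" using True by simp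
  moreover have "\<alpha> * (\<beta> + \<delta>) - \<beta> * (\<alpha> + \<gamma>) = \<alpha> * \<delta> - \<beta> * \<gamma>" by (simp add: algebra_simps)
  then have "trunc_eq m (\<alpha> * (\<beta> + \<delta>) - \<beta> * (\<alpha> + \<gamma>)) 1" using det by simp
  ultimately have "joined_to_one m (aut0_mat m (((\<alpha>, \<beta>), (\<alpha> + \<gamma>, \<beta> + \<delta>)), ((0, 0), (0, 0))))"
    by (intro joined_to_one_sl_unit[OF m])
  from joined_to_one_mult[OF joined_to_one_unipotent(2)[OF m, of "- 1"] this]
  show ?thesis by (simp add: aut0_mat_mult)
qed

text \<open>
  An automorphism is the product of one that is trivial on the centre and modulo the centre, an element of
  \<open>SL\<^sub>2(k[t]/(t\<^sup>m))\<close> and a lift of its action on the centre.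
\<close>

theorem connected_lie_Aut:
  assumes m: "m \<ge> 1"
  shows "connected_space (subtopology (zariski (lie_rank m)) (carrier (lie_Aut m :: 'a::field_char_0 mat monoid)))"
proof -
  let ?G = "carrier (lie_Aut m :: 'a mat monoid)" and ?n = "lie_rank m"
  have joined: "joined_to_one m M" if MG: "M \<in> ?G" for M
  proof -
    interpret p: group_hom "lie_Aut m" B2 "centre_block m :: 'a mat \<Rightarrow> 'a mat"
      by (rule group_hom_centre_block[OF m])
    let ?b = "centre_block m M"
    have b: "?b \<in> carrier B2" by (rule p.hom_closed[OF MG])
    have s: "B2_section m ?b \<in> ?G" by (rule B2_section_in_lie_Aut[OF b m])
    define g where "g = M \<otimes>\<^bsub>lie_Aut m\<^esub> inv\<^bsub>lie_Aut m\<^esub> (B2_section m ?b)"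
    have gG: "g \<in> ?G" unfolding g_def by (intro p.G.m_closed p.G.inv_closed MG s)
    have "centre_block m g = \<one>\<^bsub>B2\<^esub>"
      unfolding g_def using MG s b centre_block_section[OF b]
      by (simp only: p.hom_mult p.G.inv_closed p.hom_inv p.H.r_inv)
    then have "g \<in> carrier (lie_Aut0 m)"
      using gG kernel_centre_block[OF m, where ?'a = 'a] by (auto simp: kernel_def)
    then obtain \<alpha> \<beta> \<gamma> \<delta> v v' where det: "toeplitz m (\<alpha> * \<delta> - \<beta> * \<gamma>) = toeplitz m (1 :: 'a poly)"
      and g: "g = aut0_mat m (((\<alpha>, \<beta>), (\<gamma>, \<delta>)), (v, v'))"
      unfolding lie_Aut0_iff_aut0_mat[OF m] by blast
    have "g = aut0_mat m (((1, 0), (0, 1)), (v, v')) * aut0_mat m (((\<alpha>, \<beta>), (\<gamma>, \<delta>)), ((0, 0), (0, 0)))"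
      unfolding g aut0_mat_mult by simp
    moreover have "joined_to_one m (aut0_mat m (((1, 0), (0, 1)), (v, v')))"
      using joined_to_one_unipotent(3)[OF m, of "fst v" "snd v" "fst v'" "snd v'"] by simp
    moreover have "joined_to_one m (aut0_mat m (((\<alpha>, \<beta>), (\<gamma>, \<delta>)), ((0, 0), (0, 0))))"
      using det by (intro joined_to_one_sl m) (simp add: trunc_eq_def toeplitz_eq_iff)
    ultimately have "joined_to_one m g" using joined_to_one_mult by simp
    then have "joined_to_one m (g * B2_section m ?b)"
      using joined_to_one_section[OF m b] by (rule joined_to_one_mult)
    moreover have "g * B2_section m ?b = M"
    proof -
      have "g \<otimes>\<^bsub>lie_Aut m\<^esub> B2_section m ?b = M"
        unfolding g_def using MG s by (simp only: p.G.m_assoc p.G.inv_closed p.G.l_inv p.G.r_one)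
      then show ?thesis by simp
    qed
    ultimately show ?thesis by simp
  qed
  let ?U = "{S. connectedin (zariski ?n) S \<and> S \<subseteq> ?G \<and> 1\<^sub>m ?n \<in> S}"
  have "connectedin (zariski ?n) (\<Union>?U)"
    by (rule connectedin_Union) auto
  moreover have "\<Union>?U = ?G"
    using joined unfolding joined_to_one_def by blast
  ultimately show ?thesis by (simp add: connectedin_def)
qed

section \<open>The structure of the automorphism group\<close>

theorem theorem1p10:
  fixes m :: nat
  assumes "m \<ge> 1"
  shows
    "carrier (lie_Aut0 m :: 'k::field_char_0 mat monoid) \<lhd> lie_Aut m
     \<and> (\<exists>(\<theta> :: 'k mat \<Rightarrow> 'k mat \<Rightarrow> 'k mat) (\<Phi> :: 'k mat \<times> 'k mat \<Rightarrow> 'k mat).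
          \<theta> \<in> hom B2 (AutoGroup (lie_Aut0 m))
          \<and> rat_morphism (carrier B2 \<times> carrier (lie_Aut0 m))
              (prod_coords (GL_coords 2) (GL_coords (lie_rank m))) (GL_coords (lie_rank m))
              (\<lambda>(b, g). \<theta> b g)
          \<and> rat_iso (semidirect B2 (lie_Aut0 m) \<theta>)
              (prod_coords (GL_coords 2) (GL_coords (lie_rank m)))
              (lie_Aut m) (GL_coords (lie_rank m)) \<Phi>
          \<and> (\<forall>g \<in> carrier (lie_Aut0 m). \<Phi> (\<one>\<^bsub>B2\<^esub>, g) = g))
     \<and> (lie_Aut0 m :: 'k mat monoid) \<cong> SL2_V_st_V_st (trunc_ring m :: 'k poly set ring)
     \<and> connected_space (subtopology (zariski (lie_rank m))
          (carrier (lie_Aut m :: 'k alg_closure mat monoid)))"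
proof -
  note m = assms
  let ?G = "lie_Aut m :: 'k mat monoid" and ?N = "lie_Aut0 m :: 'k mat monoid"
  interpret p: group_hom ?G B2 "centre_block m" by (rule group_hom_centre_block[OF m])
  interpret s: group_hom B2 ?G "B2_section m"
    by (rule group_hom.intro[OF group_B2 group_lie_Aut group_hom_axioms.intro[OF B2_section_hom[OF m]]])
  let ?\<theta> = "conj_action ?G (carrier ?N) (B2_section m)" and ?\<Phi> = "\<lambda>(b, g). g \<otimes>\<^bsub>?G\<^esub> B2_section m b"
  have N: "?G\<lparr>carrier := kernel ?G B2 (centre_block m)\<rparr> = ?N"
    unfolding kernel_centre_block[OF m] by (simp add: lie_Aut0_def)
  note split = split_extension[OF p.group_hom_axioms B2_section_hom[OF m] centre_block_section, unfolded N]
  have C: "carrier (semidirect B2 ?N ?\<theta>) = carrier B2 \<times> carrier ?N" by (simp add: semidirect_def)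
  have normal: "carrier ?N \<lhd> ?G"
    using p.normal_kernel unfolding kernel_centre_block[OF m] .
  have iso: "rat_iso (semidirect B2 ?N ?\<theta>) (prod_coords (GL_coords 2) (GL_coords (lie_rank m)))
      ?G (GL_coords (lie_rank m)) ?\<Phi>"
    unfolding rat_iso_def
  proof (intro conjI)
    show "?\<Phi> \<in> iso (semidirect B2 ?N ?\<theta>) ?G" by (rule split(2))
    show "rat_morphism (carrier (semidirect B2 ?N ?\<theta>)) (prod_coords (GL_coords 2) (GL_coords (lie_rank m)))
        (GL_coords (lie_rank m)) ?\<Phi>"
      unfolding C by (rule rat_morphism_conj_and_mult(2)[OF m])
    show "rat_morphism (carrier ?G) (GL_coords (lie_rank m)) (prod_coords (GL_coords 2) (GL_coords (lie_rank m)))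
        (inv_into (carrier (semidirect B2 ?N ?\<theta>)) ?\<Phi>)"
      using rat_morphism_decompose[OF m, where ?'k = 'k] split(3)
      unfolding rat_morphism_def by simp
  qed
  have "?\<Phi> (\<one>\<^bsub>B2\<^esub>, g) = g" if "g \<in> carrier ?N" for g
  proof -
    have "g \<in> carrier ?G" using that by (simp add: lie_Aut0_def)
    then show ?thesis using s.hom_one lie_Aut_carrier(1)[of g m] by simp
  qed
  then show ?thesis
    using normal split(1) rat_morphism_conj_and_mult(1)[OF m, where ?'k = 'k] iso
      lie_Aut0_iso[OF m, where ?'k = 'k] connected_lie_Aut[OF m, where ?'a = "'k alg_closure"]
    by blast
qed

end
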